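(* Let $\{\mathcal{F}\Phi,\mathcal{F}\varphi\}$ and $\{\mathcal{F}\Psi,\mathcal{F}\psi\}$ be two resolutions of unity, let $p\in\mathcal{P}^{\log}(\mathbb{R}^n)$ and $\alpha\in C^{\log}_{\mathrm{loc}}(\mathbb{R}^n)$, and let $q\in\mathcal{P}(\mathbb{R})$ be log-Hölder continuous at the origin. Then $$\|f\|^{\Phi,\varphi}_{\boldsymbol{B}^{\alpha(\cdot)}_{p(\cdot),q(\cdot)}}\approx\|f\|^{\Psi,\psi}_{\boldsymbol{B}^{\alpha(\cdot)}_{p(\cdot),q(\cdot)}},$$ that is, there are constants $c,C>0$ such that for all $f\in\mathcal{S}'(\mathbb{R}^n)$ (both sides being allowed to be $+\infty$) $$c\,\|f\|^{\Phi,\varphi}_{\boldsymbol{B}^{\alpha(\cdot)}_{p(\cdot),q(\cdot)}}\le\|f\|^{\Psi,\psi}_{\boldsymbol{B}^{\alpha(\cdot)}_{p(\cdot),q(\cdot)}}\le C\,\|f\|^{\Phi,\varphi}_{\boldsymbol{B}^{\alpha(\cdot)}_{p(\cdot),q(\cdot)}}.$$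
   Context: Exponents. $\mathcal{P}(\mathbb{R}^d)$ is the set of measurable functions $\mathbb{R}^d\to[1,\infty)$. For $p\in\mathcal{P}(\mathbb{R}^n)$, $\|f\|_{p(\cdot)}:=\inf\{\lambda>0:\int_{\mathbb{R}^n}|f(x)/\lambda|^{p(x)}dx\le1\}$. For $q\in\mathcal{P}(\mathbb{R})$ and measurable $g$ on an interval $I\subset(0,1]$, $\|g(t)\|_{L^{q(\cdot)}(I,dt/t)}:=\inf\{\lambda>0:\int_I|g(t)/\lambda|^{q(t)}\frac{dt}{t}\le1\}$. Log-Hölder conditions. $g\in C^{\log}_{\mathrm{loc}}(\mathbb{R}^n)$ means $g:\mathbb{R}^n\to\mathbb{R}$ and there is $c_{\log}(g)>0$ with $|g(x)-g(y)|\le\frac{c_{\log}(g)}{\log(e+1/|x-y|)}$ for all $x,y\in\mathbb{R}^n$. $g$ is log-Hölder continuous at the origin if there is $c>0$ with $|g(x)-g(0)|\le\frac{c}{\log(e+1/|x|)}$ for all $x$. $g\in C^{\log}(\mathbb{R}^n)$ if $g\in C^{\log}_{\mathrm{loc}}(\mathbb{R}^n)$ and there are $g_\infty\in\mathbb{R}$, $c>0$ with $|g(x)-g_\infty|\le\frac{c}{\log(e+|x|)}$ for all $x$. $\mathcal{P}^{\log}(\mathbb{R}^n):=\{p\in\mathcal{P}(\mathbb{R}^n):1/p\in C^{\log}(\mathbb{R}^n)\}$. Resolution of unity. $\mathcal{F}$ is the Fourier transform, normalised so that $\mathcal{F}(f*g)=\mathcal{F}f\,\mathcal{F}g$. A pair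 $\{\mathcal{F}\Phi,\mathcal{F}\varphi\}$ with $\Phi,\varphi\in\mathcal{S}(\mathbb{R}^n)$ is a resolution of unity if $\operatorname{supp}\mathcal{F}\Phi\subset\{|x|<2\}$, $\operatorname{supp}\mathcal{F}\varphi\subset\{\frac12<|x|<2\}$ and $\mathcal{F}\Phi(\xi)+\int_0^1\mathcal{F}\varphi(t\xi)\frac{dt}{t}=1$ for all $\xi\in\mathbb{R}^n$. Put $\varphi_t:=t^{-n}\varphi(\cdot/t)$. Besov norm. For a resolution of unity $\{\mathcal{F}\Phi,\mathcal{F}\varphi\}$ and $f\in\mathcal{S}'(\mathbb{R}^n)$, $$\|f\|^{\Phi,\varphi}_{\boldsymbol{B}^{\alpha(\cdot)}_{p(\cdot),q(\cdot)}}:=\|\Phi*f\|_{p(\cdot)}+\Big\|\,\|t^{-\alpha(\cdot)}(\varphi_t*f)\|_{p(\cdot)}\Big\|_{L^{q(\cdot)}((0,1],\frac{dt}{t})},$$ and $\|f\|^{\Psi,\psi}_{\boldsymbol{B}^{\alpha(\cdot)}_{p(\cdot),q(\cdot)}}$ is the same with $\Psi,\psi$ in place of $\Phi,\varphi$. *)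

theory Defs
  imports "HOL-Analysis.Analysis"
begin

text \<open>
  \<open>\<real>\<^sup>n\<close> is rendered as an arbitrary type \<open>'a :: euclidean_space\<close>, with \<open>n = DIM('a)\<close>.
  Norms take values in \<open>ennreal\<close>, so that \<open>Inf {} = \<infinity>\<close>.
\<close>

section \<open>Variable exponents\<close>

definition var_exponents :: "('a::euclidean_space \<Rightarrow> real) set" where
  "var_exponents = {p. p \<in> borel_measurable lebesgue \<and> (\<forall>x. 1 \<le> p x)}"

text \<open>Only used for exponents \<open>r \<ge> 1\<close>.\<close>
definition enn_powr :: "ennreal \<Rightarrow> real \<Rightarrow> ennreal" where
  "enn_powr a r = (if a = \<infinity> then \<infinity> else ennreal (enn2real a powr r))"

definition Lp_norm :: "('a::euclidean_space \<Rightarrow> real) \<Rightarrow> ('a \<Rightarrow> complex) \<Rightarrow> ennreal" where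
  "Lp_norm p f = Inf {ennreal l | l. 0 < l \<and>
     (\<integral>\<^sup>+x. ennreal ((norm (f x) / l) powr p x) \<partial>lebesgue) \<le> 1}"

text \<open>The argument \<open>g\<close> will be a norm and may therefore be infinite.\<close>
definition Lq_norm_dt :: "(real \<Rightarrow> real) \<Rightarrow> real set \<Rightarrow> (real \<Rightarrow> ennreal) \<Rightarrow> ennreal" where
  "Lq_norm_dt q I g = Inf {ennreal l | l. 0 < l \<and>
     (\<integral>\<^sup>+t\<in>I. enn_powr (g t / ennreal l) (q t) * ennreal (1 / t) \<partial>lebesgue) \<le> 1}"

section \<open>Log-Hoelder conditions\<close>

text \<open>
  For \<open>x = y\<close> (respectively \<open>x = 0\<close>), where \<open>1 / 0 = 0\<close> in HOL, the left-hand side of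
  the inequality vanishes, so that it holds trivially.
\<close>

definition Clog_loc :: "('a::euclidean_space \<Rightarrow> real) set" where
  "Clog_loc = {g. \<exists>c>0. \<forall>x y. \<bar>g x - g y\<bar> \<le> c / ln (exp 1 + 1 / norm (x - y))}"

definition log_Hoelder_at_0 :: "('a::euclidean_space \<Rightarrow> real) \<Rightarrow> bool" where
  "log_Hoelder_at_0 g \<longleftrightarrow> (\<exists>c>0. \<forall>x. \<bar>g x - g 0\<bar> \<le> c / ln (exp 1 + 1 / norm x))"

definition Clog :: "('a::euclidean_space \<Rightarrow> real) set" where
  "Clog = {g \<in> Clog_loc. \<exists>g_inf. \<exists>c>0. \<forall>x. \<bar>g x - g_inf\<bar> \<le> c / ln (exp 1 + norm x)}"

definition log_exponents :: "('a::euclidean_space \<Rightarrow> real) set" where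
  "log_exponents = {p \<in> var_exponents. (\<lambda>x. 1 / p x) \<in> Clog}"

section \<open>Schwartz functions and tempered distributions\<close>

text \<open>
  A multi-index is represented by a list of basis vectors, the directions of the successive
  partial derivatives. For a function all of whose iterated partial derivatives are
  differentiable (that is, a smooth function), the order of the list does not matter.
\<close>
primrec iter_partial :: "'a::euclidean_space list \<Rightarrow> ('a \<Rightarrow> complex) \<Rightarrow> 'a \<Rightarrow> complex" where
  "iter_partial [] f = f"
| "iter_partial (b # bs) f = (\<lambda>x. frechet_derivative (iter_partial bs f) (at x) b)"

definition smooth :: "('a::euclidean_space \<Rightarrow> complex) \<Rightarrow> bool" where
  "smooth f \<longleftrightarrow> (\<forall>bs. set bs \<subseteq> Basis \<longrightarrow> (\<forall>x. iter_partial bs f differentiable (at x)))"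

definition Schwartz :: "('a::euclidean_space \<Rightarrow> complex) set" where
  "Schwartz = {f. smooth f \<and>
     (\<forall>N bs. set bs \<subseteq> Basis \<longrightarrow> bdd_above (range (\<lambda>x. (1 + norm x) ^ N * norm (iter_partial bs f x))))}"

definition Schwartz_seminorm :: "nat \<Rightarrow> 'a::euclidean_space list \<Rightarrow> ('a \<Rightarrow> complex) \<Rightarrow> real" where
  "Schwartz_seminorm N bs f = (SUP x. (1 + norm x) ^ N * norm (iter_partial bs f x))"

definition Schwartz_topology :: "('a::euclidean_space \<Rightarrow> complex) topology" where
  "Schwartz_topology = topology_generated_by
     {{g \<in> Schwartz. Schwartz_seminorm N bs (\<lambda>x. g x - h x) < e} | N bs h e.
        set bs \<subseteq> Basis \<and> h \<in> Schwartz \<and> 0 < e}"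

lemma topspace_Schwartz_topology:
  "topspace (Schwartz_topology :: ('a::euclidean_space \<Rightarrow> complex) topology) = Schwartz"
proof -
  have "g \<in> \<Union>{{g \<in> Schwartz. Schwartz_seminorm N bs (\<lambda>x. g x - h x) < e} | N bs h e.
      set bs \<subseteq> Basis \<and> h \<in> Schwartz \<and> 0 < e}"
    if g: "g \<in> Schwartz" for g :: "'a \<Rightarrow> complex"
  proof (rule UnionI)
    show "{k \<in> Schwartz. Schwartz_seminorm 0 [] (\<lambda>x. k x - g x) < 1} \<in>
        {{g \<in> Schwartz. Schwartz_seminorm N bs (\<lambda>x. g x - h x) < e} | N bs h e.
          set bs \<subseteq> Basis \<and> h \<in> Schwartz \<and> 0 < e}"
      by (rule CollectI, rule exI[of _ 0], rule exI[of _ "[]"], rule exI[of _ g], rule exI[of _ 1])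
        (simp add: g)
    show "g \<in> {k \<in> Schwartz. Schwartz_seminorm 0 [] (\<lambda>x. k x - g x) < 1}"
      using g by (simp add: Schwartz_seminorm_def)
  qed
  moreover have "\<Union>{{g \<in> Schwartz. Schwartz_seminorm N bs (\<lambda>x. g x - h x) < e} | N bs h e.
      set bs \<subseteq> Basis \<and> h \<in> Schwartz \<and> 0 < e} \<subseteq> (Schwartz :: ('a \<Rightarrow> complex) set)"
    by (rule Union_least) auto
  ultimately show ?thesis
    unfolding Schwartz_topology_def topology_generated_by_topspace by (intro equalityI subsetI) auto
qed

text \<open>Only the values of a functional on Schwartz functions are relevant.\<close>
definition tempered_distributions :: "(('a::euclidean_space \<Rightarrow> complex) \<Rightarrow> complex) set" where
  "tempered_distributions = {f.
     (\<forall>g\<in>Schwartz. \<forall>h\<in>Schwartz. f (\<lambda>x. g x + h x) = f g + f h) \<and>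
     (\<forall>a. \<forall>g\<in>Schwartz. f (\<lambda>x. a * g x) = a * f g) \<and>
     continuous_map Schwartz_topology euclidean f}"

definition conv_dist :: "('a::euclidean_space \<Rightarrow> complex) \<Rightarrow> (('a \<Rightarrow> complex) \<Rightarrow> complex) \<Rightarrow> 'a \<Rightarrow> complex" where
  "conv_dist g f x = f (\<lambda>y. g (x - y))"

section \<open>Resolutions of unity and the Besov norm\<close>

definition Fourier :: "('a::euclidean_space \<Rightarrow> complex) \<Rightarrow> 'a \<Rightarrow> complex" where
  "Fourier f \<xi> = (LINT x|lborel. cis (- (x \<bullet> \<xi>)) * f x)"

definition supp :: "('a::euclidean_space \<Rightarrow> complex) \<Rightarrow> 'a set" where
  "supp f = closure {x. f x \<noteq> 0}"

text \<open>
  The integral always converges: its integrand vanishes for \<open>t \<bar>\<xi>\<bar> < 1/2\<close>.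
\<close>
definition resolution_of_unity :: "('a::euclidean_space \<Rightarrow> complex) \<Rightarrow> ('a \<Rightarrow> complex) \<Rightarrow> bool" where
  "resolution_of_unity \<Phi> \<phi> \<longleftrightarrow>
     \<Phi> \<in> Schwartz \<and> \<phi> \<in> Schwartz \<and>
     supp (Fourier \<Phi>) \<subseteq> {x. norm x < 2} \<and>
     supp (Fourier \<phi>) \<subseteq> {x. 1 / 2 < norm x \<and> norm x < 2} \<and>
     (\<forall>\<xi>. Fourier \<Phi> \<xi> + (LINT t:{0<..1}|lborel. Fourier \<phi> (t *\<^sub>R \<xi>) / complex_of_real t) = 1)"

definition dilate :: "real \<Rightarrow> ('a::euclidean_space \<Rightarrow> complex) \<Rightarrow> 'a \<Rightarrow> complex" where
  "dilate t g x = g (x /\<^sub>R t) / complex_of_real (t ^ DIM('a))"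

definition Besov_norm :: "('a::euclidean_space \<Rightarrow> complex) \<Rightarrow> ('a \<Rightarrow> complex) \<Rightarrow>
    ('a \<Rightarrow> real) \<Rightarrow> ('a \<Rightarrow> real) \<Rightarrow> (real \<Rightarrow> real) \<Rightarrow> (('a \<Rightarrow> complex) \<Rightarrow> complex) \<Rightarrow> ennreal" where
  "Besov_norm \<Phi> \<phi> \<alpha> p q f =
     Lp_norm p (conv_dist \<Phi> f) +
     Lq_norm_dt q {0<..1}
       (\<lambda>t. Lp_norm p (\<lambda>x. complex_of_real (t powr (- \<alpha> x)) * conv_dist (dilate t \<phi>) f x))"

end

theory Submission
  imports Defs "HOL-Probability.Probability"
begin

text \<open>
  The statement is symmetric, so it suffices to bound the norm built on \<open>\<Phi>, \<phi>\<close> by the one built on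
  \<open>\<Psi>, \<psi>\<close>. Comparing Fourier transforms, \<open>\<phi>\<^sub>t\<close> is the sum of \<open>\<phi>\<^sub>t * \<Psi>\<close>, which vanishes for \<open>t < 1/4\<close>, and of
  the integral of \<open>\<phi>\<^sub>t * \<psi>\<^sub>\<tau>\<close> with respect to \<open>d\<tau>/\<tau>\<close> over \<open>t/4 \<le> \<tau> \<le> min 1 (4 t)\<close>. Applied to \<open>f\<close>, this bounds
  \<open>\<bar>\<phi>\<^sub>t * f\<bar>\<close> by averages of \<open>\<bar>\<psi>\<^sub>\<tau> * f\<bar>\<close> against the rapidly decreasing kernel \<open>\<bar>\<phi>\<^sub>t\<bar>\<close>.

  Such averages are bounded in the variable exponent space, uniformly in \<open>t\<close>, without any maximal
  function. With \<open>s = 1 / p(x)\<close> and \<open>a\<close> a smoothed version of the modular density \<open>\<bar>f\<bar>\<^sup>p\<close>, the elementary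
  inequality \<open>u powr s \<le> a powr (s - 1) * u + a powr s\<close> replaces Jensen's inequality, and the log-Hoelder
  conditions allow one to pass from the exponent \<open>1 / p(y)\<close> to \<open>1 / p(x)\<close> at the cost of a power of
  \<open>1 + \<bar>x - y\<bar> / t\<close>, which the decay of the kernel absorbs. The same inequality with \<open>s = 1 / q(t)\<close> treats
  the integration in \<open>t\<close>, where log-Hoelder continuity at the origin is enough because the averages over
  the scales near \<open>1\<close> are bounded.
\<close>

section \<open>Luxemburg norms\<close>

text \<open>What lets \<open>powr_Young\<close> replace Jensen's inequality is that \<open>a\<close>
  is, up to harmless additional terms, the average of the very density \<open>u\<close> to which it
  is applied. Averaging \<open>a powr (s - 1) * u + a powr s\<close> then gives a multiple of
  \<open>a powr s\<close>; the power \<open>1 / s\<close> of this is \<open>a\<close> again, and the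
  integral of \<open>a\<close> is computed by Fubini. As \<open>p\<close> may be unbounded, the
  multiple must never be raised to the power \<open>p x\<close>: every constant is first moved into
  the Luxemburg norm, where \<open>1 \<le> p\<close> is enough to handle it. The second difficulty
  is to apply \<open>f\<close> under the integral of the reproducing formula. What the estimates use
  is an inequality: the value of \<open>f\<close> at an integral of Schwartz functions is at most
  the integral of the absolute values. It rests on the finitely many seminorms that control
  \<open>f\<close>, while the integral itself is a concrete Schwartz function, identified through
  its Fourier transform. The factor 4 in all scale ranges comes from the annuli
  \<open>1 / 2 < norm x < 2\<close>: dilated by \<open>t\<close> and by \<tau>, they meet only if
  \<open>t / 4 < \<tau> < 4 * t\<close>.\<close>

lemma Lp_norm_leI:
  assumes "0 < l" "(\<integral>\<^sup>+x. ennreal ((norm (f x) / l) powr p x) \<partial>lborel) \<le> 1"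
  shows "Lp_norm p f \<le> ennreal l"
  unfolding Lp_norm_def using assms by (intro Inf_lower) (auto simp: nn_integral_completion)

text \<open>Strictness yields an admissible value below \<open>l\<close>, and the modular decreases
  in the scaling factor, so it does not matter whether the infimum is attained. Later proofs
  therefore enlarge a norm by an arbitrary positive amount before they use its modular.\<close>

lemma Lp_norm_less_imp:
  assumes p: "\<And>x. 0 \<le> p x" and l: "0 < l" and less: "Lp_norm p f < ennreal l"
  shows "(\<integral>\<^sup>+x. ennreal ((norm (f x) / l) powr p x) \<partial>lborel) \<le> 1"
proof -
  from less obtain k where k: "0 < k" "ennreal k < ennreal l"
     "(\<integral>\<^sup>+x. ennreal ((norm (f x) / k) powr p x) \<partial>lborel) \<le> 1"
    unfolding Lp_norm_def Inf_less_iff by (auto simp: nn_integral_completion)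
  then have kl: "k < l" by (simp add: ennreal_less_iff)
  have "(\<integral>\<^sup>+x. ennreal ((norm (f x) / l) powr p x) \<partial>lborel)
      \<le> (\<integral>\<^sup>+x. ennreal ((norm (f x) / k) powr p x) \<partial>lborel)"
    using k kl l p by (intro nn_integral_mono ennreal_leI powr_mono2 divide_left_mono) auto
  with k show ?thesis by simp
qed

text \<open>Since \<open>1 \<le> p x\<close> and \<open>1 \<le> C\<close>, dividing the function by
  \<open>C\<close> divides the integrand by at least \<open>C\<close>. A modular bound
  \<open>C\<close> thus costs only the factor \<open>C\<close> in the norm, even for unbounded
  \<open>p\<close>. Measurability is asked of the majorant \<open>A\<close>, because the function
  itself is arbitrary in the applications.\<close>

lemma Lp_norm_leI_dominated:
  assumes p: "\<And>x. 1 \<le> p x" and l: "0 < l" and C: "1 \<le> C"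
    and A: "A \<in> borel_measurable borel"
    and le: "\<And>x. ennreal ((norm (f x) / l) powr p x) \<le> A x"
    and int: "(\<integral>\<^sup>+x. A x \<partial>lborel) \<le> ennreal C"
  shows "Lp_norm p f \<le> ennreal (C * l)"
proof (rule Lp_norm_leI)
  have "(\<integral>\<^sup>+x. ennreal ((norm (f x) / (C * l)) powr p x) \<partial>lborel) \<le> (\<integral>\<^sup>+x. ennreal (1 / C) * A x \<partial>lborel)"
  proof (rule nn_integral_mono)
    fix x
    have "(norm (f x) / (C * l)) powr p x = C powr (- p x) * (norm (f x) / l) powr p x"
      using C l by (simp add: powr_divide powr_mult powr_minus field_simps)
    also have "\<dots> \<le> C powr (- 1) * (norm (f x) / l) powr p x"
      using C p[of x] by (intro mult_right_mono powr_mono) auto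
    finally have "ennreal ((norm (f x) / (C * l)) powr p x)
        \<le> ennreal (1 / C * (norm (f x) / l) powr p x)"
      using C by (intro ennreal_leI) (simp add: powr_minus divide_inverse)
    also have "\<dots> = ennreal (1 / C) * ennreal ((norm (f x) / l) powr p x)"
      using C by (intro ennreal_mult) auto
    also have "\<dots> \<le> ennreal (1 / C) * A x" by (intro mult_left_mono le) auto
    finally show "ennreal ((norm (f x) / (C * l)) powr p x) \<le> ennreal (1 / C) * A x" .
  qed
  also have "\<dots> = ennreal (1 / C) * (\<integral>\<^sup>+x. A x \<partial>lborel)"
    using A by (intro nn_integral_cmult) auto
  also have "\<dots> \<le> ennreal (1 / C) * ennreal C" by (intro mult_left_mono int) auto
  also have "\<dots> = 1" using C by (simp flip: ennreal_mult)
  finally show "(\<integral>\<^sup>+x. ennreal ((norm (f x) / (C * l)) powr p x) \<partial>lborel) \<le> 1" .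
qed (use C l in auto)

lemma Lp_norm_mono_scaled:
  assumes p: "\<And>x. 0 \<le> p x" and c: "0 < c" and le: "\<And>x. norm (f x) \<le> c * norm (g x)"
  shows "Lp_norm p f \<le> ennreal c * Lp_norm p g"
proof (cases "Lp_norm p g = \<infinity>")
  case True
  then show ?thesis using c by (simp add: ennreal_mult_top)
next
  case False
  show ?thesis
  proof (rule ennreal_le_epsilon)
    fix e :: real assume e: "0 < e"
    obtain l where l: "Lp_norm p g = ennreal l" "0 \<le> l"
      using False by (cases "Lp_norm p g") auto
    define k where "k = l + e / c"
    have k: "0 < k" "Lp_norm p g < ennreal k"
      using l e c by (auto simp: k_def ennreal_less_iff add_nonneg_pos)
    have "Lp_norm p f \<le> ennreal (c * k)"
    proof (rule Lp_norm_leI)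
      have "(\<integral>\<^sup>+x. ennreal ((norm (f x) / (c * k)) powr p x) \<partial>lborel)
          \<le> (\<integral>\<^sup>+x. ennreal ((norm (g x) / k) powr p x) \<partial>lborel)"
        using p c k le by (intro nn_integral_mono ennreal_leI powr_mono2) (auto simp: field_simps)
      also have "\<dots> \<le> 1" using k p by (intro Lp_norm_less_imp)
      finally show "(\<integral>\<^sup>+x. ennreal ((norm (f x) / (c * k)) powr p x) \<partial>lborel) \<le> 1" .
    qed (use c k in auto)
    also have "\<dots> = ennreal c * Lp_norm p g + ennreal e"
      using c e l by (simp add: k_def algebra_simps ennreal_plus ennreal_mult)
    finally show "Lp_norm p f \<le> ennreal c * Lp_norm p g + ennreal e" .
  qed
qed

text \<open>The mean of two numbers is at most their maximum, and the power of the maximum is at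
  most the sum of the powers. This bounds the modular by 2 at twice the sum of the norms, hence the
  factor \<open>2 * 2\<close>.\<close>

lemma Lp_norm_triangle:
  assumes p: "\<And>x. 1 \<le> p x" and [measurable]: "p \<in> borel_measurable borel"
    and [measurable]: "f \<in> borel_measurable borel" "g \<in> borel_measurable borel"
    and le: "\<And>x. norm (F x) \<le> norm (f x) + norm (g x)"
  shows "Lp_norm p F \<le> 4 * (Lp_norm p f + Lp_norm p g)"
proof (cases "Lp_norm p f = \<infinity> \<or> Lp_norm p g = \<infinity>")
  case True
  then show ?thesis by (auto simp: ennreal_mult_top)
next
  case False
  then obtain a b where ab: "Lp_norm p f = ennreal a" "Lp_norm p g = ennreal b" "0 \<le> a" "0 \<le> b"
    by (cases "Lp_norm p f"; cases "Lp_norm p g") auto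
  have p0: "\<And>x. 0 \<le> p x" using p order_trans zero_le_one by blast
  show ?thesis
  proof (rule ennreal_le_epsilon)
    fix e :: real assume e: "0 < e"
    define k where "k = a + b + e / 4"
    have k: "0 < k" "Lp_norm p f < ennreal k" "Lp_norm p g < ennreal k"
      using ab e by (auto simp: k_def ennreal_less_iff add_nonneg_pos add_pos_nonneg)
    have "Lp_norm p F \<le> ennreal (2 * (2 * k))"
    proof (rule Lp_norm_leI_dominated[where A="\<lambda>x. ennreal ((norm (f x) / k) powr p x)
          + ennreal ((norm (g x) / k) powr p x)"])
      fix x
      have "norm (F x) / (2 * k) \<le> (norm (f x) + norm (g x)) / (2 * k)"
        using k le by (intro divide_right_mono) auto
      also have "\<dots> \<le> max (norm (f x) / k) (norm (g x) / k)"
        using k by (auto simp: field_simps max_def)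
      finally have "(norm (F x) / (2 * k)) powr p x \<le> (max (norm (f x) / k) (norm (g x) / k)) powr p x"
        using p0 k by (intro powr_mono2) auto
      also have "\<dots> \<le> (norm (f x) / k) powr p x + (norm (g x) / k) powr p x"
        by (auto simp: max_def)
      finally show "ennreal ((norm (F x) / (2 * k)) powr p x)
        \<le> ennreal ((norm (f x) / k) powr p x) + ennreal ((norm (g x) / k) powr p x)"
        by (simp add: ennreal_leI flip: ennreal_plus)
    next
      have "(\<integral>\<^sup>+x. ennreal ((norm (f x) / k) powr p x) + ennreal ((norm (g x) / k) powr p x) \<partial>lborel) =
         (\<integral>\<^sup>+x. ennreal ((norm (f x) / k) powr p x) \<partial>lborel) + (\<integral>\<^sup>+x. ennreal ((norm (g x) / k) powr p x) \<partial>lborel)"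
        by (intro nn_integral_add) auto
      also have "\<dots> \<le> 1 + 1"
        using k p0 by (intro add_mono Lp_norm_less_imp) auto
      finally show "(\<integral>\<^sup>+x. ennreal ((norm (f x) / k) powr p x) + ennreal ((norm (g x) / k) powr p x) \<partial>lborel)
         \<le> ennreal 2" by simp
    qed (use k p in auto)
    also have "\<dots> = 4 * (Lp_norm p f + Lp_norm p g) + ennreal e"
    proof -
      have "ennreal (2 * (2 * k)) = ennreal (4 * (a + b) + e)" by (simp add: k_def algebra_simps)
      also have "\<dots> = ennreal 4 * (ennreal a + ennreal b) + ennreal e"
        using ab e by (simp only: ennreal_plus ennreal_mult add_nonneg_nonneg mult_nonneg_nonneg less_imp_le zero_le_numeral)
      finally show ?thesis using ab by simp
    qed
    finally show "Lp_norm p F \<le> 4 * (Lp_norm p f + Lp_norm p g) + ennreal e" .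
  qed
qed

lemma borel_measurable_Lp_norm:
  assumes p: "\<And>x. 0 \<le> p x" and [measurable]: "p \<in> borel_measurable borel"
    and V[measurable]: "(\<lambda>(\<tau>, x). V \<tau> x) \<in> borel_measurable (M \<Otimes>\<^sub>M borel)"
  shows "(\<lambda>\<tau>. Lp_norm p (V \<tau>)) \<in> borel_measurable M"
proof (rule borel_measurableI_less)
  fix c :: ennreal
  define S where "S l = {\<tau> \<in> space M. (\<integral>\<^sup>+x. ennreal ((norm (V \<tau> x) / l) powr p x) \<partial>lborel) \<le> 1}" for l
  have [measurable]: "S l \<in> sets M" for l unfolding S_def by measurable
  \<comment> \<open>Monotonicity of the modular in \<open>l\<close> makes rational values of
    \<open>l\<close> sufficient, so the sublevel set is a countable union.\<close>
  have "{\<tau> \<in> space M. Lp_norm p (V \<tau>) < c} = (\<Union>l\<in>{l\<in>\<rat>. 0 < l \<and> ennreal l < c}. S l)"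
  proof (intro equalityI subsetI)
    fix \<tau> assume "\<tau> \<in> {\<tau> \<in> space M. Lp_norm p (V \<tau>) < c}"
    then have t: "\<tau> \<in> space M" "Lp_norm p (V \<tau>) < c" by auto
    obtain d where d: "Lp_norm p (V \<tau>) < d" "d < c" using t dense by blast
    obtain r where r: "Lp_norm p (V \<tau>) = ennreal r" "0 \<le> r" using d by (cases "Lp_norm p (V \<tau>)") auto
    obtain r' where r': "d = ennreal r'" "0 \<le> r'" using d by (cases d) auto
    have "r < r'" using d r r' by (simp add: ennreal_less_iff)
    then obtain l where l: "l \<in> \<rat>" "r < l" "l < r'" using Rats_dense_in_real by blast
    have "Lp_norm p (V \<tau>) < ennreal l" "0 < l" using l r by (auto simp: ennreal_less_iff)
    moreover have "ennreal l < c" using l r' d \<open>0 < l\<close>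
      by (metis ennreal_less_iff less_imp_le order.strict_trans)
    ultimately show "\<tau> \<in> (\<Union>l\<in>{l\<in>\<rat>. 0 < l \<and> ennreal l < c}. S l)"
      using l t p by (auto simp: S_def intro!: Lp_norm_less_imp bexI[of _ l])
  next
    fix \<tau> assume "\<tau> \<in> (\<Union>l\<in>{l\<in>\<rat>. 0 < l \<and> ennreal l < c}. S l)"
    then obtain l where "0 < l" "ennreal l < c" "\<tau> \<in> S l" by auto
    then show "\<tau> \<in> {\<tau> \<in> space M. Lp_norm p (V \<tau>) < c}"
      using Lp_norm_leI[of l "V \<tau>" p] by (auto simp: S_def)
  qed
  moreover have "countable {l\<in>\<rat>. 0 < l \<and> ennreal l < c}"
    by (rule countable_subset[OF _ countable_rat]) auto
  ultimately show "{\<tau> \<in> space M. Lp_norm p (V \<tau>) < c} \<in> sets M" by auto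
qed

text \<open>For \<open>u > a\<close> the factor \<open>u powr (s - 1)\<close> is at most
  \<open>a powr (s - 1)\<close>, because \<open>s \<le> 1\<close>. The bound is affine in
  \<open>u\<close>, so it can be integrated with \<open>a\<close> held fixed; if \<open>a\<close> is
  the mean of \<open>u\<close>, both terms average to \<open>a powr s\<close>.\<close>

lemma powr_Young:
  fixes u a s :: real
  assumes "0 \<le> u" "0 < a" "0 \<le> s" "s \<le> 1"
  shows "u powr s \<le> a powr (s - 1) * u + a powr s"
proof (cases "u \<le> a")
  case True
  then have "u powr s \<le> a powr s" using assms by (intro powr_mono2) auto
  then show ?thesis using assms by (simp add: add_increasing)
next
  case False
  then have "u powr s = u powr (s - 1) * u" using assms by (simp add: powr_diff)
  also have "\<dots> \<le> a powr (s - 1) * u" using False assms by (intro mult_right_mono powr_mono2') auto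
  finally show ?thesis by (simp add: add_increasing2)
qed

section \<open>Convolutions in variable exponent spaces\<close>

text \<open>
  For \<open>r = 0\<close> the bound on \<open>d\<close> reads \<open>\<bar>d\<bar> \<le> c\<close>, because of \<open>1 / 0 = 0\<close>; hence the last premise.
\<close>
lemma powr_log_Hoelder_le:
  fixes t r d c :: real
  assumes t: "0 < t" "t \<le> 1" and r: "0 \<le> r" and c: "0 \<le> c"
    and d: "\<bar>d\<bar> \<le> c / ln (exp 1 + 1 / r)" and d0: "r = 0 \<Longrightarrow> d = 0"
  shows "t powr d \<le> exp (2 * c) * (1 + r / t) powr (2 * c)"
proof (cases "r = 0")
  case True
  then show ?thesis using d0 t c by simp
next
  case False
  with r have r0: "0 < r" by simp
  define L where "L = ln (exp 1 + 1 / r)"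
  have L1: "1 \<le> L" unfolding L_def using r0 by (subst ln_ge_iff) (auto intro: add_pos_pos)
  have lnt: "0 \<le> ln (1 / t)" using t by simp
  \<comment> \<open>If the square of \<open>r\<close> is at most \<open>t\<close>, then
    \<open>ln (1 / t)\<close> is at most \<open>2 * L\<close> and the denominator absorbs it;
    otherwise \<open>1 / t\<close> is at most the square of \<open>r / t\<close>, which a power of
    \<open>1 + r / t\<close> absorbs.\<close>
  have "\<bar>d\<bar> * ln (1 / t) \<le> 2 * c + 2 * c * ln (1 + r / t)"
  proof (cases "r\<^sup>2 \<le> t")
    case True
    have "ln (1 / t) \<le> ln (1 / r\<^sup>2)" using True t r0 by (subst ln_le_cancel_iff) (auto simp: field_simps)
    also have "\<dots> = 2 * ln (1 / r)" using r0 by (simp add: ln_div ln_realpow)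
    also have "\<dots> \<le> 2 * L" unfolding L_def using r0 by (simp add: add_pos_pos)
    finally have "\<bar>d\<bar> * ln (1 / t) \<le> (c / L) * (2 * L)"
      using d L1 c lnt unfolding L_def by (intro mult_mono) auto
    also have "\<dots> = 2 * c" using L1 by simp
    finally show ?thesis using c r0 t by (simp add: add_increasing2)
  next
    case False
    have "1 / t \<le> (r / t)\<^sup>2" using False t by (simp add: power2_eq_square field_simps)
    then have "ln (1 / t) \<le> ln ((r / t)\<^sup>2)" using t r0 by (subst ln_le_cancel_iff) auto
    also have "\<dots> = 2 * ln (r / t)" using r0 t by (simp add: ln_realpow)
    also have "\<dots> \<le> 2 * ln (1 + r / t)" using r0 t by (intro mult_left_mono ln_mono) (auto simp: add_pos_pos)
    finally have a: "ln (1 / t) \<le> 2 * ln (1 + r / t)" .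
    have "c / L \<le> c" using L1 c divide_left_mono[of 1 L c] by simp
    then have "\<bar>d\<bar> \<le> c" using d L_def by simp
    then have "\<bar>d\<bar> * ln (1 / t) \<le> c * (2 * ln (1 + r / t))" using a lnt c by (intro mult_mono) auto
    then show ?thesis using c by simp
  qed
  moreover have "t powr d \<le> exp (\<bar>d\<bar> * ln (1 / t))"
  proof -
    have "t powr d \<le> t powr (- \<bar>d\<bar>)" using t by (intro powr_mono') auto
    also have "\<dots> = exp (\<bar>d\<bar> * ln (1 / t))" using t by (simp add: powr_def ln_div)
    finally show ?thesis .
  qed
  ultimately have "t powr d \<le> exp (2 * c + 2 * c * ln (1 + r / t))" by (meson exp_le_cancel_iff order_trans)
  also have "\<dots> = exp (2 * c) * (1 + r / t) powr (2 * c)"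
  proof -
    have "1 + r / t > 0" using r0 t by (simp add: add_pos_pos)
    then show ?thesis by (simp add: exp_add powr_def)
  qed
  finally show ?thesis .
qed

lemma one_le_ln_exp1_plus: "0 \<le> r \<Longrightarrow> 1 \<le> ln (exp 1 + r)" for r :: real
  by (subst ln_ge_iff) (auto intro: add_pos_nonneg)

text \<open>
  The substitute for Jensen's inequality: if \<open>a\<close> is the integral of the sum
  \<open>G + \<dots>\<close> in \<open>y\<close> against a kernel, then integrating the right-hand side against this kernel
  gives a multiple of \<open>a powr s x\<close>. The condition at infinity serves for \<open>G < 1\<close>, the local one
  for \<open>1 \<le> G \<le> t powr (- n)\<close>; larger values of \<open>G\<close> are absorbed by the upper bound on \<open>a\<close>.
\<close>
lemma powr_exponent_change_le:
  fixes s :: "'a::euclidean_space \<Rightarrow> real"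
  assumes s: "\<And>x. 0 \<le> s x" "\<And>x. s x \<le> 1"
    and loc: "\<And>x y. \<bar>s x - s y\<bar> \<le> c1 / ln (exp 1 + 1 / norm (x - y))" and c1: "0 \<le> c1"
    and inf: "\<And>x. \<bar>s x - sinf\<bar> \<le> c2 / ln (exp 1 + norm x)" and c2: "0 \<le> c2"
    and M: "0 \<le> M" and n: "0 \<le> n"
    and t: "0 < t" "t \<le> 1" and G: "0 \<le> G" and a: "0 < a" "a \<le> B * t powr (- n)" and B: "1 \<le> B"
  shows "G powr s y \<le> exp (2 * M * c2) * exp (2 * (n * c1)) * B * (1 + norm (x - y) / t) powr (2 * (n * c1)) *
     (a powr (s x - 1) * (G + (exp 1 + norm x) powr (- M) + (exp 1 + norm y) powr (- M)) + a powr s x)"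
    (is "_ \<le> ?E2 * ?E1 * B * ?w * (?as * (G + ?hx + ?hy) + ?b)")
proof -
  have w1: "1 \<le> ?w" using c1 n t by (intro ge_one_powr_ge_zero) auto
  have E1: "1 \<le> ?E1" and E2: "1 \<le> ?E2" using c1 c2 n M by auto
  have nn: "0 \<le> ?as * (G + ?hx + ?hy) + ?b" using G by (intro add_nonneg_nonneg mult_nonneg_nonneg) auto
  have tpow: "(t powr (- n)) powr d \<le> ?E1 * ?w" if "\<bar>d\<bar> = \<bar>s x - s y\<bar>" for d
  proof -
    have "t powr (- n * d) \<le> exp (2 * (n * c1)) * (1 + norm (x - y) / t) powr (2 * (n * c1))"
    proof (rule powr_log_Hoelder_le)
      have "\<bar>- n * d\<bar> = n * \<bar>s x - s y\<bar>" using n that by (simp add: abs_mult)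
      also have "\<dots> \<le> n * (c1 / ln (exp 1 + 1 / norm (x - y)))" using n loc by (intro mult_left_mono) auto
      finally show "\<bar>- n * d\<bar> \<le> n * c1 / ln (exp 1 + 1 / norm (x - y))" by simp
    qed (use n c1 t that in auto)
    then show ?thesis by (simp add: powr_powr)
  qed
  consider "G < 1" | "1 \<le> G" "G \<le> t powr (- n)" | "t powr (- n) < G" by linarith
  then show ?thesis
  proof cases
    case 1
    define \<mu> where "\<mu> = min (norm x) (norm y)"
    define l where "l = ln (exp 1 + \<mu>)"
    \<comment> \<open>A tiny \<open>G\<close> would make \<open>G powr (s y - s x)\<close>
      unbounded. Raised to \<open>Q\<close>, it is at least
      \<open>(exp 1 + \<mu>) powr (- M)\<close>, whose logarithm is \<open>- M * l\<close>; the
      exponents differ by at most \<open>2 * c2 / l\<close>, and the product of the two is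
      bounded.\<close>
    define Q where "Q = max G (max ?hx ?hy)"
    have \<mu>0: "0 \<le> \<mu>" by (simp add: \<mu>_def)
    have l1: "1 \<le> l" unfolding l_def by (rule one_le_ln_exp1_plus[OF \<mu>0])
    have base: "0 < exp 1 + norm x" "0 < exp 1 + norm y" "0 < exp 1 + \<mu>"
      using \<mu>0 by (auto intro: add_pos_nonneg)
    have e1: "1 \<le> exp (1::real)" by simp
    have h1: "?hx \<le> 1" "?hy \<le> 1"
      using M e1 powr_mono[of "- M" 0 "exp 1 + norm x"] powr_mono[of "- M" 0 "exp 1 + norm y"] base
      by (auto simp: add_increasing2)
    have Q: "0 < Q" "Q \<le> 1" "G \<le> Q" using 1 h1 base by (auto simp: Q_def less_max_iff_disj)
    have Qsum: "Q \<le> G + ?hx + ?hy" using G by (auto simp: Q_def)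
    have Qmu: "(exp 1 + \<mu>) powr (- M) \<le> Q" by (auto simp: Q_def \<mu>_def min_def)
    have "\<bar>s y - s x\<bar> \<le> \<bar>s y - sinf\<bar> + \<bar>s x - sinf\<bar>" by linarith
    also have "\<dots> \<le> c2 / ln (exp 1 + norm y) + c2 / ln (exp 1 + norm x)" by (intro add_mono inf)
    also have "\<dots> \<le> c2 / l + c2 / l"
    proof (intro add_mono divide_left_mono mult_pos_pos)
      show "l \<le> ln (exp 1 + norm y)" "l \<le> ln (exp 1 + norm x)"
        unfolding l_def using base by (auto simp: \<mu>_def intro!: ln_mono)
      show "0 < ln (exp 1 + norm y)" "0 < ln (exp 1 + norm x)"
        using one_le_ln_exp1_plus[of "norm x"] one_le_ln_exp1_plus[of "norm y"] by auto
    qed (use l1 c2 in auto)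
    finally have d: "\<bar>s y - s x\<bar> * l \<le> 2 * c2" using l1 by (simp add: field_simps)
    have "Q powr (s y - s x) \<le> Q powr (- \<bar>s y - s x\<bar>)" using Q by (intro powr_mono') auto
    also have "\<dots> \<le> ((exp 1 + \<mu>) powr (- M)) powr (- \<bar>s y - s x\<bar>)"
      using Qmu base by (intro powr_mono2') auto
    also have "\<dots> = exp (M * (\<bar>s y - s x\<bar> * l))" using base by (simp add: powr_powr powr_def l_def)
    also have "\<dots> \<le> ?E2" using mult_left_mono[OF d M] by simp
    finally have Qd: "Q powr (s y - s x) \<le> ?E2" .
    have "G powr s y \<le> Q powr s y" using Q G s by (intro powr_mono2) auto
    also have "\<dots> = Q powr (s y - s x) * Q powr s x" by (simp flip: powr_add)
    also have "\<dots> \<le> ?E2 * Q powr s x" using Qd by (intro mult_right_mono) auto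
    also have "\<dots> \<le> ?E2 * (?as * Q + ?b)" using Q a s by (intro mult_left_mono powr_Young) auto
    also have "\<dots> \<le> ?E2 * (?as * (G + ?hx + ?hy) + ?b)"
      using Qsum by (intro mult_left_mono add_mono) auto
    also have "\<dots> = ?E2 * 1 * 1 * 1 * (?as * (G + ?hx + ?hy) + ?b)" by simp
    also have "\<dots> \<le> ?E2 * ?E1 * B * ?w * (?as * (G + ?hx + ?hy) + ?b)"
      using w1 E1 E2 B nn by (intro mult_mono mult_nonneg_nonneg) auto
    finally show ?thesis .
  next
    case 2
    have "G powr s y = G powr s x * G powr (s y - s x)" by (simp flip: powr_add)
    also have "\<dots> \<le> G powr s x * (t powr (- n)) powr \<bar>s y - s x\<bar>"
      using 2 by (intro mult_left_mono order_trans[OF powr_mono powr_mono2]) auto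
    also have "\<dots> \<le> G powr s x * (?E1 * ?w)" by (intro mult_left_mono tpow) (simp_all add: abs_minus_commute)
    also have "\<dots> \<le> (?as * G + ?b) * (?E1 * ?w)"
      using G a s by (intro mult_right_mono powr_Young) auto
    also have "\<dots> \<le> (?as * (G + ?hx + ?hy) + ?b) * (?E1 * ?w)"
      by (intro mult_right_mono add_mono mult_left_mono) auto
    also have "\<dots> = 1 * ?E1 * 1 * ?w * (?as * (G + ?hx + ?hy) + ?b)" by simp
    also have "\<dots> \<le> ?E2 * ?E1 * B * ?w * (?as * (G + ?hx + ?hy) + ?b)"
      using w1 E1 E2 B nn by (intro mult_mono mult_nonneg_nonneg) auto
    finally show ?thesis .
  next
    case 3
    have tn: "0 < t powr (- n)" using t by simp
    have G0: "0 < G" using 3 tn by linarith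
    \<comment> \<open>As \<open>s y - 1\<close> is not positive, \<open>G\<close> may be replaced in
      this power by the smaller \<open>t powr (- n)\<close>; the exponent is changed there, and
      \<open>a / B \<le> t powr (- n)\<close> finally brings in \<open>a\<close>.\<close>
    have "G powr s y = G powr (s y - 1) * G" using G0 by (simp add: powr_diff)
    also have "\<dots> \<le> (t powr (- n)) powr (s y - 1) * G"
      using 3 tn G s by (intro mult_right_mono powr_mono2') auto
    also have "\<dots> = (t powr (- n)) powr (s y - s x) * (t powr (- n)) powr (s x - 1) * G"
      by (simp flip: powr_add)
    also have "\<dots> \<le> (?E1 * ?w) * (B * ?as) * G"
    proof (intro mult_mono mult_nonneg_nonneg)
      have "(t powr (- n)) powr (s x - 1) \<le> (a / B) powr (s x - 1)"
        using a B s tn by (intro powr_mono2') (auto simp: field_simps)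
      also have "\<dots> = B powr (1 - s x) * ?as" using a B by (simp add: powr_divide powr_diff field_simps)
      also have "\<dots> \<le> B powr 1 * ?as" using B s by (intro mult_right_mono powr_mono) auto
      finally show "(t powr (- n)) powr (s x - 1) \<le> B * ?as" using B by simp
    qed (use tpow[of "s y - s x"] G B in auto)
    also have "\<dots> = (?E1 * ?w) * B * (?as * G)" by simp
    also have "\<dots> \<le> (?E1 * ?w) * B * (?as * (G + ?hx + ?hy) + ?b)"
      using B by (intro mult_left_mono add_increasing2 mult_nonneg_nonneg) auto
    also have "\<dots> = 1 * ?E1 * B * ?w * (?as * (G + ?hx + ?hy) + ?b)" by simp
    also have "\<dots> \<le> ?E2 * ?E1 * B * ?w * (?as * (G + ?hx + ?hy) + ?b)"
      using w1 E1 E2 B nn by (intro mult_mono mult_nonneg_nonneg) auto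
    finally show ?thesis .
  qed
qed

section \<open>Integrable weights and continuity of the exponents\<close>

lemma nn_integral_lborel_affine:
  fixes f :: "'a::euclidean_space \<Rightarrow> ennreal"
  assumes [measurable]: "f \<in> borel_measurable borel" and c: "c \<noteq> 0"
  shows "(\<integral>\<^sup>+x. f x \<partial>lborel) = ennreal (\<bar>c\<bar> ^ DIM('a)) * (\<integral>\<^sup>+x. f (y + c *\<^sub>R x) \<partial>lborel)"
  by (subst lborel_affine[OF c, of y]) (simp add: nn_integral_density nn_integral_distr nn_integral_cmult)

text \<open>Each of the \<open>DIM('a)\<close> factors \<open>1 + (x \<bullet> b)^2\<close> is at
  most \<open>(1 + norm x)^2\<close>, so the weight lies below a product of one-dimensional
  functions \<open>1 / (1 + x^2)\<close>. This comparison fixes the exponent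
  \<open>2 * DIM('a)\<close> of the kernels below.\<close>

lemma nn_integral_one_plus_norm_finite:
  "(\<integral>\<^sup>+x. ennreal ((1 + norm (x::'a::euclidean_space)) powr (- (2 * DIM('a)))) \<partial>lborel) < \<infinity>"
proof -
  have pw: "(1 + norm x) powr (- (2 * DIM('a))) \<le> (\<Prod>b\<in>Basis. 1 / (1 + (x \<bullet> b)\<^sup>2))" for x :: 'a
  proof -
    have "(\<Prod>b\<in>(Basis::'a set). 1 + (x \<bullet> b)\<^sup>2) \<le> (\<Prod>b\<in>(Basis::'a set). (1 + norm x)\<^sup>2)"
    proof (intro prod_mono conjI)
      fix b :: 'a assume "b \<in> Basis"
      then have "(x \<bullet> b)\<^sup>2 \<le> (norm x)\<^sup>2" by (metis Basis_le_norm abs_le_square_iff abs_norm_cancel)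
      then show "1 + (x \<bullet> b)\<^sup>2 \<le> (1 + norm x)\<^sup>2" using norm_ge_zero[of x] by (simp add: power2_eq_square algebra_simps del: norm_ge_zero)
    qed auto
    also have "\<dots> = (1 + norm x) powr (2 * DIM('a))"
    proof -
      have "0 < 1 + norm x" by (simp add: add_pos_nonneg)
      from powr_realpow[OF this, of "2 * DIM('a)"] show ?thesis by (simp add: power_mult)
    qed
    finally have *: "(\<Prod>b\<in>(Basis::'a set). 1 + (x \<bullet> b)\<^sup>2) \<le> (1 + norm x) powr (2 * DIM('a))" .
    have pos: "0 < (\<Prod>b\<in>(Basis::'a set). 1 + (x \<bullet> b)\<^sup>2)" by (intro prod_pos) (simp add: add_pos_nonneg)
    have "(1 + norm x) powr (- (2 * DIM('a))) = inverse ((1 + norm x) powr (2 * DIM('a)))"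
      by (simp add: powr_minus)
    also have "\<dots> \<le> inverse (\<Prod>b\<in>(Basis::'a set). 1 + (x \<bullet> b)\<^sup>2)" using * pos by (rule le_imp_inverse_le)
    finally show ?thesis by (simp add: inverse_eq_divide prod_dividef)
  qed
  have "(\<integral>\<^sup>+x. ennreal ((1 + norm (x::'a)) powr (- (2 * DIM('a)))) \<partial>lborel)
     \<le> (\<integral>\<^sup>+x. (\<Prod>b\<in>(Basis::'a set). ennreal (1 / (1 + (x \<bullet> b)\<^sup>2))) \<partial>lborel)"
    using pw by (intro nn_integral_mono) (simp add: prod_ennreal ennreal_leI)
  also have "\<dots> = (\<Prod>b\<in>(Basis::'a set). (\<integral>\<^sup>+x. ennreal (1 / (1 + x\<^sup>2)) \<partial>lborel))"
    by (rule nn_integral_lborel_prod) auto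
  also have "\<dots> < \<infinity>"
  proof -
    have "integrable lborel (\<lambda>x::real. 1 / (1 + x\<^sup>2))"
      using integrable_inverse_1_plus_square by (simp add: set_integrable_def inverse_eq_divide)
    then have "(\<integral>\<^sup>+x. ennreal (norm (1 / (1 + (x::real)\<^sup>2))) \<partial>lborel) < \<infinity>" by (simp add: integrable_iff_bounded)
    then show ?thesis by (simp add: power_less_top_ennreal)
  qed
  finally show ?thesis .
qed

lemma log_exponents_bounds:
  assumes "p \<in> log_exponents"
  obtains c1 c2 sinf where "0 \<le> c1" "0 \<le> c2" "\<And>x. 1 \<le> p x"
    "\<And>x y. \<bar>1 / p x - 1 / p y\<bar> \<le> c1 / ln (exp 1 + 1 / norm (x - y))"
    "\<And>x. \<bar>1 / p x - sinf\<bar> \<le> c2 / ln (exp 1 + norm x)"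
proof -
  have "(\<lambda>x. 1 / p x) \<in> Clog_loc" "\<exists>g_inf. \<exists>c>0. \<forall>x. \<bar>1 / p x - g_inf\<bar> \<le> c / ln (exp 1 + norm x)"
    "\<forall>x. 1 \<le> p x" using assms by (auto simp: log_exponents_def var_exponents_def Clog_def)
  moreover obtain c where "0 < c" "\<forall>x y. \<bar>1 / p x - 1 / p y\<bar> \<le> c / ln (exp 1 + 1 / norm (x - y))"
    using calculation unfolding Clog_loc_def by blast
  moreover obtain g_inf c' where "0 < c'" "\<forall>x. \<bar>1 / p x - g_inf\<bar> \<le> c' / ln (exp 1 + norm x)"
    using calculation by blast
  ultimately show thesis using that[of c c' g_inf] by simp
qed

text \<open>\<open>Clog_loc\<close> does not mention measurability, and \<open>var_exponents\<close>
  gives it only for the Lebesgue sets; continuity provides the Borel measurability on which the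
  product measures below rely.\<close>

lemma continuous_Clog_loc:
  assumes "g \<in> Clog_loc"
  shows "continuous_on UNIV g"
proof (rule continuous_on_iff[THEN iffD2], intro ballI allI impI)
  fix x :: 'a and e :: real assume e: "0 < e"
  obtain c where c: "0 < c" "\<And>x y. \<bar>g x - g y\<bar> \<le> c / ln (exp 1 + 1 / norm (x - y))"
    using assms by (auto simp: Clog_loc_def)
  \<comment> \<open>The radius \<open>d = exp (- (c / e))\<close> is the solution of
    \<open>c / ln (1 / d) = e\<close>.\<close>
  have "\<bar>g y - g x\<bar> < e" if "dist y x < exp (- (c / e))" "y \<noteq> x" for y
  proof -
    have r: "0 < norm (y - x)" using that by simp
    have "exp (c / e) < 1 / norm (y - x)" using that r by (simp add: dist_norm exp_minus field_simps)
    then have "exp (c / e) < exp 1 + 1 / norm (y - x)" using exp_gt_zero[of "1::real"] by linarith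
    then have "c / e < ln (exp 1 + 1 / norm (y - x))"
      by (metis exp_gt_zero ln_exp ln_less_cancel_iff order.strict_trans)
    moreover have "0 < c / e" using c e by simp
    ultimately have "0 < ln (exp 1 + 1 / norm (y - x))"
      by (meson order.strict_trans)
    moreover have "c < ln (exp 1 + 1 / norm (y - x)) * e"
      using e \<open>c / e < _\<close> by (simp add: pos_divide_less_eq)
    ultimately have "c / ln (exp 1 + 1 / norm (y - x)) < e" by (simp add: pos_divide_less_eq mult.commute)
    with c(2)[of y x] show ?thesis by simp
  qed
  then have "\<forall>x'\<in>UNIV. dist x' x < exp (- (c / e)) \<longrightarrow> dist (g x') (g x) < e"
    using e by (metis dist_real_def dist_self)
  then show "\<exists>d>0. \<forall>x'\<in>UNIV. dist x' x < d \<longrightarrow> dist (g x') (g x) < e" by (meson exp_gt_zero)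
qed

lemma continuous_log_exponents:
  assumes "p \<in> log_exponents"
  shows "continuous_on UNIV p"
proof -
  have "(\<lambda>x. 1 / p x) \<in> Clog_loc" "\<forall>x. 1 \<le> p x"
    using assms by (auto simp: log_exponents_def var_exponents_def Clog_def)
  then have c: "continuous_on UNIV (\<lambda>x. 1 / p x)" and nz: "p x \<noteq> 0" for x
    using continuous_Clog_loc by (auto dest: spec[of _ x])
  have "continuous_on UNIV (\<lambda>x. inverse (1 / p x))"
    by (rule continuous_on_inverse[OF c]) (simp add: nz)
  then show ?thesis by simp
qed

text \<open>The power of \<open>t\<close> in front normalises the mass under dilation. That the mass
  does not depend on \<open>t\<close> makes the later constants uniform in the scale.\<close>

lemma nn_integral_kernel:
  fixes x :: "'a::euclidean_space"
  assumes t: "0 < t"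
  defines "k \<equiv> \<lambda>z::'a. t powr (- DIM('a)) * (1 + norm z / t) powr (- (2 * DIM('a)))"
  shows "(\<integral>\<^sup>+y. ennreal (k (x - y)) \<partial>lborel) = (\<integral>\<^sup>+x. ennreal ((1 + norm (x::'a)) powr (- (2 * DIM('a)))) \<partial>lborel)"
    and "(\<integral>\<^sup>+y. ennreal (k (y - x)) \<partial>lborel) = (\<integral>\<^sup>+x. ennreal ((1 + norm (x::'a)) powr (- (2 * DIM('a)))) \<partial>lborel)"
proof -
  have [measurable]: "k \<in> borel_measurable borel" unfolding k_def by measurable
  have e: "ennreal (t ^ DIM('a)) * ennreal (k (t *\<^sub>R u)) = ennreal ((1 + norm u) powr (- (2 * DIM('a))))" for u
    using t by (simp add: k_def powr_minus powr_realpow flip: ennreal_mult)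
  have k: "k (- z) = k z" for z by (simp add: k_def)
  have 1: "(\<integral>\<^sup>+y. ennreal (k (x - y)) \<partial>lborel) = (\<integral>\<^sup>+x. ennreal ((1 + norm (x::'a)) powr (- (2 * DIM('a)))) \<partial>lborel)"
  proof -
    have "(\<integral>\<^sup>+y. ennreal (k (x - y)) \<partial>lborel) = ennreal (\<bar>-t\<bar> ^ DIM('a)) * (\<integral>\<^sup>+u. ennreal (k (x - (x + (-t) *\<^sub>R u))) \<partial>lborel)"
      using t by (intro nn_integral_lborel_affine) auto
    also have "\<dots> = (\<integral>\<^sup>+u. ennreal (t ^ DIM('a)) * ennreal (k (t *\<^sub>R u)) \<partial>lborel)"
      using t by (simp add: nn_integral_cmult)
    finally show ?thesis unfolding e .
  qed
  then show "(\<integral>\<^sup>+y. ennreal (k (x - y)) \<partial>lborel) = (\<integral>\<^sup>+x. ennreal ((1 + norm (x::'a)) powr (- (2 * DIM('a)))) \<partial>lborel)" .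
  have "k (y - x) = k (x - y)" for y using k[of "x - y"] by simp
  then show "(\<integral>\<^sup>+y. ennreal (k (y - x)) \<partial>lborel) = (\<integral>\<^sup>+x. ennreal ((1 + norm (x::'a)) powr (- (2 * DIM('a)))) \<partial>lborel)" using 1 by simp
qed

lemma nn_integral_swap:
  assumes "sigma_finite_measure M" "sigma_finite_measure N"
    and "(\<lambda>(x, y). f x y) \<in> borel_measurable (M \<Otimes>\<^sub>M N)"
  shows "(\<integral>\<^sup>+x. (\<integral>\<^sup>+y. f x y \<partial>N) \<partial>M) = (\<integral>\<^sup>+y. (\<integral>\<^sup>+x. f x y \<partial>M) \<partial>N)"
proof -
  interpret pair_sigma_finite M N using assms by (simp add: pair_sigma_finite_def)
  show ?thesis using Fubini'[OF assms(3)] by simp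
qed

text \<open>
  Averaging over scales with an arbitrary measure \<open>N\<close> covers both terms of the reproducing
  formula (a point mass and \<open>d\<tau>/\<tau>\<close>) and makes a separate Minkowski inequality superfluous.
\<close>
definition convolution_constant ::
    "('a::euclidean_space \<Rightarrow> real) \<Rightarrow> ('a \<Rightarrow> real) \<Rightarrow> ('a \<Rightarrow> complex) \<Rightarrow> real \<Rightarrow> bool" where
  "convolution_constant p \<alpha> \<Theta> C \<longleftrightarrow> 0 < C \<and> (\<forall>t N V F. 0 < t \<longrightarrow> t \<le> 1 \<longrightarrow>
    finite_measure N \<longrightarrow> sets N = sets (borel :: real measure) \<longrightarrow>
    (\<lambda>(\<tau>, y). V \<tau> y) \<in> borel_measurable (borel \<Otimes>\<^sub>M borel) \<longrightarrow>
    (\<forall>x. ennreal (norm (F x)) \<le> (\<integral>\<^sup>+\<tau>. \<integral>\<^sup>+y. ennreal (norm (dilate t \<Theta> (x - y)) * norm (V \<tau> y)) \<partial>lborel \<partial>N)) \<longrightarrow>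
    Lp_norm p (\<lambda>x. complex_of_real (t powr (- \<alpha> x)) * F x) \<le>
      ennreal C * (\<integral>\<^sup>+\<tau>. Lp_norm p (\<lambda>y. complex_of_real (t powr (- \<alpha> y)) * V \<tau> y) \<partial>N))"

text \<open>Each slice \<open>V \<tau>\<close> is divided by a number \<open>lam \<tau>\<close>
  slightly above its norm, so that its modular density \<open>G \<tau>\<close> has integral at most
  one; divided by their total, the numbers \<open>lam \<tau>\<close> become weights
  \<open>w \<tau>\<close> of mass at most one. A single use of the exponent change, with
  \<open>a x\<close> an average of \<open>G\<close> over \<open>y\<close> and \<tau>, then handles
  the spatial convolution and the integration over scales together.\<close>

lemma Lp_convolution_bound:
  fixes p \<alpha> :: "'a::euclidean_space \<Rightarrow> real" and \<Theta> :: "'a \<Rightarrow> complex"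
  assumes p: "p \<in> log_exponents" and \<alpha>: "\<alpha> \<in> Clog_loc"
    and \<Theta>[measurable]: "\<Theta> \<in> borel_measurable borel"
    and decay: "\<And>m. \<exists>c. \<forall>x. norm (\<Theta> x) \<le> c * (1 + norm x) powr (- m)"
  shows "\<exists>C. convolution_constant p \<alpha> \<Theta> C"
proof -
  define n where "n = real DIM('a)"
  have n: "0 \<le> n" by (simp add: n_def)
  obtain c1 c2 sinf where c: "0 \<le> c1" "0 \<le> c2" and p1: "\<And>x. 1 \<le> p x"
    and loc: "\<And>x y. \<bar>1 / p x - 1 / p y\<bar> \<le> c1 / ln (exp 1 + 1 / norm (x - y))"
    and inf: "\<And>x. \<bar>1 / p x - sinf\<bar> \<le> c2 / ln (exp 1 + norm x)"
    using log_exponents_bounds[OF p] by metis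
  obtain c3 where c3: "0 \<le> c3" and \<alpha>loc: "\<And>x y. \<bar>\<alpha> x - \<alpha> y\<bar> \<le> c3 / ln (exp 1 + 1 / norm (x - y))"
    using \<alpha> by (auto simp: Clog_loc_def dest: less_imp_le)
  have [measurable]: "\<alpha> \<in> borel_measurable borel" "p \<in> borel_measurable borel"
    using continuous_Clog_loc[OF \<alpha>] continuous_log_exponents[OF p] by (auto intro: borel_measurable_continuous_onI)
  define s where "s x = 1 / p x" for x
  have s: "0 < s x" "s x \<le> 1" "s x * p x = 1" for x
    using p1[of x] by (auto simp: s_def)
  \<comment> \<open>The decay of \<Theta> pays for three things: \<open>2 * c3\<close> for moving
    \<alpha> from \<open>x\<close> to \<open>y\<close>, \<open>2 * (n * c1)\<close> for changing the
    exponent \<open>1 / p\<close>, and \<open>2 * n\<close> for a kernel of finite mass.\<close>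
  define m where "m = 2 * c3 + 2 * (n * c1) + 2 * n"
  obtain c\<Theta> where c\<Theta>: "\<And>x. norm (\<Theta> x) \<le> c\<Theta> * (1 + norm x) powr (- m)" using decay by blast
  have c\<Theta>0: "0 \<le> c\<Theta>"
    using order_trans[OF norm_ge_zero c\<Theta>[of 0]] by simp
  obtain J where J: "0 \<le> J" "(\<integral>\<^sup>+x. ennreal ((1 + norm (x::'a)) powr (- (2 * DIM('a)))) \<partial>lborel) = ennreal J"
    using nn_integral_one_plus_norm_finite[where 'a='a] by (metis enn2real_nonneg ennreal_enn2real infinity_ennreal_def)
  \<comment> \<open>\<open>B\<close> will bound \<open>a x\<close> in units of
    \<open>t powr (- n)\<close>, \<open>K\<close> collects the pointwise constants, with 1 added for
    positivity, and \<open>D\<close> will bound the integral of \<open>a\<close>.\<close>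
  define B where "B = 2 + 2 * J"
  define K where "K = c\<Theta> * exp (2 * c3) * (exp (2 * (2 * n) * c2) * exp (2 * (n * c1)) * B) + 1"
  have K0: "0 < K" using c\<Theta>0 J by (auto simp: K_def B_def intro!: add_nonneg_pos mult_nonneg_nonneg)
  define D where "D = 1 + J + 2 * J * J + J"
  define C where "C = D * K * (1 + J)"
  have "0 < D" "0 < 1 + J" unfolding D_def using J by (intro add_pos_nonneg; simp)+
  then have C0: "0 < C" using K0 by (simp add: C_def)
  define h :: "'a \<Rightarrow> real" where "h x = (exp 1 + norm x) powr (- (2 * n))" for x
  have [measurable]: "h \<in> borel_measurable borel" unfolding h_def by measurable
  have e1: "1 \<le> exp (1::real)" by simp
  have h1: "h x \<le> (1 + norm x) powr (- (2 * n))" "0 < h x" "h x \<le> 1" for x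
  proof -
    show "h x \<le> (1 + norm x) powr (- (2 * n))"
      unfolding h_def using n e1 by (intro powr_mono2') (auto intro: add_pos_nonneg)
    show "0 < h x" unfolding h_def using add_pos_nonneg[of "exp 1" "norm x"] by simp
    show "h x \<le> 1" unfolding h_def using n e1 powr_mono[of "- (2 * n)" 0 "exp 1 + norm x"]
      by (auto simp: add_increasing2 split: if_splits)
  qed
  note h0 = less_imp_le[OF h1(2)]
  have hint: "(\<integral>\<^sup>+x. ennreal (h x) \<partial>lborel) \<le> ennreal J"
    unfolding J(2)[symmetric] using h1 by (intro nn_integral_mono ennreal_leI) (simp add: n_def)
  have main: "Lp_norm p (\<lambda>x. complex_of_real (t powr (- \<alpha> x)) * F x) \<le>
      ennreal C * (\<integral>\<^sup>+\<tau>. Lp_norm p (\<lambda>y. complex_of_real (t powr (- \<alpha> y)) * V \<tau> y) \<partial>N)"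
    if t: "0 < t" "t \<le> 1" and N: "finite_measure N" and sN[measurable_cong]: "sets N = sets (borel :: real measure)"
      and V[measurable]: "(\<lambda>(\<tau>, y). V \<tau> y) \<in> borel_measurable (borel \<Otimes>\<^sub>M borel)"
      and F: "\<And>x. ennreal (norm (F x)) \<le> (\<integral>\<^sup>+\<tau>. \<integral>\<^sup>+y. ennreal (norm (dilate t \<Theta> (x - y)) * norm (V \<tau> y :: complex)) \<partial>lborel \<partial>N)"
    for t N V F
  proof -
    interpret N: finite_measure N by fact
    define nrm where "nrm \<tau> = Lp_norm p (\<lambda>y. complex_of_real (t powr (- \<alpha> y)) * V \<tau> y)" for \<tau>
    have p0: "0 \<le> p x" for x using p1[of x] by simp
    have nrm_m[measurable]: "nrm \<in> borel_measurable N"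
      unfolding nrm_def using p0 by (intro borel_measurable_Lp_norm) auto
    show ?thesis
    proof (cases "(\<integral>\<^sup>+\<tau>. nrm \<tau> \<partial>N) = \<infinity>")
      case True
      then show ?thesis using C0 by (simp add: nrm_def[symmetric] ennreal_mult_top)
    next
      case False
      then obtain X where X: "0 \<le> X" "(\<integral>\<^sup>+\<tau>. nrm \<tau> \<partial>N) = ennreal X"
        by (metis enn2real_nonneg ennreal_enn2real infinity_ennreal_def less_top)
      have nrm_fin: "AE \<tau> in N. nrm \<tau> \<noteq> \<infinity>"
        using False by (intro nn_integral_PInf_AE) auto
      define k where "k z = t powr (- n) * (1 + norm z / t) powr (- (2 * n))" for z :: 'a
      have [measurable]: "k \<in> borel_measurable borel" unfolding k_def by measurable
      have k0: "0 \<le> k z" for z by (simp add: k_def)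
      have kle: "k z \<le> t powr (- n)" for z
      proof -
        have "(1 + norm z / t) powr (- (2 * n)) \<le> (1 + norm z / t) powr 0"
          using n t by (intro powr_mono) auto
        also have "\<dots> \<le> 1" by simp
        finally show ?thesis unfolding k_def by (simp add: mult_left_le)
      qed
      have kint: "(\<integral>\<^sup>+y. ennreal (k (x - y)) \<partial>lborel) = ennreal J" "(\<integral>\<^sup>+y. ennreal (k (y - x)) \<partial>lborel) = ennreal J" for x
        using nn_integral_kernel[OF t(1), where 'a='a] unfolding k_def n_def J(2) by (simp_all add: mult.commute)
      show ?thesis unfolding nrm_def[symmetric] X(2)
      proof (rule ennreal_le_epsilon)
        fix e :: real assume e: "0 < e"
        define \<epsilon> where "\<epsilon> = e / C"
        have \<epsilon>: "0 < \<epsilon>" using e C0 by (simp add: \<epsilon>_def)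
        define Lam where "Lam = X + \<epsilon>"
        have Lam: "0 < Lam" using X \<epsilon> by (simp add: Lam_def)
        \<comment> \<open>The extra amount \<epsilon> is spread evenly over the finite measure
          \<open>N\<close>: each \<open>lam \<tau>\<close> strictly exceeds its norm if that is
          finite, and the total grows by at most \<epsilon>.\<close>
        define \<delta> where "\<delta> = \<epsilon> / (1 + measure N (space N))"
        have \<delta>: "0 < \<delta>" "\<delta> * measure N (space N) \<le> \<epsilon>"
          using \<epsilon> measure_nonneg[of N "space N"] by (auto simp: \<delta>_def field_simps add_pos_nonneg simp del: measure_nonneg)
        define lam where "lam \<tau> = enn2real (nrm \<tau>) + \<delta>" for \<tau>
        have lam0: "0 < lam \<tau>" for \<tau> using \<delta> by (simp add: lam_def add_nonneg_pos)
        have [measurable]: "lam \<in> borel_measurable N" unfolding lam_def by measurable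
        have lam_int: "(\<integral>\<^sup>+\<tau>. ennreal (lam \<tau>) \<partial>N) \<le> ennreal Lam"
        proof -
          have "(\<integral>\<^sup>+\<tau>. ennreal (lam \<tau>) \<partial>N) \<le> (\<integral>\<^sup>+\<tau>. nrm \<tau> + ennreal \<delta> \<partial>N)"
            using \<delta> by (intro nn_integral_mono) (simp add: lam_def ennreal_plus ennreal_enn2real_if add_right_mono)
          also have "\<dots> = ennreal X + ennreal \<delta> * emeasure N (space N)"
            by (subst nn_integral_add) (auto simp: X)
          also have "\<dots> = ennreal (X + \<delta> * measure N (space N))"
            using \<delta> X by (simp add: N.emeasure_eq_measure ennreal_mult ennreal_plus)
          also have "\<dots> \<le> ennreal Lam" using \<delta> by (intro ennreal_leI) (simp add: Lam_def)
          finally show ?thesis .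
        qed
        define w where "w \<tau> = lam \<tau> / Lam" for \<tau>
        have w0: "0 \<le> w \<tau>" for \<tau> using lam0[of \<tau>] Lam by (simp add: w_def)
        have [measurable]: "w \<in> borel_measurable N" unfolding w_def by measurable
        have wint: "(\<integral>\<^sup>+\<tau>. ennreal (w \<tau>) \<partial>N) \<le> 1"
        proof -
          have "(\<integral>\<^sup>+\<tau>. ennreal (w \<tau>) \<partial>N) = (\<integral>\<^sup>+\<tau>. ennreal (1 / Lam) * ennreal (lam \<tau>) \<partial>N)"
            using Lam lam0 by (intro nn_integral_cong) (simp add: w_def less_imp_le flip: ennreal_mult)
          also have "\<dots> \<le> ennreal (1 / Lam) * ennreal Lam"
            by (subst nn_integral_cmult) (auto intro: mult_left_mono lam_int)
          also have "\<dots> = 1" using Lam by (simp flip: ennreal_mult)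
          finally show ?thesis .
        qed
        define v where "v \<tau> y = t powr (- \<alpha> y) * norm (V \<tau> y) / lam \<tau>" for \<tau> y
        define G where "G \<tau> y = v \<tau> y powr p y" for \<tau> y
        have v0: "0 \<le> v \<tau> y" for \<tau> y using lam0[of \<tau>] by (simp add: v_def)
        have [measurable]: "(\<lambda>(\<tau>, y). v \<tau> y) \<in> borel_measurable (N \<Otimes>\<^sub>M borel)" unfolding v_def by measurable
        have [measurable]: "(\<lambda>(\<tau>, y). G \<tau> y) \<in> borel_measurable (N \<Otimes>\<^sub>M borel)" unfolding G_def by measurable
        have [measurable]: "(\<lambda>y. G \<tau> y) \<in> borel_measurable borel" for \<tau> unfolding G_def v_def by measurable
        have G0: "0 \<le> G \<tau> y" for \<tau> y by (simp add: G_def)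
        have vG: "v \<tau> y = G \<tau> y powr s y" for \<tau> y
          using v0[of \<tau> y] s(3)[of y] by (simp add: G_def powr_powr mult.commute)
        \<comment> \<open>Where \<open>nrm \<tau>\<close> is infinite, \<open>enn2real\<close> turns
          it into 0 and \<open>lam \<tau>\<close> is no longer above it; such \<tau> form a null set
          because the integral of \<open>nrm\<close> is finite.\<close>
        have Gint: "AE \<tau> in N. (\<integral>\<^sup>+y. ennreal (G \<tau> y) \<partial>lborel) \<le> 1"
          using nrm_fin
        proof eventually_elim
          fix \<tau> assume fin: "nrm \<tau> \<noteq> \<infinity>"
          have "(\<integral>\<^sup>+y. ennreal ((norm (complex_of_real (t powr (- \<alpha> y)) * V \<tau> y) / lam \<tau>) powr p y) \<partial>lborel) \<le> 1"
          proof (rule Lp_norm_less_imp)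
            have "Lp_norm p (\<lambda>y. complex_of_real (t powr (- \<alpha> y)) * V \<tau> y) = ennreal (enn2real (nrm \<tau>))"
              using fin by (simp add: nrm_def[symmetric] less_top)
            also have "\<dots> < ennreal (lam \<tau>)" using \<delta> by (auto simp: lam_def ennreal_less_iff)
            finally show "Lp_norm p (\<lambda>y. complex_of_real (t powr (- \<alpha> y)) * V \<tau> y) < ennreal (lam \<tau>)" .
          qed (use p0 lam0 in auto)
          then show "(\<integral>\<^sup>+y. ennreal (G \<tau> y) \<partial>lborel) \<le> 1"
            by (simp add: G_def v_def norm_mult)
        qed
        define g where "g x \<tau> y = ennreal (k (x - y)) * ennreal (G \<tau> y + h x + h y)" for x \<tau> y
        \<comment> \<open>The separate summand \<open>h x\<close> keeps \<open>a x\<close> positive,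
          as its power with the nonpositive exponent \<open>s x - 1\<close> requires.\<close>
        define a where "a x = ennreal (h x) + (\<integral>\<^sup>+\<tau>. ennreal (w \<tau>) * (\<integral>\<^sup>+y. g x \<tau> y \<partial>lborel) \<partial>N)" for x
        show "Lp_norm p (\<lambda>x. complex_of_real (t powr (- \<alpha> x)) * F x) \<le> ennreal C * ennreal X + ennreal e"
        proof -
          define tn where "tn = t powr (- n)"
          have tn1: "1 \<le> tn" unfolding tn_def using powr_mono'[of "- n" 0 t] n t by simp
          define I where "I x \<tau> = (\<integral>\<^sup>+y. g x \<tau> y \<partial>lborel)" for x \<tau>
          have spN: "space N = UNIV" using sets_eq_imp_space_eq[OF sN] by simp
          have [measurable]: "(\<lambda>y. g x \<tau> y) \<in> borel_measurable borel" for x \<tau>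
          proof -
            have [measurable]: "\<tau> \<in> space N" using spN by simp
            show ?thesis unfolding g_def by measurable
          qed
          have [measurable]: "(\<lambda>(x, \<tau>). I x \<tau>) \<in> borel_measurable (borel \<Otimes>\<^sub>M N)"
            unfolding I_def g_def by measurable
          have am[measurable]: "a \<in> borel_measurable borel"
            unfolding a_def I_def[symmetric] by measurable
          \<comment> \<open>The kernel is at most \<open>tn\<close> and has mass \<open>J\<close>.
            The first bound is used against \<open>G\<close> and \<open>h y\<close>, the second
            against \<open>h x\<close>, which does not depend on \<open>y\<close>.\<close>
          have I_le: "AE \<tau> in N. \<forall>x. I x \<tau> \<le> ennreal ((1 + 2 * J) * tn)"
            using Gint
          proof eventually_elim
            case (elim \<tau>)
            show ?case
            proof
              fix x
              have "I x \<tau> \<le> (\<integral>\<^sup>+y. ennreal tn * ennreal (G \<tau> y) + (ennreal (k (x - y)) + ennreal tn * ennreal (h y)) \<partial>lborel)"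
                unfolding I_def
              proof (rule nn_integral_mono)
                fix y
                have "k (x - y) * (G \<tau> y + h x + h y) = k (x - y) * G \<tau> y + (k (x - y) * h x + k (x - y) * h y)"
                  by (simp add: algebra_simps)
                also have "\<dots> \<le> tn * G \<tau> y + (k (x - y) * 1 + tn * h y)"
                  using kle[of "x - y"] k0 G0 h1 h0 unfolding tn_def
                  by (intro add_mono mult_mono) auto
                finally have "ennreal (k (x - y) * (G \<tau> y + h x + h y)) \<le> ennreal (tn * G \<tau> y + (k (x - y) + tn * h y))"
                  by (intro ennreal_leI) simp
                then show "g x \<tau> y \<le> ennreal tn * ennreal (G \<tau> y) + (ennreal (k (x - y)) + ennreal tn * ennreal (h y))"
                  unfolding g_def using k0 G0[of \<tau> y] h0 tn1
                  by (simp add: ennreal_mult ennreal_plus)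
              qed
              also have "\<dots> = ennreal tn * (\<integral>\<^sup>+y. ennreal (G \<tau> y) \<partial>lborel) + (ennreal J + ennreal tn * (\<integral>\<^sup>+y. ennreal (h y) \<partial>lborel))"
                by (simp add: nn_integral_add nn_integral_cmult kint)
              also have "\<dots> \<le> ennreal tn * 1 + (ennreal J + ennreal tn * ennreal J)"
                using elim hint by (intro add_mono mult_left_mono) auto
              also have "\<dots> = ennreal (tn + (J + tn * J))"
                using tn1 J by (simp add: ennreal_mult ennreal_plus)
              also have "\<dots> \<le> ennreal ((1 + 2 * J) * tn)"
                using tn1 J mult_right_mono[of 1 tn J] by (intro ennreal_leI) (simp add: algebra_simps)
              finally show "I x \<tau> \<le> ennreal ((1 + 2 * J) * tn)" .
            qed
          qed
          have a_le: "a x \<le> ennreal (B * tn)" for x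
          proof -
            have "(\<integral>\<^sup>+\<tau>. ennreal (w \<tau>) * I x \<tau> \<partial>N) \<le> (\<integral>\<^sup>+\<tau>. ennreal (w \<tau>) * ennreal ((1 + 2 * J) * tn) \<partial>N)"
              using I_le by (intro nn_integral_mono_AE) (auto elim!: eventually_mono intro!: mult_left_mono)
            also have "\<dots> = (\<integral>\<^sup>+\<tau>. ennreal (w \<tau>) \<partial>N) * ennreal ((1 + 2 * J) * tn)"
              by (intro nn_integral_multc) auto
            also have "\<dots> \<le> 1 * ennreal ((1 + 2 * J) * tn)" by (intro mult_right_mono wint) auto
            finally have "a x \<le> ennreal tn + ennreal ((1 + 2 * J) * tn)"
              unfolding a_def I_def[symmetric] using h1(3)[of x] tn1 by (intro add_mono ennreal_leI) auto
            also have "\<dots> = ennreal (B * tn)"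
              using tn1 J by (subst ennreal_plus[symmetric]) (auto simp: B_def algebra_simps)
            finally show ?thesis .
          qed
          define b where "b x = enn2real (a x)" for x
          have ab: "a x = ennreal (b x)" for x
            unfolding b_def using le_less_trans[OF a_le[of x] ennreal_less_top] by simp
          have b_le: "b x \<le> B * tn" for x
            using a_le[of x] tn1 J unfolding ab B_def by (subst (asm) ennreal_le_iff) auto
          have b0: "0 < b x" for x
          proof -
            have "ennreal (h x) \<le> ennreal (b x)" unfolding ab[symmetric] a_def by simp
            then show ?thesis using h1(2)[of x] by (metis ennreal_le_iff2 le_less_trans less_le_not_le linorder_not_less)
          qed
          define as where "as x = b x powr (s x - 1)" for x
          define bs where "bs x = b x powr s x" for x
          \<comment> \<open>This identity closes the argument: integrating the affine bound produces
            \<open>as x * b x\<close>, which is \<open>bs x\<close> again.\<close>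
          have asb: "as x * b x = bs x" for x
            using b0[of x] by (simp add: as_def bs_def powr_diff)
          have pw: "t powr (- \<alpha> x) * (norm (dilate t \<Theta> (x - y)) * norm (V \<tau> y))
              \<le> K * Lam * (w \<tau> * (as x * (k (x - y) * (G \<tau> y + h x + h y)) + bs x * k (x - y)))" for x y \<tau>
          proof -
            define W where "W = 1 + norm (x - y) / t"
            have W: "0 < W" unfolding W_def using t by (simp add: add_pos_nonneg)
            have 1: "norm (dilate t \<Theta> (x - y)) \<le> tn * (c\<Theta> * W powr (- m))"
            proof -
              have "norm (dilate t \<Theta> (x - y)) = tn * norm (\<Theta> ((x - y) /\<^sub>R t))"
                using t by (simp add: dilate_def tn_def n_def norm_divide norm_power powr_minus powr_realpow field_simps)
              also have "\<dots> \<le> tn * (c\<Theta> * (1 + norm ((x - y) /\<^sub>R t)) powr (- m))"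
                using tn1 by (intro mult_left_mono c\<Theta>) auto
              finally show ?thesis using t by (simp add: W_def divide_inverse mult.commute)
            qed
            have 2: "t powr (- \<alpha> x) \<le> (exp (2 * c3) * W powr (2 * c3)) * t powr (- \<alpha> y)"
            proof -
              have "t powr (\<alpha> y - \<alpha> x) \<le> exp (2 * c3) * W powr (2 * c3)"
                unfolding W_def using t c3 \<alpha>loc[of x y] by (intro powr_log_Hoelder_le) (auto simp: abs_minus_commute)
              then have "t powr (\<alpha> y - \<alpha> x) * t powr (- \<alpha> y) \<le> (exp (2 * c3) * W powr (2 * c3)) * t powr (- \<alpha> y)"
                by (intro mult_right_mono) auto
              then show ?thesis by (simp flip: powr_add)
            qed
            let ?E = "exp (2 * (2 * n) * c2) * exp (2 * (n * c1)) * B"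
            let ?r = "as x * (G \<tau> y + h x + h y) + bs x"
            have r0: "0 \<le> ?r" using G0[of \<tau> y] h0[of x] h0[of y] by (simp add: as_def bs_def)
            have 3: "v \<tau> y \<le> ?E * W powr (2 * (n * c1)) * ?r"
              unfolding vG as_def bs_def h_def W_def s_def
              using c p1 loc inf t b_le[of x] b0[of x] n J G0 p0 s(2)[unfolded s_def]
              by (intro powr_exponent_change_le) (auto simp: B_def tn_def)
            have 4: "t powr (- \<alpha> y) * norm (V \<tau> y) = Lam * w \<tau> * v \<tau> y"
              using Lam lam0[of \<tau>] by (simp add: v_def w_def)
            have "t powr (- \<alpha> x) * (norm (dilate t \<Theta> (x - y)) * norm (V \<tau> y))
               = norm (dilate t \<Theta> (x - y)) * (t powr (- \<alpha> x) * norm (V \<tau> y))" by simp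
            also have "\<dots> \<le> (tn * (c\<Theta> * W powr (- m))) * ((exp (2 * c3) * W powr (2 * c3)) * t powr (- \<alpha> y) * norm (V \<tau> y))"
              using 1 2 tn1 c\<Theta>0 by (intro mult_mono mult_right_mono) auto
            also have "\<dots> = (tn * c\<Theta> * W powr (- m) * exp (2 * c3) * W powr (2 * c3)) * (Lam * w \<tau> * v \<tau> y)"
              unfolding 4[symmetric] by simp
            also have "\<dots> \<le> (tn * c\<Theta> * W powr (- m) * exp (2 * c3) * W powr (2 * c3)) * (Lam * w \<tau> * (?E * W powr (2 * (n * c1)) * ?r))"
              using tn1 c\<Theta>0 Lam w0 3 by (intro mult_left_mono mult_nonneg_nonneg) auto
            also have "\<dots> = (c\<Theta> * exp (2 * c3) * ?E) * (Lam * w \<tau> * (tn * (W powr (- m) * W powr (2 * c3) * W powr (2 * (n * c1))) * ?r))"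
              by (simp only: mult_ac)
            \<comment> \<open>By the choice of \<open>m\<close> exactly the power of
              \<open>W\<close> that belongs to the kernel \<open>k\<close> remains.\<close>
            also have "W powr (- m) * W powr (2 * c3) * W powr (2 * (n * c1)) = W powr (- (2 * n))"
              by (simp add: m_def flip: powr_add)
            also have "tn * W powr (- (2 * n)) = k (x - y)" by (simp add: k_def tn_def W_def)
            also have "(c\<Theta> * exp (2 * c3) * ?E) * (Lam * w \<tau> * (k (x - y) * ?r)) \<le> K * (Lam * w \<tau> * (k (x - y) * ?r))"
              using Lam w0 k0 r0 by (intro mult_right_mono mult_nonneg_nonneg) (auto simp: K_def)
            finally show ?thesis by (simp add: algebra_simps)
          qed
          have Fle: "t powr (- \<alpha> x) * norm (F x) \<le> K * Lam * (1 + J) * bs x" for x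
          proof -
            have as0: "0 \<le> as x" "0 \<le> bs x" by (simp_all add: as_def bs_def)
            have "ennreal (t powr (- \<alpha> x) * norm (F x)) = ennreal (t powr (- \<alpha> x)) * ennreal (norm (F x))"
              by (simp add: ennreal_mult)
            also have "\<dots> \<le> ennreal (t powr (- \<alpha> x)) * (\<integral>\<^sup>+\<tau>. \<integral>\<^sup>+y. ennreal (norm (dilate t \<Theta> (x - y)) * norm (V \<tau> y)) \<partial>lborel \<partial>N)"
              by (intro mult_left_mono F) auto
            also have "\<dots> = (\<integral>\<^sup>+\<tau>. \<integral>\<^sup>+y. ennreal (t powr (- \<alpha> x)) * ennreal (norm (dilate t \<Theta> (x - y)) * norm (V \<tau> y)) \<partial>lborel \<partial>N)"
              unfolding dilate_def by (simp add: nn_integral_cmult)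
            also have "\<dots> \<le> (\<integral>\<^sup>+\<tau>. \<integral>\<^sup>+y. ennreal (K * Lam) * (ennreal (w \<tau>) * (ennreal (as x) * g x \<tau> y + ennreal (bs x) * ennreal (k (x - y)))) \<partial>lborel \<partial>N)"
            proof (intro nn_integral_mono)
              fix \<tau> y
              have nn: "0 \<le> G \<tau> y + h x + h y" "0 \<le> k (x - y)" using G0[of \<tau> y] h0[of x] h0[of y] k0 by auto
              have "ennreal (t powr (- \<alpha> x)) * ennreal (norm (dilate t \<Theta> (x - y)) * norm (V \<tau> y))
                = ennreal (t powr (- \<alpha> x) * (norm (dilate t \<Theta> (x - y)) * norm (V \<tau> y)))"
                by (simp add: ennreal_mult)
              also have "\<dots> \<le> ennreal (K * Lam * (w \<tau> * (as x * (k (x - y) * (G \<tau> y + h x + h y)) + bs x * k (x - y))))"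
                by (intro ennreal_leI pw)
              also have "\<dots> = ennreal (K * Lam) * (ennreal (w \<tau>) * (ennreal (as x) * g x \<tau> y + ennreal (bs x) * ennreal (k (x - y))))"
                unfolding g_def using K0 Lam w0[of \<tau>] as0 nn by (simp only: ennreal_mult ennreal_plus mult_nonneg_nonneg add_nonneg_nonneg less_imp_le)
              finally show "ennreal (t powr (- \<alpha> x)) * ennreal (norm (dilate t \<Theta> (x - y)) * norm (V \<tau> y)) \<le> \<dots>" .
            qed
            also have "\<dots> = ennreal (K * Lam) * (ennreal (as x) * (\<integral>\<^sup>+\<tau>. ennreal (w \<tau>) * I x \<tau> \<partial>N) + ennreal (bs x) * ennreal J * (\<integral>\<^sup>+\<tau>. ennreal (w \<tau>) \<partial>N))"
            proof -
              have "(\<integral>\<^sup>+y. ennreal (K * Lam) * (ennreal (w \<tau>) * (ennreal (as x) * g x \<tau> y + ennreal (bs x) * ennreal (k (x - y)))) \<partial>lborel)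
                = ennreal (K * Lam) * (ennreal (as x) * (ennreal (w \<tau>) * I x \<tau>) + ennreal (bs x) * ennreal J * ennreal (w \<tau>))"
                if [measurable]: "\<tau> \<in> space N" for \<tau>
                by (simp add: nn_integral_cmult nn_integral_add kint I_def distrib_left mult_ac)
              then have "(\<integral>\<^sup>+\<tau>. \<integral>\<^sup>+y. ennreal (K * Lam) * (ennreal (w \<tau>) * (ennreal (as x) * g x \<tau> y + ennreal (bs x) * ennreal (k (x - y)))) \<partial>lborel \<partial>N)
                 = (\<integral>\<^sup>+\<tau>. ennreal (K * Lam) * (ennreal (as x) * (ennreal (w \<tau>) * I x \<tau>) + ennreal (bs x) * ennreal J * ennreal (w \<tau>)) \<partial>N)"
                by (intro nn_integral_cong) auto
              also have "\<dots> = ennreal (K * Lam) * (ennreal (as x) * (\<integral>\<^sup>+\<tau>. ennreal (w \<tau>) * I x \<tau> \<partial>N) + ennreal (bs x) * ennreal J * (\<integral>\<^sup>+\<tau>. ennreal (w \<tau>) \<partial>N))"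
                by (subst nn_integral_cmult, measurable, subst nn_integral_add, measurable, subst nn_integral_cmult, measurable, subst nn_integral_cmult, measurable)
              finally show ?thesis .
            qed
            also have "\<dots> \<le> ennreal (K * Lam) * (ennreal (as x) * a x + ennreal (bs x) * ennreal J * 1)"
              by (intro mult_left_mono add_mono wint) (auto simp: a_def I_def)
            also have "\<dots> = ennreal (K * Lam * (as x * b x + bs x * J))"
              unfolding ab using K0 Lam as0 b0[of x] J by (simp add: ennreal_mult ennreal_plus)
            also have "\<dots> = ennreal (K * Lam * (1 + J) * bs x)" unfolding asb by (simp add: algebra_simps)
            finally show ?thesis using K0 Lam J as0 by (subst (asm) ennreal_le_iff) auto
          qed
          \<comment> \<open>By Fubini each of the three densities \<open>G\<close>,
            \<open>h x\<close> and \<open>h y\<close> contributes its own mass times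
            \<open>J\<close>; with the separate summand \<open>h\<close> this gives
            \<open>J + (J + 2 * J * J)\<close>.\<close>
          have aint: "(\<integral>\<^sup>+x. a x \<partial>lborel) \<le> ennreal D"
          proof -
            have Ix: "AE \<tau> in N. (\<integral>\<^sup>+x. I x \<tau> \<partial>lborel) \<le> ennreal (J + 2 * J * J)"
              using Gint AE_space
            proof eventually_elim
              case (elim \<tau>)
              note [measurable] = \<open>\<tau> \<in> space N\<close>
              have ge: "g x \<tau> y = ennreal (k (x - y)) * ennreal (G \<tau> y) + (ennreal (k (x - y)) * ennreal (h x) + ennreal (k (x - y)) * ennreal (h y))" for x y
                unfolding g_def using G0[of \<tau> y] h0[of x] h0[of y] by (simp add: ennreal_plus distrib_left add.assoc)
              have swap: "(\<integral>\<^sup>+x. \<integral>\<^sup>+y. ennreal (k (x - y)) * u y \<partial>lborel \<partial>lborel) = ennreal J * (\<integral>\<^sup>+y. u y \<partial>lborel)"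
                if [measurable]: "u \<in> borel_measurable borel" for u :: "'a \<Rightarrow> ennreal"
              proof -
                have "(\<integral>\<^sup>+x. \<integral>\<^sup>+y. ennreal (k (x - y)) * u y \<partial>lborel \<partial>lborel) = (\<integral>\<^sup>+y. \<integral>\<^sup>+x. ennreal (k (x - y)) * u y \<partial>lborel \<partial>lborel)"
                  by (rule nn_integral_swap) (auto intro: sigma_finite_lborel)
                also have "\<dots> = (\<integral>\<^sup>+y. ennreal J * u y \<partial>lborel)" by (simp add: nn_integral_multc kint)
                finally show ?thesis by (simp add: nn_integral_cmult)
              qed
              have "(\<integral>\<^sup>+x. I x \<tau> \<partial>lborel) = (\<integral>\<^sup>+x. (\<integral>\<^sup>+y. ennreal (k (x - y)) * ennreal (G \<tau> y) \<partial>lborel)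
                 + (ennreal J * ennreal (h x) + (\<integral>\<^sup>+y. ennreal (k (x - y)) * ennreal (h y) \<partial>lborel)) \<partial>lborel)"
                unfolding I_def ge by (simp add: nn_integral_add nn_integral_multc kint)
              also have "\<dots> = ennreal J * (\<integral>\<^sup>+y. ennreal (G \<tau> y) \<partial>lborel)
                 + (ennreal J * (\<integral>\<^sup>+y. ennreal (h y) \<partial>lborel) + ennreal J * (\<integral>\<^sup>+y. ennreal (h y) \<partial>lborel))"
                by (simp add: nn_integral_add nn_integral_cmult swap)
              also have "\<dots> \<le> ennreal J * 1 + (ennreal J * ennreal J + ennreal J * ennreal J)"
                using elim by (intro add_mono mult_left_mono hint) auto
              also have "\<dots> = ennreal (J + 2 * J * J)"
                using J by (simp add: flip: ennreal_mult ennreal_plus)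
              finally show ?case .
            qed
            have "(\<integral>\<^sup>+x. a x \<partial>lborel) = (\<integral>\<^sup>+x. ennreal (h x) \<partial>lborel) + (\<integral>\<^sup>+x. (\<integral>\<^sup>+\<tau>. ennreal (w \<tau>) * I x \<tau> \<partial>N) \<partial>lborel)"
              unfolding a_def I_def[symmetric] by (intro nn_integral_add) auto
            also have "(\<integral>\<^sup>+x. (\<integral>\<^sup>+\<tau>. ennreal (w \<tau>) * I x \<tau> \<partial>N) \<partial>lborel) = (\<integral>\<^sup>+\<tau>. (\<integral>\<^sup>+x. ennreal (w \<tau>) * I x \<tau> \<partial>lborel) \<partial>N)"
              by (rule nn_integral_swap) (auto intro: sigma_finite_lborel N.sigma_finite_measure_axioms)
            also have "\<dots> = (\<integral>\<^sup>+\<tau>. ennreal (w \<tau>) * (\<integral>\<^sup>+x. I x \<tau> \<partial>lborel) \<partial>N)"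
              by (intro nn_integral_cong nn_integral_cmult) measurable
            also have "\<dots> \<le> (\<integral>\<^sup>+\<tau>. ennreal (w \<tau>) * ennreal (J + 2 * J * J) \<partial>N)"
              using Ix by (intro nn_integral_mono_AE) (auto elim!: eventually_mono intro!: mult_left_mono)
            also have "\<dots> = (\<integral>\<^sup>+\<tau>. ennreal (w \<tau>) \<partial>N) * ennreal (J + 2 * J * J)"
              by (intro nn_integral_multc) auto
            also have "\<dots> \<le> 1 * ennreal (J + 2 * J * J)" by (intro mult_right_mono wint) auto
            also have "(\<integral>\<^sup>+x. ennreal (h x) \<partial>lborel) \<le> ennreal J" by (rule hint)
            finally have "(\<integral>\<^sup>+x. a x \<partial>lborel) \<le> ennreal J + ennreal (J + 2 * J * J)"
              by (simp add: add_mono)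
            also have "\<dots> = ennreal (J + (J + 2 * J * J))"
              using J by (intro ennreal_plus[symmetric]) auto
            also have "\<dots> \<le> ennreal D" by (intro ennreal_leI) (simp add: D_def)
            finally show ?thesis .
          qed
          define l where "l = K * Lam * (1 + J)"
          have l0: "0 < l" using K0 Lam J by (simp add: l_def)
          have "Lp_norm p (\<lambda>x. complex_of_real (t powr (- \<alpha> x)) * F x) \<le> ennreal (D * l)"
          proof (rule Lp_norm_leI_dominated[OF p1 l0 _ am _ aint])
            show "1 \<le> D" using J by (simp add: D_def)
            fix x
            have "norm (complex_of_real (t powr (- \<alpha> x)) * F x) / l \<le> bs x"
              using Fle[of x] l0 by (simp add: norm_mult l_def divide_le_eq mult.commute)
            then have "(norm (complex_of_real (t powr (- \<alpha> x)) * F x) / l) powr p x \<le> bs x powr p x"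
              using l0 p0 by (intro powr_mono2) auto
            \<comment> \<open>Here \<open>s x * p x = 1\<close> undoes the power. All constants sit
              in \<open>l\<close>, so none of them is raised to \<open>p x\<close>.\<close>
            also have "\<dots> = b x" using s(3)[of x] b0[of x] by (simp add: bs_def powr_powr)
            finally show "ennreal ((norm (complex_of_real (t powr (- \<alpha> x)) * F x) / l) powr p x) \<le> a x"
              unfolding ab by (rule ennreal_leI)
          qed
          also have "D * l = C * X + e" using C0 by (simp add: l_def C_def Lam_def \<epsilon>_def field_simps)
          also have "ennreal \<dots> = ennreal C * ennreal X + ennreal e"
            using C0 X e by (simp add: ennreal_mult ennreal_plus)
          finally show ?thesis .
        qed
      qed
    qed
  qed
  show ?thesis
    unfolding convolution_constant_def by (intro exI[of _ C] conjI allI impI C0 main) auto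
qed

section \<open>Local averages on the scale axis\<close>

lemma enn_powr_mono: "a \<le> b \<Longrightarrow> 0 \<le> r \<Longrightarrow> enn_powr a r \<le> enn_powr b r"
  by (auto simp: enn_powr_def top_unique less_top[symmetric] intro!: ennreal_leI powr_mono2 enn2real_mono)

lemma enn_powr_ennreal: "0 \<le> a \<Longrightarrow> enn_powr (ennreal a) r = ennreal (a powr r)"
  by (simp add: enn_powr_def)

lemma enn_powr_divide_le:
  assumes "1 \<le> C" "1 \<le> r"
  shows "enn_powr (a / ennreal C) r \<le> ennreal (1 / C) * enn_powr a r"
proof (cases a)
  case (real x)
  have "enn_powr (a / ennreal C) r = ennreal ((x / C) powr r)"
    using real assms by (simp add: divide_ennreal enn_powr_ennreal)
  also have "(x / C) powr r = C powr (- r) * x powr r"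
    using assms real by (simp add: powr_divide powr_minus field_simps)
  also have "ennreal \<dots> \<le> ennreal (C powr (- 1) * x powr r)"
    using assms by (intro ennreal_leI mult_right_mono powr_mono) auto
  also have "\<dots> = ennreal (1 / C) * enn_powr a r"
    using assms real by (simp add: enn_powr_ennreal powr_minus divide_inverse ennreal_mult)
  finally show ?thesis .
next
  case top
  then show ?thesis using assms by (simp add: enn_powr_def ennreal_mult_top)
qed

lemma borel_measurable_enn_powr[measurable (raw)]:
  assumes [measurable]: "f \<in> borel_measurable M" "g \<in> borel_measurable M"
  shows "(\<lambda>x. enn_powr (f x) (g x)) \<in> borel_measurable M"
  unfolding enn_powr_def by measurable

lemma Lq_norm_dt_less_imp:
  assumes q: "\<And>t. 0 \<le> q t" and less: "Lq_norm_dt q I g < ennreal l"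
  shows "(\<integral>\<^sup>+t\<in>I. enn_powr (g t / ennreal l) (q t) * ennreal (1 / t) \<partial>lborel) \<le> 1"
proof -
  from less obtain k where k: "0 < k" "ennreal k < ennreal l"
     "(\<integral>\<^sup>+t\<in>I. enn_powr (g t / ennreal k) (q t) * ennreal (1 / t) \<partial>lborel) \<le> 1"
    unfolding Lq_norm_dt_def Inf_less_iff by (auto simp: nn_integral_completion)
  have "g t / ennreal l \<le> g t / ennreal k" for t
  proof -
    have "inverse l \<le> inverse k" "0 < l" using k by (auto simp: ennreal_less_iff)
    then show ?thesis
      using k by (auto simp: divide_ennreal_def inverse_ennreal intro!: mult_left_mono ennreal_leI)
  qed
  then have "(\<integral>\<^sup>+t\<in>I. enn_powr (g t / ennreal l) (q t) * ennreal (1 / t) \<partial>lborel)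
      \<le> (\<integral>\<^sup>+t\<in>I. enn_powr (g t / ennreal k) (q t) * ennreal (1 / t) \<partial>lborel)"
    using q by (intro nn_integral_mono mult_right_mono enn_powr_mono) auto
  with k show ?thesis by simp
qed

text \<open>The constant enters as in \<open>Lp_norm_leI_dominated\<close>. As \<open>q\<close> is
  only Lebesgue measurable, the integrand may fail to be Borel, and measurability is asked of the
  majorant \<open>A\<close>.\<close>

lemma Lq_norm_dt_leI_dominated:
  assumes q: "\<And>t. 1 \<le> q t" and l: "0 < l" and C: "1 \<le> C"
    and [measurable]: "A \<in> borel_measurable borel" "I \<in> sets borel"
    and le: "\<And>t. t \<in> I \<Longrightarrow> enn_powr (g t / ennreal l) (q t) \<le> A t"
    and int: "(\<integral>\<^sup>+t\<in>I. A t * ennreal (1 / t) \<partial>lborel) \<le> ennreal C"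
  shows "Lq_norm_dt q I g \<le> ennreal (C * l)"
proof -
  have "(\<integral>\<^sup>+t\<in>I. enn_powr (g t / ennreal (C * l)) (q t) * ennreal (1 / t) \<partial>lborel)
     \<le> (\<integral>\<^sup>+t. ennreal (1 / C) * (A t * ennreal (1 / t) * indicator I t) \<partial>lborel)"
  proof (rule nn_integral_mono)
    fix t
    show "enn_powr (g t / ennreal (C * l)) (q t) * ennreal (1 / t) * indicator I t
       \<le> ennreal (1 / C) * (A t * ennreal (1 / t) * indicator I t)"
    proof (cases "t \<in> I")
      case True
      have "g t / ennreal (C * l) = (g t / ennreal l) / ennreal C"
        using C l by (simp add: ennreal_divide_times divide_ennreal_def ennreal_mult inverse_ennreal mult.assoc mult.commute[of "inverse C"] flip: ennreal_mult)
      then have "enn_powr (g t / ennreal (C * l)) (q t) \<le> ennreal (1 / C) * enn_powr (g t / ennreal l) (q t)"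
        using enn_powr_divide_le[OF C q] by simp
      also have "\<dots> \<le> ennreal (1 / C) * A t" by (intro mult_left_mono le True) simp
      finally show ?thesis using True by (simp add: mult.assoc[symmetric] mult_right_mono)
    qed simp
  qed
  also have "\<dots> = ennreal (1 / C) * (\<integral>\<^sup>+t\<in>I. A t * ennreal (1 / t) \<partial>lborel)"
    by (intro nn_integral_cmult) measurable
  also have "\<dots> \<le> ennreal (1 / C) * ennreal C" by (intro mult_left_mono int) auto
  also have "\<dots> = 1" using C by (simp flip: ennreal_mult)
  finally show ?thesis
    unfolding Lq_norm_dt_def using C l by (intro Inf_lower) (auto simp: nn_integral_completion)
qed

text \<open>One-dimensional counterpart of \<open>powr_exponent_change_le\<close>: both exponents
  are compared with \<open>q 0\<close>, and since \<open>t\<close> and \<tau> differ by a factor of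
  at most 4, the two logarithmic errors are of the same size. The term \<tau> plays the part of the
  decaying weight; it is integrable for \<open>d\<tau>/\<tau>\<close> on the unit interval. The
  bound \<open>b \<le> 2\<close> serves the case \<open>1 \<le> x\<close>, where raising
  \<open>x\<close> to the power \<open>q \<tau>\<close> does not decrease it.\<close>

lemma powr_exponent_change_at_0_le:
  fixes q :: "real \<Rightarrow> real"
  assumes q1: "\<And>t. 1 \<le> q t" and c: "0 \<le> c" and hq: "\<And>t. \<bar>q t - q 0\<bar> \<le> c / ln (exp 1 + 1 / \<bar>t\<bar>)"
    and t: "0 < t" "t < 1 / 4" and \<tau>: "t / 4 \<le> \<tau>" "\<tau> \<le> 4 * t" and x: "0 \<le> x" and b: "0 < b" "b \<le> 2"
  shows "x \<le> (2 + exp (4 * c)) * (b powr (1 / q t - 1) * (x powr q \<tau> + \<tau>) + b powr (1 / q t))"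
proof -
  define s where "s = 1 / q t"
  have s: "0 < s" "s \<le> 1" using q1[of t] by (auto simp: s_def)
  have \<tau>0: "0 < \<tau>" "\<tau> < 1" using t \<tau> by linarith+
  have nn: "0 \<le> b powr (s - 1) * (x powr q \<tau> + \<tau>) + b powr s" using \<tau>0 by simp
  show ?thesis
  proof (cases "1 \<le> x")
    case True
    have "1 / 2 \<le> b powr (s - 1)"
    proof -
      have "2 powr (- 1) \<le> (2::real) powr (s - 1)" using s by (intro powr_mono) auto
      also have "\<dots> \<le> b powr (s - 1)" using b s by (intro powr_mono2') auto
      finally show ?thesis by (simp add: powr_minus)
    qed
    then have "1 \<le> 2 * b powr (s - 1)" by simp
    moreover have "x \<le> x powr q \<tau>" using True powr_mono[of 1 "q \<tau>" x] q1[of \<tau>] by simp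
    ultimately have "1 * x \<le> (2 * b powr (s - 1)) * x powr q \<tau>" using x by (intro mult_mono) auto
    also have "\<dots> \<le> 2 * (b powr (s - 1) * (x powr q \<tau> + \<tau>) + b powr s)"
      using \<tau>0 by (simp add: algebra_simps)
    also have "\<dots> \<le> (2 + exp (4 * c)) * (b powr (s - 1) * (x powr q \<tau> + \<tau>) + b powr s)"
      using nn by (intro mult_right_mono) auto
    finally show ?thesis by (simp add: s_def)
  next
    case False
    define G where "G = x powr q \<tau>"
    \<comment> \<open>Raising \<open>G\<close> to at least \<tau> bounds
      \<open>M powr (s' - s)\<close> by \<open>\<tau> powr (- \<bar>s' - s\<bar>)\<close>, which the
      log-Hoelder condition controls.\<close>
    define M where "M = max G \<tau>"
    define s' where "s' = 1 / q \<tau>"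
    have s': "0 < s'" using q1[of \<tau>] by (auto simp: s'_def)
    have G: "0 \<le> G" "G \<le> 1"
    proof -
      show "0 \<le> G" by (simp add: G_def)
      have "x powr q \<tau> \<le> 1 powr q \<tau>" using False x q1[of \<tau>] by (intro powr_mono2) auto
      then show "G \<le> 1" by (simp add: G_def)
    qed
    have M: "\<tau> \<le> M" "G \<le> M" "M \<le> 1" "M \<le> G + \<tau>" "0 < M" using G \<tau>0 by (auto simp: M_def)
    define Lt where "Lt = ln (exp 1 + 1 / t)"
    define L\<tau> where "L\<tau> = ln (exp 1 + 1 / \<tau>)"
    have L1: "1 \<le> Lt" "1 \<le> L\<tau>" unfolding Lt_def L\<tau>_def using t \<tau>0 by (auto intro!: one_le_ln_exp1_plus)
    have "\<bar>s' - s\<bar> = \<bar>q t - q \<tau>\<bar> / (q \<tau> * q t)"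
      using q1[of t] q1[of \<tau>] by (simp add: s_def s'_def field_simps abs_divide abs_mult)
    also have "\<dots> \<le> \<bar>q t - q \<tau>\<bar> / 1"
      using mult_mono[OF q1[of \<tau>] q1[of t]] q1[of \<tau>] q1[of t] by (intro divide_left_mono) auto
    also have "\<dots> \<le> \<bar>q t - q 0\<bar> + \<bar>q \<tau> - q 0\<bar>" by simp
    also have "\<dots> \<le> c / Lt + c / L\<tau>"
      unfolding Lt_def L\<tau>_def using hq[of t] hq[of \<tau>] t \<tau>0 by (intro add_mono) auto
    finally have d: "\<bar>s' - s\<bar> \<le> c / Lt + c / L\<tau>" .
    have l0: "0 \<le> ln (1 / \<tau>)" using \<tau>0 by simp
    have l1: "ln (1 / \<tau>) \<le> L\<tau>" unfolding L\<tau>_def using \<tau>0 by (intro ln_mono) auto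
    \<comment> \<open>The factor 3 absorbs \<open>ln 4 \<le> 2\<close>, which
      \<open>t / 4 \<le> \<tau>\<close> costs, by means of \<open>1 \<le> Lt\<close>; together with
      \<open>l1\<close> it leads to \<open>4 * c\<close>.\<close>
    have l2: "ln (1 / \<tau>) \<le> 3 * Lt"
    proof -
      have "ln (1 / \<tau>) \<le> ln (4 * (1 / t))" using t \<tau> \<tau>0 by (intro ln_mono) (auto simp: field_simps)
      also have "\<dots> = ln (2 * 2) + ln (1 / t)" using t by (subst ln_mult) auto
      also have "ln (2 * 2 :: real) = 2 * ln 2" by (subst ln_mult) auto
      also have "2 * ln 2 \<le> 2 * (1::real)" using ln_2_less_1 by simp
      also have "ln (1 / t) \<le> Lt" unfolding Lt_def using t by (intro ln_mono) auto
      finally show ?thesis using L1 by linarith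
    qed
    have "\<bar>s' - s\<bar> * ln (1 / \<tau>) \<le> (c / Lt + c / L\<tau>) * ln (1 / \<tau>)" using d l0 by (intro mult_right_mono)
    also have "\<dots> = c / Lt * ln (1 / \<tau>) + c / L\<tau> * ln (1 / \<tau>)" by (simp add: algebra_simps)
    also have "\<dots> \<le> c / Lt * (3 * Lt) + c / L\<tau> * L\<tau>" using l1 l2 c L1 by (intro add_mono mult_left_mono) auto
    also have "\<dots> = 4 * c" using L1 by simp
    finally have e: "\<bar>s' - s\<bar> * ln (1 / \<tau>) \<le> 4 * c" .
    have "x = G powr s'" using x q1[of \<tau>] by (simp add: G_def s'_def powr_powr)
    also have "\<dots> \<le> M powr s'" using M G s' by (intro powr_mono2) auto
    also have "\<dots> = M powr (s' - s) * M powr s" by (simp flip: powr_add)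
    also have "\<dots> \<le> exp (4 * c) * (b powr (s - 1) * M + b powr s)"
    proof (intro mult_mono)
      have "M powr (s' - s) \<le> M powr (- \<bar>s' - s\<bar>)" using M by (intro powr_mono') auto
      also have "\<dots> \<le> \<tau> powr (- \<bar>s' - s\<bar>)" using M \<tau>0 by (intro powr_mono2') auto
      also have "\<dots> = exp (\<bar>s' - s\<bar> * ln (1 / \<tau>))" using \<tau>0 by (simp add: powr_def ln_div)
      also have "\<dots> \<le> exp (4 * c)" using e by simp
      finally show "M powr (s' - s) \<le> exp (4 * c)" .
      show "M powr s \<le> b powr (s - 1) * M + b powr s" using M b s by (intro powr_Young) auto
    qed auto
    also have "\<dots> \<le> exp (4 * c) * (b powr (s - 1) * (x powr q \<tau> + \<tau>) + b powr s)"
      using M by (intro mult_left_mono add_mono) (auto simp: G_def)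
    also have "\<dots> \<le> (2 + exp (4 * c)) * (b powr (s - 1) * (x powr q \<tau> + \<tau>) + b powr s)"
      using nn by (intro mult_right_mono) auto
    finally show ?thesis by (simp add: s_def)
  qed
qed

lemma nn_integral_inverse_Icc_le:
  assumes "0 < a" "a \<le> b"
  shows "(\<integral>\<^sup>+t\<in>{a..b}. ennreal (1 / t) \<partial>lborel) \<le> ennreal ((b - a) / a)"
proof -
  have "(\<integral>\<^sup>+t\<in>{a..b}. ennreal (1 / t) \<partial>lborel) \<le> (\<integral>\<^sup>+t. ennreal (1 / a) * indicator {a..b} t \<partial>lborel)"
    using assms by (intro nn_integral_mono) (auto simp: indicator_def frac_le intro!: ennreal_leI)
  also have "\<dots> = ennreal (1 / a) * ennreal (b - a)"
    using assms by (subst nn_integral_cmult_indicator) auto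
  also have "\<dots> = ennreal ((b - a) / a)" using assms by (simp flip: ennreal_mult)
  finally show ?thesis .
qed

lemma Lq_norm_dt_cong: "(\<And>t. t \<in> I \<Longrightarrow> g t = h t) \<Longrightarrow> Lq_norm_dt q I g = Lq_norm_dt q I h"
  unfolding Lq_norm_dt_def
  by (intro arg_cong[where f=Inf] Collect_cong ex_cong1 conj_cong refl arg_cong[where f="\<lambda>x. x \<le> 1"] nn_integral_cong)
     (auto simp: indicator_def)

text \<open>\<open>A\<close> stands for the norm of the low-frequency part, which meets the scale
  \<open>t\<close> only for \<open>1 / 4 \<le> t\<close>, and \<open>H\<close> for the norms at the
  single scales. The predicate form makes it visible that \<open>C\<close> is chosen before
  \<open>g\<close>, \<open>H\<close> and \<open>A\<close>. The second clause is what the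
  low-frequency part of the other resolution requires.\<close>

definition local_average_constant :: "(real \<Rightarrow> real) \<Rightarrow> real \<Rightarrow> real \<Rightarrow> bool" where
  "local_average_constant q C0 C \<longleftrightarrow> 0 < C \<and>
    (\<forall>g H A. H \<in> borel_measurable borel \<longrightarrow>
      (\<forall>t. 0 < t \<longrightarrow> t \<le> 1 \<longrightarrow> g t \<le> ennreal C0 * ((if 1 / 4 \<le> t then A else 0) +
        (\<integral>\<^sup>+\<tau>\<in>{t / 4..min 1 (4 * t)}. H \<tau> * ennreal (1 / \<tau>) \<partial>lborel))) \<longrightarrow>
      Lq_norm_dt q {0<..1} g \<le> ennreal C * (A + Lq_norm_dt q {0<..1} H)) \<and>
    (\<forall>H. H \<in> borel_measurable borel \<longrightarrow>
      (\<integral>\<^sup>+\<tau>\<in>{1 / 4..1}. H \<tau> * ennreal (1 / \<tau>) \<partial>lborel) \<le> ennreal C * Lq_norm_dt q {0<..1} H)"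

text \<open>For \<open>1 / 4 \<le> t\<close> only scales above 1/16 occur; there
  \<open>d\<tau>/\<tau>\<close> is finite, and \<open>x \<le> x powr q \<tau> + 1\<close> turns the
  modular into an integral bound. For smaller \<open>t\<close> the exponent change is applied with
  \<open>a t\<close>, the integral of the modular density over a window around \<open>t\<close>.
  Fubini then closes the estimate, since \<tau> lies in the window of \<open>t\<close> only if
  \<open>t\<close> is between \<open>\<tau> / 4\<close> and \<open>4 * \<tau>\<close>.\<close>

lemma Lq_norm_dt_local_average_bound:
  fixes q :: "real \<Rightarrow> real" and C0 :: real
  assumes qv: "q \<in> var_exponents" and qH: "log_Hoelder_at_0 q" and C0: "0 \<le> C0"
  shows "\<exists>C. local_average_constant q C0 C"
proof -
  have q1: "\<And>t. 1 \<le> q t" and qm: "q \<in> borel_measurable lebesgue"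
    using qv by (auto simp: var_exponents_def)
  have q0: "0 \<le> q t" for t using q1[of t] by simp
  obtain c where c: "0 \<le> c" and hq: "\<And>t. \<bar>q t - q 0\<bar> \<le> c / ln (exp 1 + 1 / \<bar>t\<bar>)"
    using qH by (auto simp: log_Hoelder_at_0_def dest: less_imp_le)
  define K where "K = 2 + exp (4 * c)"
  have K: "2 \<le> K" by (simp add: K_def)
  \<comment> \<open>The 17 is one \<open>Lam\<close> for \<open>A\<close> and \<open>1 + 15\<close>
    for the scales above 1/16; the 16 is \<open>1 + 15\<close> with 15 the bound for the mass of a
    window. The 33 below is 3 for the scales above 1/4 plus \<open>2 * 15\<close> from
    Fubini.\<close>
  define E where "E = 17 * K * C0 + 1"
  have E: "0 < E" "17 * C0 \<le> E" "16 * K * C0 \<le> E"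
    using K C0 mult_right_mono[of 1 K C0] by (auto simp: E_def add_nonneg_pos)
  define C where "C = 33 * E + 17"
  have C: "0 < C" "33 * E \<le> C" "17 \<le> C" using E by (auto simp: C_def)
  \<comment> \<open>The power of \<open>H\<close> by the Lebesgue measurable \<open>q\<close> is
    replaced by a Borel function \<open>Q'\<close> equal to it almost everywhere, so that Fubini on
    \<open>lborel\<close> becomes available.\<close>
  have normalised: "\<exists>Q' \<in> borel_measurable borel. (AE \<tau> in lborel. enn_powr (H \<tau> / ennreal Lam) (q \<tau>) = Q' \<tau>)
      \<and> (\<integral>\<^sup>+\<tau>\<in>{0<..1}. Q' \<tau> * ennreal (1 / \<tau>) \<partial>lborel) \<le> 1
      \<and> (\<forall>a>0. (\<integral>\<^sup>+\<tau>\<in>{a..1}. H \<tau> * ennreal (1 / \<tau>) \<partial>lborel) \<le> ennreal (Lam * (1 + (1 - a) / a)))"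
    if [measurable]: "H \<in> borel_measurable borel" and less: "Lq_norm_dt q {0<..1} H < ennreal Lam" for H Lam
  proof -
    have L0: "0 < Lam" using less by (metis ennreal_less_zero_iff le_less_trans zero_le)
    have "(\<lambda>\<tau>. enn_powr (H \<tau> / ennreal Lam) (q \<tau>)) \<in> borel_measurable lebesgue"
    proof (rule borel_measurable_enn_powr)
      show "(\<lambda>\<tau>. H \<tau> / ennreal Lam) \<in> borel_measurable lebesgue"
        by (rule measurable_completion) measurable
    qed (rule qm)
    then obtain Q' where Q'[measurable]: "Q' \<in> borel_measurable borel"
      and ae: "AE \<tau> in lborel. enn_powr (H \<tau> / ennreal Lam) (q \<tau>) = Q' \<tau>"
      using completion_ex_borel_measurable[of _ lborel] by auto
    have "(\<integral>\<^sup>+\<tau>\<in>{0<..1}. Q' \<tau> * ennreal (1 / \<tau>) \<partial>lborel)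
      = (\<integral>\<^sup>+\<tau>\<in>{0<..1}. enn_powr (H \<tau> / ennreal Lam) (q \<tau>) * ennreal (1 / \<tau>) \<partial>lborel)"
      using ae by (intro nn_integral_cong_AE) (auto elim!: eventually_mono)
    also have "\<dots> \<le> 1" by (rule Lq_norm_dt_less_imp[OF q0 less])
    finally have Q1: "(\<integral>\<^sup>+\<tau>\<in>{0<..1}. Q' \<tau> * ennreal (1 / \<tau>) \<partial>lborel) \<le> 1" .
    have "(\<integral>\<^sup>+\<tau>\<in>{a..1}. H \<tau> * ennreal (1 / \<tau>) \<partial>lborel) \<le> ennreal (Lam * (1 + (1 - a) / a))" if a: "0 < a" for a
    proof (cases "a \<le> 1")
      case True
      have "(\<integral>\<^sup>+\<tau>\<in>{a..1}. H \<tau> * ennreal (1 / \<tau>) \<partial>lborel)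
        \<le> (\<integral>\<^sup>+\<tau>. ennreal Lam * ((Q' \<tau> * ennreal (1 / \<tau>) * indicator {0<..1} \<tau>) + ennreal (1 / \<tau>) * indicator {a..1} \<tau>) \<partial>lborel)"
      proof (rule nn_integral_mono_AE)
        show "AE \<tau> in lborel. H \<tau> * ennreal (1 / \<tau>) * indicator {a..1} \<tau>
          \<le> ennreal Lam * ((Q' \<tau> * ennreal (1 / \<tau>) * indicator {0<..1} \<tau>) + ennreal (1 / \<tau>) * indicator {a..1} \<tau>)"
          using ae
        proof eventually_elim
          case (elim \<tau>)
          have "H \<tau> \<le> ennreal Lam * (Q' \<tau> + 1)"
          proof (cases "H \<tau>")
            case (real r)
            have "r / Lam \<le> (r / Lam) powr q \<tau> + 1"
            proof (cases "1 \<le> r / Lam")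
              case True
              then show ?thesis using powr_mono[of 1 "q \<tau>" "r / Lam"] q1[of \<tau>] real L0 by simp
            next
              case False
              then show ?thesis by (intro add_increasing) auto
            qed
            then have "r \<le> Lam * ((r / Lam) powr q \<tau> + 1)" using L0 by (simp add: field_simps)
            then have "ennreal r \<le> ennreal (Lam * ((r / Lam) powr q \<tau> + 1))" by (rule ennreal_leI)
            then show ?thesis
              using real L0 elim[symmetric] by (simp add: divide_ennreal enn_powr_ennreal ennreal_mult ennreal_plus)
          next
            case top
            then have "Q' \<tau> = \<infinity>" using elim[symmetric] by (simp add: enn_powr_def ennreal_top_divide)
            then show ?thesis using L0 by (simp add: ennreal_mult_top)
          qed
          then have "H \<tau> * (ennreal (1 / \<tau>) * indicator {a..1} \<tau>) \<le> ennreal Lam * (Q' \<tau> + 1) * (ennreal (1 / \<tau>) * indicator {a..1} \<tau>)"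
            by (rule mult_right_mono) simp
          also have "\<dots> = ennreal Lam * (Q' \<tau> * ennreal (1 / \<tau>) * indicator {a..1} \<tau> + ennreal (1 / \<tau>) * indicator {a..1} \<tau>)"
            by (simp add: distrib_left distrib_right mult_ac)
          also have "\<dots> \<le> ennreal Lam * (Q' \<tau> * ennreal (1 / \<tau>) * indicator {0<..1} \<tau> + ennreal (1 / \<tau>) * indicator {a..1} \<tau>)"
            using a by (intro mult_left_mono add_mono) (auto simp: indicator_def)
          finally show ?case by (simp add: mult.assoc)
        qed
      qed
      also have "\<dots> = ennreal Lam * ((\<integral>\<^sup>+\<tau>\<in>{0<..1}. Q' \<tau> * ennreal (1 / \<tau>) \<partial>lborel) + (\<integral>\<^sup>+t\<in>{a..1}. ennreal (1 / t) \<partial>lborel))"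
        by (simp add: nn_integral_cmult nn_integral_add)
      also have "\<dots> \<le> ennreal Lam * (1 + ennreal ((1 - a) / a))"
        using a True by (intro mult_left_mono add_mono Q1 nn_integral_inverse_Icc_le) auto
      also have "\<dots> = ennreal (Lam * (1 + (1 - a) / a))"
        using a True L0 by (simp add: ennreal_mult)
      finally show ?thesis .
    qed (simp add: indicator_def)
    with Q' ae Q1 show ?thesis by blast
  qed
  have part2: "(\<integral>\<^sup>+\<tau>\<in>{1 / 4..1}. H \<tau> * ennreal (1 / \<tau>) \<partial>lborel) \<le> ennreal C * Lq_norm_dt q {0<..1} H"
    if [measurable]: "H \<in> borel_measurable borel" for H
  proof (cases "Lq_norm_dt q {0<..1} H")
    case (real r)
    show ?thesis
    proof (rule ennreal_le_epsilon)
      fix e :: real assume e: "0 < e"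
      have "r < r + e / C" using e C by simp
      then have less: "Lq_norm_dt q {0<..1} H < ennreal (r + e / C)"
        using real ennreal_less_iff by presburger
      have "\<forall>a>0. (\<integral>\<^sup>+\<tau>\<in>{a..1}. H \<tau> * ennreal (1 / \<tau>) \<partial>lborel) \<le> ennreal ((r + e / C) * (1 + (1 - a) / a))"
        using normalised[OF that less] by blast
      then have "(\<integral>\<^sup>+\<tau>\<in>{1 / 4..1}. H \<tau> * ennreal (1 / \<tau>) \<partial>lborel) \<le> ennreal ((r + e / C) * (1 + (1 - 1/4) / (1/4)))"
        by (rule allE[where x="1/4"]) simp
      also have "\<dots> \<le> ennreal ((r + e / C) * C)"
        using real e C by (intro ennreal_leI mult_left_mono) auto
      also have "\<dots> = ennreal C * Lq_norm_dt q {0<..1} H + ennreal e"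
      proof -
        have "(r + e / C) * C = C * r + e" using C by (simp add: field_simps)
        then show ?thesis using real e C by (simp add: ennreal_mult ennreal_plus)
      qed
      finally show "(\<integral>\<^sup>+\<tau>\<in>{1 / 4..1}. H \<tau> * ennreal (1 / \<tau>) \<partial>lborel) \<le> ennreal C * Lq_norm_dt q {0<..1} H + ennreal e" .
    qed
  next
    case top
    then show ?thesis using C by (simp add: ennreal_mult_top)
  qed
  have part1: "Lq_norm_dt q {0<..1} g \<le> ennreal C * (A + Lq_norm_dt q {0<..1} H)"
    if H[measurable]: "H \<in> borel_measurable borel"
      and g: "\<And>t. 0 < t \<Longrightarrow> t \<le> 1 \<Longrightarrow> g t \<le> ennreal C0 *
        ((if 1 / 4 \<le> t then A else 0) + (\<integral>\<^sup>+\<tau>\<in>{t / 4..min 1 (4 * t)}. H \<tau> * ennreal (1 / \<tau>) \<partial>lborel))"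
    for g H A
  proof (cases "A + Lq_norm_dt q {0<..1} H")
    case (real r)
    show ?thesis
    proof (rule ennreal_le_epsilon)
      fix e :: real assume e: "0 < e"
      define Lam where "Lam = r + e / C"
      have L0: "0 < Lam" using e C real by (simp add: Lam_def add_nonneg_pos)
      have sumless: "A + Lq_norm_dt q {0<..1} H < ennreal Lam"
      proof -
        have "r < Lam" using e C by (simp add: Lam_def)
        then show ?thesis using real L0 ennreal_less_iff by presburger
      qed
      have less: "Lq_norm_dt q {0<..1} H < ennreal Lam"
        by (rule le_less_trans[OF _ sumless]) simp
      have Ale: "A \<le> ennreal Lam"
        by (rule order_trans[OF _ less_imp_le[OF sumless]]) simp
      obtain Q' where Q'[measurable]: "Q' \<in> borel_measurable borel"
        and ae: "AE \<tau> in lborel. enn_powr (H \<tau> / ennreal Lam) (q \<tau>) = Q' \<tau>"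
        and Q1: "(\<integral>\<^sup>+\<tau>\<in>{0<..1}. Q' \<tau> * ennreal (1 / \<tau>) \<partial>lborel) \<le> 1"
        and Hint: "\<And>a. 0 < a \<Longrightarrow> (\<integral>\<^sup>+\<tau>\<in>{a..1}. H \<tau> * ennreal (1 / \<tau>) \<partial>lborel) \<le> ennreal (Lam * (1 + (1 - a) / a))"
        using normalised[OF H less] by blast
      \<comment> \<open>The summand \<tau> adds the Lebesgue measure of \<open>{0<..1}\<close> to
        the integral, hence the total of at most 2; it also keeps the window integral
        \<open>a t\<close> positive.\<close>
      define R where "R \<tau> = (Q' \<tau> + ennreal \<tau>) * ennreal (1 / \<tau>) * indicator {0<..1} \<tau>" for \<tau>
      have [measurable]: "R \<in> borel_measurable borel" unfolding R_def by measurable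
      have Rint: "(\<integral>\<^sup>+\<tau>. R \<tau> \<partial>lborel) \<le> 2"
      proof -
        have "(\<integral>\<^sup>+\<tau>. R \<tau> \<partial>lborel) = (\<integral>\<^sup>+\<tau>. Q' \<tau> * ennreal (1 / \<tau>) * indicator {0<..1} \<tau> + indicator {0<..1} \<tau> \<partial>lborel)"
          by (intro nn_integral_cong) (auto simp: R_def indicator_def distrib_right simp flip: ennreal_mult)
        also have "\<dots> = (\<integral>\<^sup>+\<tau>\<in>{0<..1}. Q' \<tau> * ennreal (1 / \<tau>) \<partial>lborel) + emeasure lborel {0<..1::real}"
          by (subst nn_integral_add) auto
        also have "\<dots> \<le> 1 + 1" by (intro add_mono Q1) auto
        finally show ?thesis by simp
      qed
      define a where "a t = (\<integral>\<^sup>+\<tau>. R \<tau> * indicator {t / 4..4 * t} \<tau> \<partial>lborel)" for t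
      have [measurable]: "(\<lambda>(t, \<tau>::real). indicator {t / 4..4 * t} \<tau> :: ennreal) \<in> borel_measurable (borel \<Otimes>\<^sub>M borel)"
      proof -
        have "(\<lambda>(t, \<tau>::real). indicator {t / 4..4 * t} \<tau> :: ennreal) = (\<lambda>(t, \<tau>::real). if t / 4 \<le> \<tau> \<and> \<tau> \<le> 4 * t then 1 else 0)"
          by (auto simp: indicator_def)
        then show ?thesis by simp
      qed
      have [measurable]: "a \<in> borel_measurable borel" unfolding a_def by measurable
      \<comment> \<open>Near scale 1 the constant 1 is an affordable majorant, because
        \<open>dt/t\<close> has finite mass on \<open>{1 / 4..1}\<close>.\<close>
      define A' where "A' t = (if 1 / 4 \<le> t then 1 else a t)" for t
      have "Lq_norm_dt q {0<..1} g \<le> ennreal (33 * (E * Lam))"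
      proof (rule Lq_norm_dt_leI_dominated[OF q1])
        show "A' \<in> borel_measurable borel" unfolding A'_def by measurable
        fix t :: real assume "t \<in> {0<..1}"
        then have t: "0 < t" "t \<le> 1" by auto
        show "enn_powr (g t / ennreal (E * Lam)) (q t) \<le> A' t"
        proof (cases "1 / 4 \<le> t")
          case True
          have "g t \<le> ennreal C0 * (A + (\<integral>\<^sup>+\<tau>\<in>{t / 4..min 1 (4 * t)}. H \<tau> * ennreal (1 / \<tau>) \<partial>lborel))"
            using g[OF t] True by simp
          also have "\<dots> \<le> ennreal C0 * (ennreal Lam + (\<integral>\<^sup>+\<tau>\<in>{1 / 16..1}. H \<tau> * ennreal (1 / \<tau>) \<partial>lborel))"
            using True by (intro mult_left_mono add_mono Ale nn_integral_mono) (auto simp: indicator_def)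
          also have "\<dots> \<le> ennreal C0 * (ennreal Lam + ennreal (Lam * (1 + (1 - 1 / 16) / (1 / 16))))"
            by (intro mult_left_mono add_mono Hint) auto
          also have "\<dots> = ennreal (C0 * (Lam + Lam * (1 + (1 - 1 / 16) / (1 / 16))))"
            using C0 L0 by (subst ennreal_plus[symmetric]) (auto simp flip: ennreal_mult)
          also have "\<dots> \<le> ennreal (E * Lam)"
            using mult_right_mono[OF E(2), of Lam] L0 by (intro ennreal_leI) (simp add: algebra_simps)
          finally have "g t / ennreal (E * Lam) \<le> 1"
            using E L0 by (intro divide_le_posI_ennreal) auto
          then have "enn_powr (g t / ennreal (E * Lam)) (q t) \<le> enn_powr (ennreal 1) (q t)"
            by (intro enn_powr_mono q0) simp
          then show ?thesis using True by (simp add: A'_def enn_powr_ennreal del: ennreal_1) simp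
        next
          case False
          \<comment> \<open>As \<open>t < 1 / 4\<close>, the window from \<open>t / 4\<close> to
            \<open>4 * t\<close> lies inside \<open>{0<..1}\<close>, where \<open>R\<close> is at
            least 1 because of its summand \<tau>.\<close>
          have lower: "ennreal (t * 15 / 4) \<le> a t"
          proof -
            have "ennreal (t * 15 / 4) = emeasure lborel {t / 4..4 * t}" using t by (simp add: field_simps)
            also have "\<dots> = (\<integral>\<^sup>+\<tau>. indicator {t / 4..4 * t} \<tau> \<partial>lborel)" by simp
            also have "\<dots> \<le> a t"
              unfolding a_def
            proof (rule nn_integral_mono)
              fix \<tau>
              have "1 \<le> (Q' \<tau> + ennreal \<tau>) * ennreal (1 / \<tau>)" if "t / 4 \<le> \<tau>"
              proof -
                have "1 = ennreal \<tau> * ennreal (1 / \<tau>)" using that t by (simp flip: ennreal_mult)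
                also have "\<dots> \<le> (Q' \<tau> + ennreal \<tau>) * ennreal (1 / \<tau>)" by (intro mult_right_mono) auto
                finally show ?thesis .
              qed
              then show "indicator {t / 4..4 * t} \<tau> \<le> R \<tau> * indicator {t / 4..4 * t} \<tau>"
                using t False by (auto simp: indicator_def R_def)
            qed
            finally show ?thesis .
          qed
          have upper: "a t \<le> 2"
          proof -
            have "a t \<le> (\<integral>\<^sup>+\<tau>. R \<tau> \<partial>lborel)" unfolding a_def by (intro nn_integral_mono) (auto simp: indicator_def)
            then show ?thesis using Rint by (rule order_trans)
          qed
          define b where "b = enn2real (a t)"
          have ab: "a t = ennreal b" unfolding b_def using le_less_trans[OF upper] by simp
          have b: "0 < b" "b \<le> 2"
          proof -
            have "t * 15 / 4 \<le> b" using lower unfolding ab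
              by (metis b_def enn2real_nonneg ennreal_le_iff)
            then show "0 < b" using t by linarith
            have "ennreal b \<le> ennreal 2" using upper unfolding ab by simp
            then show "b \<le> 2" by (subst (asm) ennreal_le_iff) auto
          qed
          define s where "s = 1 / q t"
          have "(\<integral>\<^sup>+\<tau>\<in>{t / 4..min 1 (4 * t)}. H \<tau> * ennreal (1 / \<tau>) \<partial>lborel)
            \<le> (\<integral>\<^sup>+\<tau>. ennreal (Lam * K) * (ennreal (b powr (s - 1)) * (R \<tau> * indicator {t / 4..4 * t} \<tau>)
                 + ennreal (b powr s) * (ennreal (1 / \<tau>) * indicator {t / 4..4 * t} \<tau>)) \<partial>lborel)"
          proof (rule nn_integral_mono_AE)
            show "AE \<tau> in lborel. H \<tau> * ennreal (1 / \<tau>) * indicator {t / 4..min 1 (4 * t)} \<tau>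
              \<le> ennreal (Lam * K) * (ennreal (b powr (s - 1)) * (R \<tau> * indicator {t / 4..4 * t} \<tau>)
                 + ennreal (b powr s) * (ennreal (1 / \<tau>) * indicator {t / 4..4 * t} \<tau>))"
              using ae
            proof eventually_elim
              case (elim \<tau>)
              show ?case
              proof (cases "\<tau> \<in> {t / 4..4 * t}")
                case True
                then have \<tau>: "0 < \<tau>" "\<tau> \<le> 1" "t / 4 \<le> \<tau>" "\<tau> \<le> 4 * t" using t False by auto
                have "H \<tau> \<le> ennreal (Lam * K) * (ennreal (b powr (s - 1)) * (Q' \<tau> + ennreal \<tau>) + ennreal (b powr s))"
                proof (cases "H \<tau>")
                  case (real r)
                  have "r / Lam \<le> K * (b powr (s - 1) * ((r / Lam) powr q \<tau> + \<tau>) + b powr s)"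
                    unfolding K_def s_def
                    using q1 c hq t False \<tau> real L0 b
                    by (intro powr_exponent_change_at_0_le) auto
                  then have "r \<le> (Lam * K) * (b powr (s - 1) * ((r / Lam) powr q \<tau> + \<tau>) + b powr s)"
                    using L0 by (simp add: pos_divide_le_eq mult_ac)
                  then have "ennreal r \<le> ennreal ((Lam * K) * (b powr (s - 1) * ((r / Lam) powr q \<tau> + \<tau>) + b powr s))"
                    by (rule ennreal_leI)
                  also have "\<dots> = ennreal (Lam * K) * (ennreal (b powr (s - 1)) * (ennreal ((r / Lam) powr q \<tau>) + ennreal \<tau>) + ennreal (b powr s))"
                    using L0 K \<tau> by (subst ennreal_mult, simp, simp, subst ennreal_plus, simp, simp, subst ennreal_mult, simp, simp, subst ennreal_plus) auto
                  finally show ?thesis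
                    using real L0 elim[symmetric] by (simp add: divide_ennreal enn_powr_ennreal)
                next
                  case top
                  then have "Q' \<tau> = \<infinity>" using elim[symmetric] by (simp add: enn_powr_def ennreal_top_divide)
                  then show ?thesis using L0 K b by (simp add: ennreal_mult_top)
                qed
                then have "H \<tau> * ennreal (1 / \<tau>) \<le> ennreal (Lam * K) * (ennreal (b powr (s - 1)) * (Q' \<tau> + ennreal \<tau>) + ennreal (b powr s)) * ennreal (1 / \<tau>)"
                  by (rule mult_right_mono) simp
                then show ?thesis using True \<tau> by (simp add: R_def distrib_right mult.assoc)
              qed (auto simp: indicator_def)
            qed
          qed
          also have "\<dots> = ennreal (Lam * K) * (ennreal (b powr (s - 1)) * a t
              + ennreal (b powr s) * (\<integral>\<^sup>+\<tau>\<in>{t / 4..4 * t}. ennreal (1 / \<tau>) \<partial>lborel))"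
            unfolding a_def by (simp add: nn_integral_cmult nn_integral_add)
          also have "\<dots> \<le> ennreal (Lam * K) * (ennreal (b powr (s - 1)) * ennreal b
              + ennreal (b powr s) * ennreal ((4 * t - t / 4) / (t / 4)))"
            unfolding ab using t by (intro mult_left_mono add_mono nn_integral_inverse_Icc_le) auto
          also have "\<dots> = ennreal (Lam * K * (b powr (s - 1) * b + b powr s * 15))"
          proof -
            have "(4 * t - t / 4) / (t / 4) = 15" using t by (simp add: field_simps)
            then show ?thesis using L0 K b
              by (simp only: ennreal_mult ennreal_plus mult_nonneg_nonneg add_nonneg_nonneg less_imp_le powr_ge_zero order_trans[OF zero_le_numeral K] zero_le_numeral)
          qed
          also have "b powr (s - 1) * b = b powr s" using b by (simp add: powr_diff)
          finally have Hle: "(\<integral>\<^sup>+\<tau>\<in>{t / 4..min 1 (4 * t)}. H \<tau> * ennreal (1 / \<tau>) \<partial>lborel) \<le> ennreal (16 * Lam * K * b powr s)"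
            by (simp add: algebra_simps)
          have "g t \<le> ennreal C0 * (\<integral>\<^sup>+\<tau>\<in>{t / 4..min 1 (4 * t)}. H \<tau> * ennreal (1 / \<tau>) \<partial>lborel)"
            using g[OF t] False by simp
          also have "\<dots> \<le> ennreal C0 * ennreal (16 * Lam * K * b powr s)" by (intro mult_left_mono Hle) auto
          also have "\<dots> = ennreal (C0 * (16 * Lam * K * b powr s))" using C0 L0 K by (simp add: ennreal_mult)
          also have "\<dots> \<le> ennreal (b powr s * (E * Lam))"
            using mult_right_mono[OF E(3), of "Lam * b powr s"] L0 by (intro ennreal_leI) (simp add: algebra_simps)
          also have "\<dots> = ennreal (b powr s) * ennreal (E * Lam)" using E L0 by (simp add: ennreal_mult)
          finally have "g t / ennreal (E * Lam) \<le> ennreal (b powr s)"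
            using E L0 by (intro divide_le_posI_ennreal) (auto simp: mult.commute)
          then have "enn_powr (g t / ennreal (E * Lam)) (q t) \<le> enn_powr (ennreal (b powr s)) (q t)"
            by (intro enn_powr_mono q0)
          also have "\<dots> = ennreal b" using b q1[of t] by (simp add: enn_powr_ennreal s_def powr_powr)
          finally show ?thesis using False ab by (simp add: A'_def)
        qed
      next
        have "(\<integral>\<^sup>+t\<in>{0<..1}. A' t * ennreal (1 / t) \<partial>lborel)
          \<le> (\<integral>\<^sup>+t. ennreal (1 / t) * indicator {1 / 4..1} t + a t * (ennreal (1 / t) * indicator {0<..1} t) \<partial>lborel)"
          by (intro nn_integral_mono) (auto simp: A'_def indicator_def)
        also have "\<dots> = (\<integral>\<^sup>+t\<in>{1 / 4..1}. ennreal (1 / t) \<partial>lborel) + (\<integral>\<^sup>+t. a t * (ennreal (1 / t) * indicator {0<..1} t) \<partial>lborel)"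
          by (intro nn_integral_add) auto
        also have "\<dots> \<le> ennreal ((1 - 1 / 4) / (1 / 4)) + ennreal 30"
        proof (intro add_mono nn_integral_inverse_Icc_le)
          have "(\<integral>\<^sup>+t. a t * (ennreal (1 / t) * indicator {0<..1} t) \<partial>lborel)
             = (\<integral>\<^sup>+t. (\<integral>\<^sup>+\<tau>. R \<tau> * indicator {t / 4..4 * t} \<tau> * (ennreal (1 / t) * indicator {0<..1} t) \<partial>lborel) \<partial>lborel)"
            unfolding a_def by (simp add: nn_integral_multc)
          also have "\<dots> = (\<integral>\<^sup>+\<tau>. (\<integral>\<^sup>+t. R \<tau> * indicator {t / 4..4 * t} \<tau> * (ennreal (1 / t) * indicator {0<..1} t) \<partial>lborel) \<partial>lborel)"
            by (rule nn_integral_swap) (auto intro: sigma_finite_lborel)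
          also have "\<dots> \<le> (\<integral>\<^sup>+\<tau>. R \<tau> * ennreal 15 \<partial>lborel)"
          proof (rule nn_integral_mono)
            fix \<tau> :: real
            show "(\<integral>\<^sup>+t. R \<tau> * indicator {t / 4..4 * t} \<tau> * (ennreal (1 / t) * indicator {0<..1} t) \<partial>lborel) \<le> R \<tau> * ennreal 15"
            proof (cases "0 < \<tau>")
              case True
              have "(\<integral>\<^sup>+t. R \<tau> * indicator {t / 4..4 * t} \<tau> * (ennreal (1 / t) * indicator {0<..1} t) \<partial>lborel)
                \<le> (\<integral>\<^sup>+t. R \<tau> * (ennreal (1 / t) * indicator {\<tau> / 4..4 * \<tau>} t) \<partial>lborel)"
                by (intro nn_integral_mono) (auto simp: indicator_def)
              also have "\<dots> = R \<tau> * (\<integral>\<^sup>+t\<in>{\<tau> / 4..4 * \<tau>}. ennreal (1 / t) \<partial>lborel)"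
                by (intro nn_integral_cmult) auto
              also have "\<dots> \<le> R \<tau> * ennreal ((4 * \<tau> - \<tau> / 4) / (\<tau> / 4))"
                using True by (intro mult_left_mono nn_integral_inverse_Icc_le) auto
              also have "(4 * \<tau> - \<tau> / 4) / (\<tau> / 4) = 15" using True by (simp add: field_simps)
              finally show ?thesis .
            next
              case False
              then have "R \<tau> = 0" by (simp add: R_def)
              then show ?thesis by simp
            qed
          qed
          also have "\<dots> = (\<integral>\<^sup>+\<tau>. R \<tau> \<partial>lborel) * ennreal 15" by (intro nn_integral_multc) auto
          also have "\<dots> \<le> 2 * ennreal 15" by (intro mult_right_mono Rint) auto
          also have "\<dots> = ennreal 30" by simp
          finally show "(\<integral>\<^sup>+t. a t * (ennreal (1 / t) * indicator {0<..1} t) \<partial>lborel) \<le> ennreal 30" .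
        qed auto
        also have "\<dots> = ennreal 33" by (subst ennreal_plus[symmetric]) auto
        finally show "(\<integral>\<^sup>+t\<in>{0<..1}. A' t * ennreal (1 / t) \<partial>lborel) \<le> ennreal 33" .
      qed (use E L0 in auto)
      also have "\<dots> \<le> ennreal (C * Lam)"
        using C L0 mult_right_mono[of "33 * E" C Lam] by (intro ennreal_leI) (simp add: mult.assoc)
      also have "C * Lam = C * r + e" using C(1) by (simp add: Lam_def distrib_left)
      also have "ennreal \<dots> = ennreal C * (A + Lq_norm_dt q {0<..1} H) + ennreal e"
        using C real e by (simp add: ennreal_mult ennreal_plus)
      finally show "Lq_norm_dt q {0<..1} g \<le> ennreal C * (A + Lq_norm_dt q {0<..1} H) + ennreal e" .
    qed
  next
    case top
    have "ennreal C * (A + Lq_norm_dt q {0<..1} H) = top"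
      unfolding top using C(1) by (simp add: ennreal_mult_top)
    then show ?thesis by simp
  qed
  show ?thesis
    unfolding local_average_constant_def by (intro exI[of _ C] conjI allI impI C(1) part1 part2) auto
qed

section \<open>Schwartz functions and tempered distributions\<close>

lemma smoothD: "smooth g \<Longrightarrow> set bs \<subseteq> Basis \<Longrightarrow> iter_partial bs g differentiable (at x)"
  by (auto simp: smooth_def)

lemma iter_partial_has_derivative:
  fixes g :: "'a::euclidean_space \<Rightarrow> complex"
  assumes "smooth g" "set bs \<subseteq> Basis"
  shows "(iter_partial bs g has_derivative (\<lambda>h. \<Sum>b\<in>Basis. (h \<bullet> b) *\<^sub>R iter_partial (b # bs) g x)) (at x)"
proof -
  have d: "(iter_partial bs g has_derivative frechet_derivative (iter_partial bs g) (at x)) (at x)"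
    using smoothD[OF assms] by (rule frechet_derivative_works[THEN iffD1])
  then interpret bounded_linear "frechet_derivative (iter_partial bs g) (at x)" by (rule has_derivative_bounded_linear)
  have "frechet_derivative (iter_partial bs g) (at x) h = (\<Sum>b\<in>Basis. (h \<bullet> b) *\<^sub>R iter_partial (b # bs) g x)" for h
  proof -
    have "frechet_derivative (iter_partial bs g) (at x) h = frechet_derivative (iter_partial bs g) (at x) (\<Sum>b\<in>Basis. (h \<bullet> b) *\<^sub>R b)"
      by (simp add: euclidean_representation)
    then show ?thesis by (simp add: sum scaleR)
  qed
  then show ?thesis using d by presburger
qed

lemma continuous_iter_partial:
  assumes "smooth g" "set bs \<subseteq> Basis"
  shows "continuous_on UNIV (iter_partial bs g)"
  using smoothD[OF assms] by (simp add: continuous_at_imp_continuous_on differentiable_imp_continuous_within)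

text \<open>Scalar multiples, dilations, translations and reflections are all of the form
  \<open>c * g (r *\<^sub>R z + y)\<close>, so one chain rule serves them all; each direction in the
  list contributes a factor \<open>r\<close>.\<close>

lemma iter_partial_affine:
  fixes g :: "'a::euclidean_space \<Rightarrow> complex"
  assumes g: "smooth g" and bs: "set bs \<subseteq> Basis"
  shows "iter_partial bs (\<lambda>z. c * g (r *\<^sub>R z + y)) = (\<lambda>z. c * of_real (r ^ length bs) * iter_partial bs g (r *\<^sub>R z + y))"
    and "(\<lambda>z. c * of_real (r ^ length bs) * iter_partial bs g (r *\<^sub>R z + y)) differentiable (at z)"
proof -
  have d: "((\<lambda>z. c * of_real (r ^ length bs) * iter_partial bs g (r *\<^sub>R z + y)) has_derivative
     (\<lambda>h. c * of_real (r ^ length bs) * (\<Sum>b\<in>Basis. ((r *\<^sub>R h) \<bullet> b) *\<^sub>R iter_partial (b # bs) g (r *\<^sub>R z + y)))) (at z)"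
    if "set bs \<subseteq> Basis" for bs z
    using that by (intro has_derivative_mult_right has_derivative_compose[OF _ iter_partial_has_derivative[OF g]])
      (auto intro!: derivative_eq_intros)
  then show "(\<lambda>z. c * of_real (r ^ length bs) * iter_partial bs g (r *\<^sub>R z + y)) differentiable (at z)"
    using bs unfolding differentiable_def by blast
  show "iter_partial bs (\<lambda>z. c * g (r *\<^sub>R z + y)) = (\<lambda>z. c * of_real (r ^ length bs) * iter_partial bs g (r *\<^sub>R z + y))"
    using bs
  proof (induction bs)
    case (Cons b bs)
    then have b: "b \<in> Basis" "set bs \<subseteq> Basis" by auto
    have "frechet_derivative (\<lambda>z. c * of_real (r ^ length bs) * iter_partial bs g (r *\<^sub>R z + y)) (at z) b =
        c * of_real (r ^ length (b # bs)) * iter_partial (b # bs) g (r *\<^sub>R z + y)" for z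
    proof -
      have "frechet_derivative (\<lambda>z. c * of_real (r ^ length bs) * iter_partial bs g (r *\<^sub>R z + y)) (at z) b
        = c * of_real (r ^ length bs) * (\<Sum>b'\<in>Basis. ((r *\<^sub>R b) \<bullet> b') *\<^sub>R iter_partial (b' # bs) g (r *\<^sub>R z + y))"
        unfolding frechet_derivative_at[OF d[OF b(2)], symmetric] ..
      also have "(\<Sum>b'\<in>Basis. ((r *\<^sub>R b) \<bullet> b') *\<^sub>R iter_partial (b' # bs) g (r *\<^sub>R z + y))
        = (\<Sum>b'\<in>Basis. if b' = b then r *\<^sub>R iter_partial (b' # bs) g (r *\<^sub>R z + y) else 0)"
        using b by (intro sum.cong) (auto simp: inner_Basis)
      also have "\<dots> = r *\<^sub>R iter_partial (b # bs) g (r *\<^sub>R z + y)" using b by simp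
      finally show ?thesis by (simp add: scaleR_conv_of_real)
    qed
    then show ?case using Cons by simp
  qed simp
qed

lemma smooth_affine:
  assumes "smooth g"
  shows "smooth (\<lambda>z. c * g (r *\<^sub>R z + y))"
  unfolding smooth_def
proof (intro allI impI)
  fix bs :: "'a list" and x :: 'a assume bs: "set bs \<subseteq> Basis"
  show "iter_partial bs (\<lambda>z. c * g (r *\<^sub>R z + y)) differentiable (at x)"
    unfolding iter_partial_affine(1)[OF assms bs] by (rule iter_partial_affine(2)[OF assms bs])
qed

lemma iter_partial_add:
  fixes g h :: "'a::euclidean_space \<Rightarrow> complex"
  assumes g: "smooth g" and h: "smooth h" and bs: "set bs \<subseteq> Basis"
  shows "iter_partial bs (\<lambda>z. g z + h z) = (\<lambda>z. iter_partial bs g z + iter_partial bs h z)"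
  using bs
proof (induction bs)
  case (Cons b bs)
  then have b: "set bs \<subseteq> Basis" by auto
  have "frechet_derivative (\<lambda>z. iter_partial bs g z + iter_partial bs h z) (at z) =
     (\<lambda>v. frechet_derivative (iter_partial bs g) (at z) v + frechet_derivative (iter_partial bs h) (at z) v)" for z
    using smoothD[OF g b] smoothD[OF h b]
    by (intro frechet_derivative_at[symmetric] has_derivative_add) (auto simp: frechet_derivative_works)
  then show ?case using Cons by simp
qed simp

lemma smooth_add: "smooth g \<Longrightarrow> smooth h \<Longrightarrow> smooth (\<lambda>z. g z + h z)"
  unfolding smooth_def[of "\<lambda>z. g z + h z"] by (auto simp: iter_partial_add intro: differentiable_add smoothD)

lemma iter_partial_cmult:
  assumes "smooth g" "set bs \<subseteq> Basis"
  shows "iter_partial bs (\<lambda>z. c * g z) = (\<lambda>z. c * iter_partial bs g z)"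
  using iter_partial_affine(1)[OF assms, of c 1 0] by simp

lemma smooth_cmult: "smooth g \<Longrightarrow> smooth (\<lambda>z. c * g z)"
  using smooth_affine[of g c 1 0] by simp

lemma iter_partial_diff:
  assumes g: "smooth g" and h: "smooth h" and bs: "set bs \<subseteq> Basis"
  shows "iter_partial bs (\<lambda>z. g z - h z) = (\<lambda>z. iter_partial bs g z - iter_partial bs h z)"
  using iter_partial_add[OF g smooth_cmult[OF h, of "-1"] bs] iter_partial_cmult[OF h bs, of "-1"] by simp

lemma SchwartzI:
  assumes "smooth g" "\<And>N bs. set bs \<subseteq> Basis \<Longrightarrow> \<exists>C. \<forall>x. (1 + norm x) ^ N * norm (iter_partial bs g x) \<le> C"
  shows "g \<in> Schwartz"
  using assms unfolding Schwartz_def bdd_above_def by (auto 4 4)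

lemma Schwartz_smooth: "g \<in> Schwartz \<Longrightarrow> smooth g"
  by (simp add: Schwartz_def)

lemma Schwartz_seminorm_upper:
  "g \<in> Schwartz \<Longrightarrow> set bs \<subseteq> Basis \<Longrightarrow> (1 + norm x) ^ N * norm (iter_partial bs g x) \<le> Schwartz_seminorm N bs g"
  unfolding Schwartz_seminorm_def by (intro cSUP_upper) (auto simp: Schwartz_def)

lemma Schwartz_seminorm_least:
  "(\<And>x. (1 + norm x) ^ N * norm (iter_partial bs g x) \<le> C) \<Longrightarrow> Schwartz_seminorm N bs g \<le> C"
  unfolding Schwartz_seminorm_def by (intro cSUP_least) auto

lemma Schwartz_seminorm_nonneg:
  "g \<in> Schwartz \<Longrightarrow> set bs \<subseteq> Basis \<Longrightarrow> 0 \<le> Schwartz_seminorm N bs g"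
  by (rule order_trans[OF _ Schwartz_seminorm_upper[where x=0]]) auto

lemma Schwartz_add:
  assumes "g \<in> Schwartz" "h \<in> Schwartz"
  shows "(\<lambda>z. g z + h z) \<in> Schwartz"
    and "set bs \<subseteq> Basis \<Longrightarrow> Schwartz_seminorm N bs (\<lambda>z. g z + h z) \<le> Schwartz_seminorm N bs g + Schwartz_seminorm N bs h"
proof -
  have *: "(1 + norm x) ^ N * norm (iter_partial bs (\<lambda>z. g z + h z) x) \<le> Schwartz_seminorm N bs g + Schwartz_seminorm N bs h"
    if bs: "set bs \<subseteq> Basis" for N bs x
  proof -
    have "(1 + norm x) ^ N * norm (iter_partial bs (\<lambda>z. g z + h z) x)
       \<le> (1 + norm x) ^ N * (norm (iter_partial bs g x) + norm (iter_partial bs h x))"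
      using assms bs by (intro mult_left_mono) (auto simp: iter_partial_add Schwartz_smooth norm_triangle_ineq)
    also have "\<dots> \<le> Schwartz_seminorm N bs g + Schwartz_seminorm N bs h"
      unfolding distrib_left using assms bs by (intro add_mono Schwartz_seminorm_upper)
    finally show ?thesis .
  qed
  show "(\<lambda>z. g z + h z) \<in> Schwartz"
    using assms * by (intro SchwartzI smooth_add) (auto simp: Schwartz_smooth)
  show "set bs \<subseteq> Basis \<Longrightarrow> Schwartz_seminorm N bs (\<lambda>z. g z + h z) \<le> Schwartz_seminorm N bs g + Schwartz_seminorm N bs h"
    using * by (intro Schwartz_seminorm_least)
qed

lemma Schwartz_cmult:
  assumes "g \<in> Schwartz"
  shows "(\<lambda>z. c * g z) \<in> Schwartz"
    and "set bs \<subseteq> Basis \<Longrightarrow> Schwartz_seminorm N bs (\<lambda>z. c * g z) \<le> norm c * Schwartz_seminorm N bs g"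
proof -
  have *: "(1 + norm x) ^ N * norm (iter_partial bs (\<lambda>z. c * g z) x) \<le> norm c * Schwartz_seminorm N bs g"
    if bs: "set bs \<subseteq> Basis" for N bs x
  proof -
    have "(1 + norm x) ^ N * norm (iter_partial bs (\<lambda>z. c * g z) x)
       = norm c * ((1 + norm x) ^ N * norm (iter_partial bs g x))"
      using assms bs by (simp add: iter_partial_cmult Schwartz_smooth norm_mult)
    also have "\<dots> \<le> norm c * Schwartz_seminorm N bs g"
      using assms bs by (intro mult_left_mono Schwartz_seminorm_upper) auto
    finally show ?thesis .
  qed
  show "(\<lambda>z. c * g z) \<in> Schwartz"
    using assms * by (intro SchwartzI smooth_cmult) (auto simp: Schwartz_smooth)
  show "set bs \<subseteq> Basis \<Longrightarrow> Schwartz_seminorm N bs (\<lambda>z. c * g z) \<le> norm c * Schwartz_seminorm N bs g"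
    using * by (intro Schwartz_seminorm_least)
qed

lemma Schwartz_diff:
  assumes "g \<in> Schwartz" "h \<in> Schwartz"
  shows "(\<lambda>z. g z - h z) \<in> Schwartz"
  using Schwartz_add(1)[OF assms(1) Schwartz_cmult(1)[OF assms(2), of "-1"]] by simp

lemma Schwartz_zero: "(\<lambda>_. 0) \<in> (Schwartz :: ('a::euclidean_space \<Rightarrow> complex) set)"
proof -
  have *: "iter_partial bs (\<lambda>_::'a. 0) = (\<lambda>_. 0)" for bs
    by (induction bs) (auto simp: frechet_derivative_const)
  show ?thesis by (rule SchwartzI) (auto simp: smooth_def *)
qed

section \<open>Continuity of a functional as a bound by finitely many seminorms\<close>

lemma tempered_add: "f \<in> tempered_distributions \<Longrightarrow> g \<in> Schwartz \<Longrightarrow> h \<in> Schwartz \<Longrightarrow> f (\<lambda>x. g x + h x) = f g + f h"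
  and tempered_cmult: "f \<in> tempered_distributions \<Longrightarrow> g \<in> Schwartz \<Longrightarrow> f (\<lambda>x. c * g x) = c * f g"
  unfolding tempered_distributions_def by blast+

lemma tempered_diff:
  assumes "f \<in> tempered_distributions" "g \<in> Schwartz" "h \<in> Schwartz"
  shows "f (\<lambda>x. g x - h x) = f g - f h"
  using tempered_add[OF assms(1,2) Schwartz_cmult(1)[OF assms(3), of "-1"]] tempered_cmult[OF assms(1,3), of "-1"]
  by simp

lemma tempered_zero: "f \<in> tempered_distributions \<Longrightarrow> f (\<lambda>_. 0) = 0"
  using tempered_cmult[OF _ Schwartz_zero, of f 0] by simp

text \<open>The subbasis consists of seminorm balls with arbitrary centres. Induction over the
  generation of \<open>U\<close> turns them into balls centred at \<open>g\<close>: intersections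
  unite the sets of seminorms, and a ball about \<open>h\<close> contains one about \<open>g\<close>
  by the triangle inequality.\<close>

lemma Schwartz_topology_nhds:
  assumes "openin Schwartz_topology U" "g \<in> U"
  shows "\<exists>F e. finite F \<and> (\<forall>(N, bs)\<in>F. set bs \<subseteq> Basis) \<and> 0 < e \<and>
     (\<forall>k\<in>Schwartz. (\<forall>(N, bs)\<in>F. Schwartz_seminorm N bs (\<lambda>x. k x - g x) < e) \<longrightarrow> k \<in> U)"
proof -
  have g: "g \<in> Schwartz" using assms openin_subset topspace_Schwartz_topology by blast
  have "generate_topology_on {{g \<in> Schwartz. Schwartz_seminorm N bs (\<lambda>x. g x - h x) < e} | N bs h e.
        set bs \<subseteq> Basis \<and> h \<in> Schwartz \<and> 0 < e} U"
    using assms(1) unfolding Schwartz_topology_def by (rule openin_topology_generated_by)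
  then show ?thesis using assms(2)
  proof (induction U)
    case Empty
    then show ?case by simp
  next
    case (Int a b)
    then have "g \<in> a" "g \<in> b" by auto
    obtain F e where *: "finite F" "\<forall>(N, bs)\<in>F. set bs \<subseteq> Basis" "0 < e"
       "\<forall>k\<in>Schwartz. (\<forall>(N, bs)\<in>F. Schwartz_seminorm N bs (\<lambda>x. k x - g x) < e) \<longrightarrow> k \<in> a"
      using Int.IH(1)[OF \<open>g \<in> a\<close>] by (elim exE conjE) rule
    obtain F' e' where **: "finite F'" "\<forall>(N, bs)\<in>F'. set bs \<subseteq> Basis" "0 < e'"
       "\<forall>k\<in>Schwartz. (\<forall>(N, bs)\<in>F'. Schwartz_seminorm N bs (\<lambda>x. k x - g x) < e') \<longrightarrow> k \<in> b"
      using Int.IH(2)[OF \<open>g \<in> b\<close>] by (elim exE conjE) rule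
    show ?case
      by (rule exI[of _ "F \<union> F'"], rule exI[of _ "min e e'"]) (use * ** in \<open>auto simp: split_def\<close>)
  next
    case (UN K)
    then obtain k where k: "k \<in> K" "g \<in> k" by auto
    from UN.IH[OF k] obtain F e where *: "finite F" "\<forall>(N, bs)\<in>F. set bs \<subseteq> Basis" "0 < e"
       "\<forall>k'\<in>Schwartz. (\<forall>(N, bs)\<in>F. Schwartz_seminorm N bs (\<lambda>x. k' x - g x) < e) \<longrightarrow> k' \<in> k"
      by (elim exE conjE) rule
    show ?case by (rule exI[of _ F], rule exI[of _ e]) (use * k in auto)
  next
    case (Basis s)
    then obtain N bs h e where s: "s = {g \<in> Schwartz. Schwartz_seminorm N bs (\<lambda>x. g x - h x) < e}"
      "set bs \<subseteq> Basis" "h \<in> Schwartz" "0 < e" by auto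
    show ?case
    proof (rule exI[of _ "{(N, bs)}"], rule exI[of _ "e - Schwartz_seminorm N bs (\<lambda>x. g x - h x)"], intro conjI ballI impI)
      show "0 < e - Schwartz_seminorm N bs (\<lambda>x. g x - h x)" using Basis s by simp
      fix k assume k: "k \<in> Schwartz" "\<forall>(N', bs')\<in>{(N, bs)}. Schwartz_seminorm N' bs' (\<lambda>x. k x - g x) < e - Schwartz_seminorm N bs (\<lambda>x. g x - h x)"
      have "Schwartz_seminorm N bs (\<lambda>x. (k x - g x) + (g x - h x)) \<le> Schwartz_seminorm N bs (\<lambda>x. k x - g x) + Schwartz_seminorm N bs (\<lambda>x. g x - h x)"
        using k g s by (intro Schwartz_add(2) Schwartz_diff)
      then show "k \<in> s" using k s by simp
    qed (use s in auto)
  qed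
qed

text \<open>A scaling argument: continuity at 0 bounds \<open>f\<close> by 1 where finitely many
  seminorms are below \<open>e\<close>, and homogeneity extends this to every
  \<open>g\<close>.\<close>

lemma tempered_bounded:
  assumes f: "f \<in> tempered_distributions"
  obtains C F where "0 \<le> C" "finite F" "\<And>N bs. (N, bs) \<in> F \<Longrightarrow> set bs \<subseteq> Basis"
    "\<And>g. g \<in> Schwartz \<Longrightarrow> norm (f g) \<le> C * (\<Sum>(N, bs)\<in>F. Schwartz_seminorm N bs g)"
proof -
  have opn: "openin Schwartz_topology {g \<in> topspace Schwartz_topology. f g \<in> ball 0 1}"
    using f by (intro openin_continuous_map_preimage[where Y=euclidean]) (auto simp: tempered_distributions_def)
  have "(\<lambda>_. 0) \<in> {g \<in> topspace Schwartz_topology. f g \<in> ball 0 1}"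
    using tempered_zero[OF f] Schwartz_zero by (simp add: topspace_Schwartz_topology)
  from Schwartz_topology_nhds[OF opn this] obtain F e where F: "finite F" "\<forall>(N, bs)\<in>F. set bs \<subseteq> Basis" and e: "0 < e"
    and imp: "\<forall>k\<in>Schwartz. (\<forall>(N, bs)\<in>F. Schwartz_seminorm N bs (\<lambda>x. k x - 0) < e) \<longrightarrow> k \<in> {g \<in> topspace Schwartz_topology. f g \<in> ball 0 1}"
    by (elim exE conjE) rule
  have F': "set bs \<subseteq> Basis" if "(N, bs) \<in> F" for N bs using F that by auto
  have bound: "norm (f g) \<le> 1 / e * (\<Sum>(N, bs)\<in>F. Schwartz_seminorm N bs g)" if g: "g \<in> Schwartz" for g
  proof -
    define S where "S = (\<Sum>(N, bs)\<in>F. Schwartz_seminorm N bs g)"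
    have S: "Schwartz_seminorm N bs g \<le> S" if "(N, bs) \<in> F" for N bs
    proof -
      have "(\<lambda>(N, bs). Schwartz_seminorm N bs g) (N, bs) \<le> S"
        unfolding S_def using F F' g that
        by (intro member_le_sum) (auto intro!: Schwartz_seminorm_nonneg)
      then show ?thesis by simp
    qed
    have S0: "0 \<le> S" unfolding S_def using F' g by (intro sum_nonneg) (auto intro!: Schwartz_seminorm_nonneg)
    \<comment> \<open>The positive \<open>d\<close> allows for \<open>S = 0\<close>, where the
      scaling factor \<open>e / S\<close> would be meaningless; it tends to 0 at the end.\<close>
    have "norm (f g) < (S + d) / e" if d: "0 < d" for d
    proof -
      define r where "r = e / (S + d)"
      have r: "0 < r" using e d S0 by (simp add: r_def)
      have "r * S < e"
      proof -
        have "r * S = e * (S / (S + d))" by (simp add: r_def)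
        also have "\<dots> < e * 1" using e d S0 by (intro mult_strict_left_mono) auto
        finally show ?thesis by simp
      qed
      have "Schwartz_seminorm N bs (\<lambda>x. of_real r * g x - 0) < e" if "(N, bs) \<in> F" for N bs
      proof -
        have "Schwartz_seminorm N bs (\<lambda>x. of_real r * g x) \<le> norm (complex_of_real r) * Schwartz_seminorm N bs g"
          using g F'[OF that] by (intro Schwartz_cmult(2))
        also have "\<dots> \<le> r * S" using S[OF that] r by simp
        finally show ?thesis using \<open>r * S < e\<close> by simp
      qed
      then have "\<forall>(N, bs)\<in>F. Schwartz_seminorm N bs (\<lambda>x. of_real r * g x - 0) < e" by auto
      with bspec[OF imp Schwartz_cmult(1)[OF g, of "of_real r"]]
      have "f (\<lambda>x. of_real r * g x) \<in> ball 0 1" by simp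
      then have "r * norm (f g) < 1" using tempered_cmult[OF f g] r by (simp add: norm_mult)
      then have "norm (f g) < 1 / r" using r by (simp add: pos_less_divide_eq mult.commute)
      then show ?thesis by (simp add: r_def)
    qed
    then have "norm (f g) * e < S + d" if "0 < d" for d using that e by (simp add: pos_less_divide_eq)
    then have "norm (f g) * e \<le> S" by (meson field_le_epsilon less_imp_le)
    then have "norm (f g) \<le> S / e" using e by (simp add: pos_le_divide_eq)
    then show ?thesis by (simp add: S_def)
  qed
  show thesis by (rule that[OF _ F(1) F' bound]) (use e in auto)
qed

section \<open>Integrals of families of Schwartz functions\<close>

text \<open>Dominated convergence along sequences tending to \<open>z\<close>: the mean value
  inequality bounds the increment of \<open>F \<omega>\<close> by \<open>W \<omega>\<close> times
  the distance, so the remainder quotient has the majorant \<open>2 * W \<omega>\<close>.\<close>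

lemma has_derivative_lebesgue_integral:
  fixes F :: "'w \<Rightarrow> 'a::real_normed_vector \<Rightarrow> 'b::{banach, second_countable_topology}"
  assumes F: "\<And>z. integrable M (\<lambda>\<omega>. F \<omega> z)" and L: "\<And>z h. integrable M (\<lambda>\<omega>. L \<omega> z h)" and W: "integrable M W"
    and W0: "\<And>\<omega>. 0 \<le> W \<omega>"
    and d: "\<And>\<omega> z. (F \<omega> has_derivative L \<omega> z) (at z)"
    and bound: "\<And>\<omega> z h. norm (L \<omega> z h) \<le> W \<omega> * norm h"
  shows "((\<lambda>z. LINT \<omega>|M. F \<omega> z) has_derivative (\<lambda>h. LINT \<omega>|M. L \<omega> z h)) (at z)"
  unfolding has_derivative_within
proof
  have lin: "bounded_linear (L \<omega> z)" for \<omega> z using d by (rule has_derivative_bounded_linear)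
  show "bounded_linear (\<lambda>h. LINT \<omega>|M. L \<omega> z h)"
  proof (rule bounded_linear_intro[where K="integral\<^sup>L M W"])
    fix x y :: 'a and r :: real
    show "(LINT \<omega>|M. L \<omega> z (x + y)) = (LINT \<omega>|M. L \<omega> z x) + (LINT \<omega>|M. L \<omega> z y)"
      using L by (simp add: linear_add[OF bounded_linear.linear[OF lin]])
    show "(LINT \<omega>|M. L \<omega> z (r *\<^sub>R x)) = r *\<^sub>R (LINT \<omega>|M. L \<omega> z x)"
      by (simp add: linear_cmul[OF bounded_linear.linear[OF lin]])
    have "norm (LINT \<omega>|M. L \<omega> z x) \<le> (LINT \<omega>|M. norm (L \<omega> z x))" by simp
    also have "\<dots> \<le> (LINT \<omega>|M. W \<omega> * norm x)"
      using L W bound by (intro integral_mono) auto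
    finally show "norm (LINT \<omega>|M. L \<omega> z x) \<le> norm x * integral\<^sup>L M W" by (simp add: mult.commute)
  qed
  show "((\<lambda>y. (1 / norm (y - z)) *\<^sub>R ((LINT \<omega>|M. F \<omega> y) - ((LINT \<omega>|M. F \<omega> z) + (LINT \<omega>|M. L \<omega> z (y - z))))) \<longlongrightarrow> 0) (at z)"
    unfolding tendsto_at_iff_sequentially
  proof (intro allI impI)
    fix X :: "nat \<Rightarrow> 'a" assume X: "\<forall>i. X i \<in> UNIV - {z}" "X \<longlonglongrightarrow> z"
    define s where "s i \<omega> = (1 / norm (X i - z)) *\<^sub>R (F \<omega> (X i) - (F \<omega> z + L \<omega> z (X i - z)))" for i \<omega>
    have sint: "integrable M (s i)" for i
      unfolding s_def using F L by (intro integrable_scaleR_right Bochner_Integration.integrable_diff Bochner_Integration.integrable_add)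
    have "(\<lambda>i. LINT \<omega>|M. s i \<omega>) \<longlonglongrightarrow> (LINT \<omega>|M. 0)"
    proof (rule integral_dominated_convergence[where w="\<lambda>\<omega>. 2 * W \<omega>"])
      show "AE \<omega> in M. (\<lambda>i. s i \<omega>) \<longlonglongrightarrow> 0"
      proof (rule AE_I2)
        fix \<omega>
        have "((\<lambda>y. (1 / norm (y - z)) *\<^sub>R (F \<omega> y - (F \<omega> z + L \<omega> z (y - z)))) \<longlongrightarrow> 0) (at z)"
          using d[of \<omega> z] unfolding has_derivative_within by blast
        then show "(\<lambda>i. s i \<omega>) \<longlonglongrightarrow> 0"
          using X unfolding tendsto_at_iff_sequentially s_def comp_def by blast
      qed
      show "AE \<omega> in M. norm (s i \<omega>) \<le> 2 * W \<omega>" for i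
      proof (rule AE_I2)
        fix \<omega>
        have on: "onorm (L \<omega> x) \<le> W \<omega>" for x
          using bound[of \<omega> x] W0 by (intro onorm_bound) auto
        have "norm (F \<omega> (X i) - F \<omega> z) \<le> W \<omega> * norm (X i - z)"
          using d on by (intro differentiable_bound[where S=UNIV and f'="L \<omega>"]) auto
        then have "norm (F \<omega> (X i) - (F \<omega> z + L \<omega> z (X i - z))) \<le> W \<omega> * norm (X i - z) + W \<omega> * norm (X i - z)"
          using bound[of \<omega> z "X i - z"] norm_triangle_ineq4[of "F \<omega> (X i) - F \<omega> z" "L \<omega> z (X i - z)"]
          by (simp add: algebra_simps)
        moreover have "X i \<noteq> z" using X by auto
        ultimately show "norm (s i \<omega>) \<le> 2 * W \<omega>" by (simp add: s_def divide_simps)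
      qed
    qed (use sint W in auto)
    moreover have "(LINT \<omega>|M. s i \<omega>) = (1 / norm (X i - z)) *\<^sub>R ((LINT \<omega>|M. F \<omega> (X i)) - ((LINT \<omega>|M. F \<omega> z) + (LINT \<omega>|M. L \<omega> z (X i - z))))" for i
      unfolding s_def using F L by simp
    ultimately show "((\<lambda>y. (1 / norm (y - z)) *\<^sub>R ((LINT \<omega>|M. F \<omega> y) - ((LINT \<omega>|M. F \<omega> z) + (LINT \<omega>|M. L \<omega> z (y - z))))) \<circ> X) \<longlonglongrightarrow> 0"
      by (simp add: comp_def)
  qed
qed

text \<open>The conditions are chosen so that \<open>K\<close> becomes continuous as a map into the
  Schwartz space: joint continuity makes the derivatives converge uniformly on compact sets, and the
  continuous bound \<open>W\<close>, available for every \<open>N\<close>, prevents a loss at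
  infinity in \<open>z\<close>.\<close>

locale Schwartz_family =
  fixes K :: "'w::euclidean_space \<Rightarrow> 'a::euclidean_space \<Rightarrow> complex"
  assumes smooth_K: "\<And>\<omega>. smooth (K \<omega>)"
    and continuous_K: "\<And>bs. set bs \<subseteq> Basis \<Longrightarrow> continuous_on UNIV (\<lambda>(\<omega>, z). iter_partial bs (K \<omega>) z)"
    and bound_K: "\<And>N bs. set bs \<subseteq> Basis \<Longrightarrow>
      \<exists>W. continuous_on UNIV W \<and> (\<forall>\<omega> z. (1 + norm z) ^ N * norm (iter_partial bs (K \<omega>) z) \<le> W \<omega>)"
begin

lemma Schwartz_K: "K \<omega> \<in> Schwartz"
  using smooth_K bound_K by (intro SchwartzI) blast+

text \<open>Outside a ball of radius \<open>R\<close> the spare factor \<open>1 + norm z\<close> in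
  the seminorm of order \<open>Suc N\<close> makes the difference small; inside it, uniform
  continuity on a compact set applies.\<close>

lemma local_seminorm_small:
  assumes bs: "set bs \<subseteq> Basis" and e: "0 < e"
  shows "\<exists>d>0. \<forall>\<omega>. dist \<omega> \<omega>0 < d \<longrightarrow> Schwartz_seminorm N bs (\<lambda>z. K \<omega> z - K \<omega>0 z) \<le> e"
proof -
  obtain W where W: "continuous_on UNIV W" "\<And>\<omega> z. (1 + norm z) ^ Suc N * norm (iter_partial bs (K \<omega>) z) \<le> W \<omega>"
    using bound_K[OF bs, of "Suc N"] by blast
  have W0: "0 \<le> W \<omega>" for \<omega> by (rule order_trans[OF _ W(2)[of 0]]) auto
  obtain d1 where d1: "0 < d1" "\<And>\<omega>. dist \<omega> \<omega>0 < d1 \<Longrightarrow> dist (W \<omega>) (W \<omega>0) < 1"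
    using W(1) unfolding continuous_on_iff by (metis UNIV_I zero_less_one)
  define B where "B = 2 * (W \<omega>0 + 1)"
  define R where "R = B / e"
  have R: "0 < R" using W0[of \<omega>0] e by (simp add: R_def B_def add_nonneg_pos)
  have "uniformly_continuous_on (cball \<omega>0 1 \<times> cball 0 R) (\<lambda>(\<omega>, z). iter_partial bs (K \<omega>) z)"
    by (intro compact_uniformly_continuous compact_Times compact_cball continuous_on_subset[OF continuous_K[OF bs]]) auto
  moreover have e': "0 < e / (1 + R) ^ N" using e R by simp
  ultimately obtain d2 where d2: "0 < d2" "\<And>u v. u \<in> cball \<omega>0 1 \<times> cball 0 R \<Longrightarrow> v \<in> cball \<omega>0 1 \<times> cball 0 R \<Longrightarrow>
      dist v u < d2 \<Longrightarrow> dist (case v of (\<omega>, z) \<Rightarrow> iter_partial bs (K \<omega>) z) (case u of (\<omega>, z) \<Rightarrow> iter_partial bs (K \<omega>) z) < e / (1 + R) ^ N"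
    unfolding uniformly_continuous_on_def by meson
  show ?thesis
  proof (intro exI[of _ "min d1 (min d2 1)"] conjI allI impI)
    show "0 < min d1 (min d2 1)" using d1 d2 by simp
    fix \<omega> assume \<omega>: "dist \<omega> \<omega>0 < min d1 (min d2 1)"
    show "Schwartz_seminorm N bs (\<lambda>z. K \<omega> z - K \<omega>0 z) \<le> e"
    proof (rule Schwartz_seminorm_least)
      fix z
      have eq: "iter_partial bs (\<lambda>z. K \<omega> z - K \<omega>0 z) z = iter_partial bs (K \<omega>) z - iter_partial bs (K \<omega>0) z"
        by (simp add: iter_partial_diff smooth_K bs)
      show "(1 + norm z) ^ N * norm (iter_partial bs (\<lambda>z. K \<omega> z - K \<omega>0 z) z) \<le> e"
      proof (cases "norm z \<le> R")
        case True
        have "dist (case (\<omega>, z) of (\<omega>, z) \<Rightarrow> iter_partial bs (K \<omega>) z) (case (\<omega>0, z) of (\<omega>, z) \<Rightarrow> iter_partial bs (K \<omega>) z) < e / (1 + R) ^ N"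
          using \<omega> True by (intro d2) (auto simp: dist_Pair_Pair dist_commute)
        then have "(1 + norm z) ^ N * norm (iter_partial bs (K \<omega>) z - iter_partial bs (K \<omega>0) z) \<le> (1 + R) ^ N * (e / (1 + R) ^ N)"
          using True R e by (intro mult_mono power_mono) (auto simp: dist_norm)
        also have "\<dots> = e" using R by simp
        finally show ?thesis unfolding eq .
      next
        case False
        have "W \<omega> \<le> W \<omega>0 + 1" using d1(2)[of \<omega>] \<omega> by (auto simp: dist_real_def)
        have "(1 + norm z) ^ Suc N * norm (iter_partial bs (K \<omega>) z - iter_partial bs (K \<omega>0) z)
           \<le> (1 + norm z) ^ Suc N * (norm (iter_partial bs (K \<omega>) z) + norm (iter_partial bs (K \<omega>0) z))"
          by (intro mult_left_mono norm_triangle_ineq4) auto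
        also have "\<dots> \<le> W \<omega> + W \<omega>0" unfolding distrib_left by (intro add_mono W)
        also have "\<dots> \<le> B" using \<open>W \<omega> \<le> W \<omega>0 + 1\<close> by (simp add: B_def)
        finally have "(1 + norm z) * ((1 + norm z) ^ N * norm (iter_partial bs (\<lambda>z. K \<omega> z - K \<omega>0 z) z)) \<le> e * R"
          unfolding eq using e by (simp add: R_def mult.assoc)
        also have "\<dots> \<le> e * (1 + norm z)" using False e by simp
        finally show ?thesis by (simp add: mult.commute[of e] add_pos_nonneg)
      qed
    qed
  qed
qed

lemma local_seminorms_small:
  assumes "finite F" "\<And>x. x \<in> F \<Longrightarrow> set (snd x) \<subseteq> Basis" and e: "0 < e"
  shows "\<exists>d>0. \<forall>\<omega>. dist \<omega> \<omega>0 < d \<longrightarrow> (\<forall>x\<in>F. Schwartz_seminorm (fst x) (snd x) (\<lambda>z. K \<omega> z - K \<omega>0 z) \<le> e)"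
  using assms(1,2)
proof (induction F rule: finite_induct)
  case empty
  then show ?case by (auto intro: exI[of _ 1])
next
  case (insert x F)
  have "set (snd x) \<subseteq> Basis" using insert.prems by simp
  from local_seminorm_small[OF this e, of \<omega>0 "fst x"]
  obtain d1 where d1: "0 < d1" "\<forall>\<omega>. dist \<omega> \<omega>0 < d1 \<longrightarrow> Schwartz_seminorm (fst x) (snd x) (\<lambda>z. K \<omega> z - K \<omega>0 z) \<le> e" by blast
  obtain d2 where d2: "0 < d2" "\<forall>\<omega>. dist \<omega> \<omega>0 < d2 \<longrightarrow> (\<forall>x\<in>F. Schwartz_seminorm (fst x) (snd x) (\<lambda>z. K \<omega> z - K \<omega>0 z) \<le> e)"
    using insert.IH insert.prems by auto
  show ?case
    by (rule exI[of _ "min d1 d2"]) (use d1 d2 in auto)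
qed

lemma local_tempered_small:
  assumes f: "f \<in> tempered_distributions" and e: "0 < e"
  shows "\<exists>d>0. \<forall>\<omega>. dist \<omega> \<omega>0 < d \<longrightarrow> norm (f (K \<omega>) - f (K \<omega>0)) \<le> e"
proof -
  obtain C F where C: "0 \<le> C" and F: "finite F" "\<And>N bs. (N, bs) \<in> F \<Longrightarrow> set bs \<subseteq> Basis"
    and bound: "\<And>g. g \<in> Schwartz \<Longrightarrow> norm (f g) \<le> C * (\<Sum>(N, bs)\<in>F. Schwartz_seminorm N bs g)"
    using tempered_bounded[OF f] by metis
  \<comment> \<open>The 1 in the denominator covers the case that \<open>C * card F\<close> is
    0.\<close>
  define e' where "e' = e / (C * card F + 1)"
  have e': "0 < e'" using e C by (simp add: e'_def add_nonneg_pos)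
  have F': "set (snd x) \<subseteq> Basis" if "x \<in> F" for x using F(2)[of "fst x" "snd x"] that by simp
  from local_seminorms_small[OF F(1) F' e', of \<omega>0]
  obtain d where d: "0 < d" "\<forall>\<omega>. dist \<omega> \<omega>0 < d \<longrightarrow> (\<forall>x\<in>F. Schwartz_seminorm (fst x) (snd x) (\<lambda>z. K \<omega> z - K \<omega>0 z) \<le> e')"
    by blast
  have "norm (f (K \<omega>) - f (K \<omega>0)) \<le> e" if "dist \<omega> \<omega>0 < d" for \<omega>
  proof -
    have "norm (f (K \<omega>) - f (K \<omega>0)) = norm (f (\<lambda>z. K \<omega> z - K \<omega>0 z))"
      by (simp add: tempered_diff[OF f] Schwartz_K)
    also have "\<dots> \<le> C * (\<Sum>(N, bs)\<in>F. Schwartz_seminorm N bs (\<lambda>z. K \<omega> z - K \<omega>0 z))"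
      by (intro bound Schwartz_diff Schwartz_K)
    also have "\<dots> \<le> C * (\<Sum>(N, bs)\<in>F. e')"
      using d(2) that C by (intro mult_left_mono sum_mono) (simp_all add: split_beta)
    also have "\<dots> = C * card F * e'" by simp
    also have "\<dots> \<le> (C * card F + 1) * e'" using e' by simp
    also have "\<dots> = e"
    proof -
      have "C * card F + 1 > 0" using C by (simp add: add_nonneg_pos)
      then show ?thesis by (simp add: e'_def)
    qed
    finally show ?thesis .
  qed
  with d show ?thesis by blast
qed

lemma continuous_tempered_K:
  assumes f: "f \<in> tempered_distributions"
  shows "continuous_on UNIV (\<lambda>\<omega>. f (K \<omega>))"
  unfolding continuous_on_iff
proof (intro ballI allI impI)
  fix \<omega>0 and e :: real assume e: "0 < e"
  obtain d where d: "0 < d" "\<And>\<omega>. dist \<omega> \<omega>0 < d \<Longrightarrow> norm (f (K \<omega>) - f (K \<omega>0)) \<le> e / 2"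
    using local_tempered_small[OF f, of "e / 2"] e by (metis half_gt_zero)
  have "dist (f (K \<omega>)) (f (K \<omega>0)) < e" if "dist \<omega> \<omega>0 < d" for \<omega>
    using d(2)[OF that] e by (simp add: dist_norm)
  with d show "\<exists>d>0. \<forall>x'\<in>UNIV. dist x' \<omega>0 < d \<longrightarrow> dist (f (K x')) (f (K \<omega>0)) < e" by blast
qed

end


text \<open>Finite mass of balls allows the integral over a small set to be approximated by a
  multiple of one member of the family; the dominating functions of \<open>integrable_K\<close>
  permit differentiation under the integral and control what lies outside a large ball.\<close>

locale Schwartz_family_measure = Schwartz_family K
  for K :: "'w::euclidean_space \<Rightarrow> 'a::euclidean_space \<Rightarrow> complex" +
  fixes M :: "'w measure"
  assumes sets_M[measurable_cong]: "sets M = sets borel"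
    and finite_M: "\<And>k::nat. emeasure M (cball 0 (real k)) < \<infinity>"
    and integrable_K: "\<And>N bs. set bs \<subseteq> Basis \<Longrightarrow>
      \<exists>W. integrable M W \<and> (\<forall>\<omega> z. (1 + norm z) ^ N * norm (iter_partial bs (K \<omega>) z) \<le> W \<omega>)"
begin

text \<open>The restriction to \<open>A\<close> lets the parameter space be cut into pieces;
  \<open>T UNIV\<close> is the integral that is finally of interest.\<close>

definition T :: "'w set \<Rightarrow> 'a \<Rightarrow> complex" where
  "T A z = (LINT \<omega>|M. indicator A \<omega> *\<^sub>R K \<omega> z)"

lemma measurable_iter_K:
  assumes "set bs \<subseteq> Basis"
  shows "(\<lambda>\<omega>. iter_partial bs (K \<omega>) z) \<in> borel_measurable M"
proof -
  have "continuous_on UNIV (\<lambda>\<omega>. (\<lambda>(\<omega>, z). iter_partial bs (K \<omega>) z) (\<omega>, z))"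
    by (rule continuous_on_compose2[OF continuous_K[OF assms]]) (auto intro: continuous_on_Pair continuous_on_const continuous_on_id)
  then have "(\<lambda>\<omega>. iter_partial bs (K \<omega>) z) \<in> borel_measurable borel"
    by (simp add: borel_measurable_continuous_onI)
  then show ?thesis by measurable
qed

lemma integrable_iter_K:
  assumes bs: "set bs \<subseteq> Basis" and A: "A \<in> sets M"
  shows "integrable M (\<lambda>\<omega>. indicator A \<omega> *\<^sub>R iter_partial bs (K \<omega>) z)"
proof -
  obtain W where W: "integrable M W" "\<And>\<omega> z. (1 + norm z) ^ 0 * norm (iter_partial bs (K \<omega>) z) \<le> W \<omega>"
    using integrable_K[OF bs, of 0] by blast
  have W0: "0 \<le> W \<omega>" for \<omega> using order_trans[OF norm_ge_zero, of _ "W \<omega>"] W(2)[of z \<omega>] by simp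
  show ?thesis
  proof (rule Bochner_Integration.integrable_bound[OF W(1)])
    show "(\<lambda>\<omega>. indicator A \<omega> *\<^sub>R iter_partial bs (K \<omega>) z) \<in> borel_measurable M"
      using A measurable_iter_K[OF bs] by measurable
    show "AE \<omega> in M. norm (indicator A \<omega> *\<^sub>R iter_partial bs (K \<omega>) z) \<le> norm (W \<omega>)"
      using W W0 by (intro AE_I2) (auto simp: indicator_def)
  qed
qed

lemma has_derivative_T:
  assumes A: "A \<in> sets M" and bs: "set bs \<subseteq> Basis"
  shows "((\<lambda>z. LINT \<omega>|M. indicator A \<omega> *\<^sub>R iter_partial bs (K \<omega>) z) has_derivative
    (\<lambda>h. LINT \<omega>|M. indicator A \<omega> *\<^sub>R (\<Sum>b\<in>Basis. (h \<bullet> b) *\<^sub>R iter_partial (b # bs) (K \<omega>) z))) (at z)"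
proof -
  have "\<exists>W. integrable M W \<and> (\<forall>\<omega> z. norm (iter_partial (b # bs) (K \<omega>) z) \<le> W \<omega>)" if "b \<in> Basis" for b
    using integrable_K[of "b # bs" 0] bs that by simp
  then obtain W where W: "\<And>b. b \<in> Basis \<Longrightarrow> integrable M (W b)"
    "\<And>b \<omega> z. b \<in> Basis \<Longrightarrow> norm (iter_partial (b # bs) (K \<omega>) z) \<le> W b \<omega>"
    by metis
  have W0: "0 \<le> W b \<omega>" if "b \<in> Basis" for b \<omega> using order_trans[OF norm_ge_zero W(2)[OF that]] .
  show ?thesis
  proof (rule has_derivative_lebesgue_integral[where W="\<lambda>\<omega>. \<Sum>b\<in>Basis. W b \<omega>"])
    show "integrable M (\<lambda>\<omega>. indicator A \<omega> *\<^sub>R iter_partial bs (K \<omega>) z)" for z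
      by (rule integrable_iter_K[OF bs A])
    show "integrable M (\<lambda>\<omega>. \<Sum>b\<in>Basis. W b \<omega>)" using W by (intro Bochner_Integration.integrable_sum)
    show "0 \<le> (\<Sum>b\<in>Basis. W b \<omega>)" for \<omega> using W0 by (intro sum_nonneg)
    show "((\<lambda>z. indicator A \<omega> *\<^sub>R iter_partial bs (K \<omega>) z) has_derivative
      (\<lambda>h. indicator A \<omega> *\<^sub>R (\<Sum>b\<in>Basis. (h \<bullet> b) *\<^sub>R iter_partial (b # bs) (K \<omega>) z))) (at z)" for \<omega> z
      by (intro has_derivative_scaleR_right iter_partial_has_derivative smooth_K bs)
    have "integrable M (\<lambda>\<omega>. \<Sum>b\<in>Basis. (h \<bullet> b) *\<^sub>R (indicator A \<omega> *\<^sub>R iter_partial (b # bs) (K \<omega>) z))" for z h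
      using bs A by (intro Bochner_Integration.integrable_sum integrable_scaleR_right integrable_iter_K) auto
    then show "integrable M (\<lambda>\<omega>. indicator A \<omega> *\<^sub>R (\<Sum>b\<in>Basis. (h \<bullet> b) *\<^sub>R iter_partial (b # bs) (K \<omega>) z))" for z h
      by (simp add: scaleR_sum_right mult.commute)
    show "norm (indicator A \<omega> *\<^sub>R (\<Sum>b\<in>Basis. (h \<bullet> b) *\<^sub>R iter_partial (b # bs) (K \<omega>) z)) \<le> (\<Sum>b\<in>Basis. W b \<omega>) * norm h" for \<omega> z h
    proof -
      have "norm (indicator A \<omega> *\<^sub>R (\<Sum>b\<in>Basis. (h \<bullet> b) *\<^sub>R iter_partial (b # bs) (K \<omega>) z))
        \<le> norm (\<Sum>b\<in>Basis. (h \<bullet> b) *\<^sub>R iter_partial (b # bs) (K \<omega>) z)"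
        by (auto simp: indicator_def)
      also have "\<dots> \<le> (\<Sum>b\<in>Basis. norm ((h \<bullet> b) *\<^sub>R iter_partial (b # bs) (K \<omega>) z))" by (rule norm_sum)
      also have "\<dots> \<le> (\<Sum>b\<in>Basis. norm h * W b \<omega>)"
        using W(2) by (intro sum_mono) (auto intro!: mult_mono simp: Basis_le_norm)
      finally show ?thesis by (simp add: sum_distrib_left mult.commute)
    qed
  qed
qed

lemma iter_partial_T:
  assumes A: "A \<in> sets M" and bs: "set bs \<subseteq> Basis"
  shows "iter_partial bs (T A) = (\<lambda>z. LINT \<omega>|M. indicator A \<omega> *\<^sub>R iter_partial bs (K \<omega>) z)"
  using bs
proof (induction bs)
  case Nil
  then show ?case by (simp add: T_def fun_eq_iff)
next
  case (Cons b bs)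
  then have b: "b \<in> Basis" "set bs \<subseteq> Basis" by auto
  have "frechet_derivative (\<lambda>z. LINT \<omega>|M. indicator A \<omega> *\<^sub>R iter_partial bs (K \<omega>) z) (at z) b
    = (LINT \<omega>|M. indicator A \<omega> *\<^sub>R iter_partial (b # bs) (K \<omega>) z)" for z
  proof -
    have "(\<Sum>b'\<in>Basis. (b \<bullet> b') *\<^sub>R iter_partial (b' # bs) (K \<omega>) z) = iter_partial (b # bs) (K \<omega>) z" for \<omega>
    proof -
      have "(\<Sum>b'\<in>Basis. (b \<bullet> b') *\<^sub>R iter_partial (b' # bs) (K \<omega>) z)
        = (\<Sum>b'\<in>Basis. if b' = b then iter_partial (b' # bs) (K \<omega>) z else 0)"
        using b by (intro sum.cong) (auto simp: inner_Basis)
      then show ?thesis using b by simp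
    qed
    then show ?thesis unfolding frechet_derivative_at[OF has_derivative_T[OF A b(2)], symmetric] by simp
  qed
  then show ?case using Cons by simp
qed

lemma T_bound:
  assumes A: "A \<in> sets M" and bs: "set bs \<subseteq> Basis"
    and W: "integrable M W" "\<And>\<omega> z. \<omega> \<in> A \<Longrightarrow> (1 + norm z) ^ N * norm (iter_partial bs (K \<omega>) z) \<le> W \<omega>"
  shows "(1 + norm z) ^ N * norm (iter_partial bs (T A) z) \<le> (LINT \<omega>|M. indicator A \<omega> * W \<omega>)"
proof -
  have "(1 + norm z) ^ N * norm (iter_partial bs (T A) z)
     \<le> (1 + norm z) ^ N * (LINT \<omega>|M. norm (indicator A \<omega> *\<^sub>R iter_partial bs (K \<omega>) z))"
    unfolding iter_partial_T[OF A bs] by (intro mult_left_mono integral_norm_bound) auto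
  also have "\<dots> = (LINT \<omega>|M. (1 + norm z) ^ N * norm (indicator A \<omega> *\<^sub>R iter_partial bs (K \<omega>) z))" by simp
  also have "\<dots> \<le> (LINT \<omega>|M. indicator A \<omega> * W \<omega>)"
  proof (rule integral_mono)
    show "integrable M (\<lambda>\<omega>. (1 + norm z) ^ N * norm (indicator A \<omega> *\<^sub>R iter_partial bs (K \<omega>) z))"
      by (intro integrable_mult_right integrable_norm integrable_iter_K bs A)
    show "integrable M (\<lambda>\<omega>. indicator A \<omega> * W \<omega>)" using integrable_mult_indicator[OF A W(1)] by simp
  qed (use W in \<open>auto simp: indicator_def\<close>)
  finally show ?thesis .
qed

lemma Schwartz_T:
  assumes A: "A \<in> sets M"
  shows "T A \<in> Schwartz"
proof (rule SchwartzI)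
  show "smooth (T A)"
    unfolding smooth_def using iter_partial_T[OF A] has_derivative_T[OF A]
    by (auto simp: differentiable_def)
  fix N :: nat and bs :: "'a list" assume bs: "set bs \<subseteq> Basis"
  obtain W where "integrable M W" "\<And>\<omega> z. (1 + norm z) ^ N * norm (iter_partial bs (K \<omega>) z) \<le> W \<omega>"
    using integrable_K[OF bs, of N] by blast
  then show "\<exists>C. \<forall>x. (1 + norm x) ^ N * norm (iter_partial bs (T A) x) \<le> C"
    using T_bound[OF A bs] by blast
qed

lemma T_Int_Diff:
  assumes A: "A \<in> sets M" and B: "B \<in> sets M"
  shows "T A = (\<lambda>z. T (A \<inter> B) z + T (A - B) z)"
proof
  fix z
  have "T (A \<inter> B) z + T (A - B) z = (LINT \<omega>|M. indicator (A \<inter> B) \<omega> *\<^sub>R K \<omega> z + indicator (A - B) \<omega> *\<^sub>R K \<omega> z)"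
    unfolding T_def using A B integrable_iter_K[of "[]"] by (subst Bochner_Integration.integral_add) auto
  also have "\<dots> = T A z"
    unfolding T_def by (intro Bochner_Integration.integral_cong) (auto simp: indicator_def)
  finally show "T A z = T (A \<inter> B) z + T (A - B) z" ..
qed

context
  fixes f :: "('a \<Rightarrow> complex) \<Rightarrow> complex" assumes f: "f \<in> tempered_distributions"
begin

lemma measurable_f_K: "(\<lambda>\<omega>. f (K \<omega>)) \<in> borel_measurable M"
  using borel_measurable_continuous_onI[OF continuous_tempered_K[OF f]] by measurable

text \<open>
  On a small set \<open>K\<close> is almost constant in the finitely many seminorms that control \<open>f\<close>, so that
  \<open>T A\<close> is close to a multiple of a single \<open>K \<omega>0\<close>.
\<close>
lemma tempered_T_local:
  assumes e: "0 < e"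
  shows "\<exists>d>0. \<forall>A\<in>sets M. A \<subseteq> ball \<omega>0 d \<longrightarrow> emeasure M A < \<infinity> \<longrightarrow>
    ennreal (norm (f (T A))) \<le> (\<integral>\<^sup>+\<omega>\<in>A. (ennreal (norm (f (K \<omega>))) + ennreal e) \<partial>M)"
proof -
  obtain C F where C: "0 \<le> C" and F: "finite F" "\<And>N bs. (N, bs) \<in> F \<Longrightarrow> set bs \<subseteq> Basis"
    and bound: "\<And>g. g \<in> Schwartz \<Longrightarrow> norm (f g) \<le> C * (\<Sum>(N, bs)\<in>F. Schwartz_seminorm N bs g)"
    using tempered_bounded[OF f] by metis
  \<comment> \<open>One half of \<open>e\<close> is spent on replacing \<open>T A\<close> by a
    multiple of \<open>K \<omega>0\<close>, the other on returning from
    \<open>f (K \<omega>0)\<close> to \<open>f (K \<omega>)\<close>.\<close>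
  define e' where "e' = e / 2 / (C * card F + 1)"
  have CF: "C * card F + 1 > 0" using C by (simp add: add_nonneg_pos)
  have e': "0 < e'" "C * card F * e' \<le> e / 2"
  proof -
    show "0 < e'" using e CF by (simp add: e'_def)
    then have "C * card F * e' \<le> (C * card F + 1) * e'" by simp
    also have "\<dots> = e / 2" using less_imp_neq[OF CF] unfolding e'_def by (metis nonzero_mult_div_cancel_left times_divide_eq_right)
    finally show "C * card F * e' \<le> e / 2" .
  qed
  have F': "set (snd x) \<subseteq> Basis" if "x \<in> F" for x using F(2)[of "fst x" "snd x"] that by simp
  from local_seminorms_small[OF F(1) F' e'(1), of \<omega>0]
  obtain d1 where d1: "0 < d1" "\<And>\<omega> x. dist \<omega> \<omega>0 < d1 \<Longrightarrow> x \<in> F \<Longrightarrow> Schwartz_seminorm (fst x) (snd x) (\<lambda>z. K \<omega> z - K \<omega>0 z) \<le> e'"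
    by blast
  obtain d2 where d2: "0 < d2" "\<And>\<omega>. dist \<omega> \<omega>0 < d2 \<Longrightarrow> norm (f (K \<omega>) - f (K \<omega>0)) \<le> e / 2"
    using local_tempered_small[OF f, of "e / 2" \<omega>0] e by auto
  have "ennreal (norm (f (T A))) \<le> (\<integral>\<^sup>+\<omega>\<in>A. (ennreal (norm (f (K \<omega>))) + ennreal e) \<partial>M)"
    if A[measurable]: "A \<in> sets M" and sub: "A \<subseteq> ball \<omega>0 (min d1 d2)" and fin: "emeasure M A < \<infinity>" for A
  proof -
    define m where "m = measure M A"
    have m: "0 \<le> m" by (simp add: m_def)
    have mA: "emeasure M A = ennreal m" using fin by (simp add: m_def emeasure_eq_ennreal_measure)
    define g where "g = (\<lambda>z. T A z - of_real m * K \<omega>0 z)"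
    have gS: "g \<in> Schwartz" unfolding g_def by (intro Schwartz_diff Schwartz_T Schwartz_cmult(1) Schwartz_K A)
    have sem: "Schwartz_seminorm N bs g \<le> e' * m" if NF: "(N, bs) \<in> F" for N bs
    proof (rule Schwartz_seminorm_least)
      fix z
      have bs: "set bs \<subseteq> Basis" by (rule F(2)[OF NF])
      have int1: "integrable M (\<lambda>\<omega>. indicator A \<omega> *\<^sub>R c)" for c :: complex
        using fin by (intro integrable_indicator integrable_scaleR_left) auto
      have "iter_partial bs g z = iter_partial bs (T A) z - of_real m * iter_partial bs (K \<omega>0) z"
        unfolding g_def using A bs Schwartz_smooth[OF Schwartz_T[OF A]]
        by (simp add: iter_partial_diff smooth_K smooth_cmult iter_partial_cmult)
      also have "\<dots> = (LINT \<omega>|M. indicator A \<omega> *\<^sub>R iter_partial bs (K \<omega>) z) - (LINT \<omega>|M. indicator A \<omega> *\<^sub>R iter_partial bs (K \<omega>0) z)"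
        using fin by (simp add: iter_partial_T[OF A bs] m_def scaleR_conv_of_real)
      also have "\<dots> = (LINT \<omega>|M. indicator A \<omega> *\<^sub>R (iter_partial bs (K \<omega>) z - iter_partial bs (K \<omega>0) z))"
        unfolding scaleR_diff_right using integrable_iter_K[OF bs A] int1 by (intro Bochner_Integration.integral_diff[symmetric])
      finally have eq: "iter_partial bs g z = (LINT \<omega>|M. indicator A \<omega> *\<^sub>R (iter_partial bs (K \<omega>) z - iter_partial bs (K \<omega>0) z))" .
      have "(1 + norm z) ^ N * norm (iter_partial bs g z) \<le> (LINT \<omega>|M. (1 + norm z) ^ N * norm (indicator A \<omega> *\<^sub>R (iter_partial bs (K \<omega>) z - iter_partial bs (K \<omega>0) z)))"
        unfolding eq integral_mult_right_zero by (intro mult_left_mono integral_norm_bound) auto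
      also have "\<dots> \<le> (LINT \<omega>|M. indicator A \<omega> * e')"
      proof (rule integral_mono)
        show "integrable M (\<lambda>\<omega>. (1 + norm z) ^ N * norm (indicator A \<omega> *\<^sub>R (iter_partial bs (K \<omega>) z - iter_partial bs (K \<omega>0) z)))"
          unfolding scaleR_diff_right using integrable_iter_K[OF bs A] int1
          by (intro integrable_mult_right integrable_norm Bochner_Integration.integrable_diff)
        show "integrable M (\<lambda>\<omega>. indicator A \<omega> * e')" using fin by simp
        fix \<omega>
        have "(1 + norm z) ^ N * norm (iter_partial bs (K \<omega>) z - iter_partial bs (K \<omega>0) z) \<le> e'" if "\<omega> \<in> A"
        proof -
          have "(1 + norm z) ^ N * norm (iter_partial bs (\<lambda>z. K \<omega> z - K \<omega>0 z) z) \<le> Schwartz_seminorm N bs (\<lambda>z. K \<omega> z - K \<omega>0 z)"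
            by (intro Schwartz_seminorm_upper Schwartz_diff Schwartz_K bs)
          also have "\<dots> \<le> e'" using d1(2)[of \<omega> "(N, bs)"] NF sub that by (auto simp: dist_commute)
          finally show ?thesis by (simp add: iter_partial_diff smooth_K bs)
        qed
        then show "(1 + norm z) ^ N * norm (indicator A \<omega> *\<^sub>R (iter_partial bs (K \<omega>) z - iter_partial bs (K \<omega>0) z)) \<le> indicator A \<omega> * e'"
          by (auto simp: indicator_def)
      qed
      also have "\<dots> = e' * m" using fin by (simp add: m_def)
      finally show "(1 + norm z) ^ N * norm (iter_partial bs g z) \<le> e' * m" .
    qed
    have "norm (f g) \<le> C * (\<Sum>(N, bs)\<in>F. Schwartz_seminorm N bs g)" by (rule bound[OF gS])
    also have "\<dots> \<le> C * (\<Sum>(N, bs)\<in>F. e' * m)"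
      using sem C by (intro mult_left_mono sum_mono) auto
    also have "\<dots> = (C * card F * e') * m" by simp
    also have "\<dots> \<le> (e / 2) * m" using e' m by (intro mult_right_mono)
    finally have fg: "norm (f g) \<le> e / 2 * m" .
    have "f g = f (T A) - of_real m * f (K \<omega>0)"
      unfolding g_def using tempered_diff[OF f Schwartz_T[OF A] Schwartz_cmult(1)[OF Schwartz_K]] tempered_cmult[OF f Schwartz_K] by simp
    then have "f (T A) = f g + of_real m * f (K \<omega>0)" by simp
    then have "norm (f (T A)) \<le> norm (f g) + norm (of_real m * f (K \<omega>0))" by (metis norm_triangle_ineq)
    also have "\<dots> \<le> (norm (f (K \<omega>0)) + e / 2) * m" using fg m by (simp add: norm_mult algebra_simps)
    finally have "ennreal (norm (f (T A))) \<le> ennreal (norm (f (K \<omega>0)) + e / 2) * emeasure M A"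
      unfolding mA using m e by (subst ennreal_mult[symmetric]) (auto intro!: ennreal_leI simp del: ennreal_plus)
    also have "\<dots> = (\<integral>\<^sup>+\<omega>\<in>A. ennreal (norm (f (K \<omega>0)) + e / 2) \<partial>M)" by (simp add: nn_integral_cmult_indicator)
    also have "\<dots> \<le> (\<integral>\<^sup>+\<omega>\<in>A. (ennreal (norm (f (K \<omega>))) + ennreal e) \<partial>M)"
    proof (rule nn_integral_mono)
      fix \<omega>
      have "norm (f (K \<omega>0)) + e / 2 \<le> norm (f (K \<omega>)) + e" if "\<omega> \<in> A"
      proof -
        have "norm (f (K \<omega>) - f (K \<omega>0)) \<le> e / 2" using that sub by (intro d2) (auto simp: dist_commute)
        then show ?thesis using norm_triangle_ineq2[of "f (K \<omega>0)" "f (K \<omega>)"] by (simp add: norm_minus_commute)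
      qed
      then show "ennreal (norm (f (K \<omega>0)) + e / 2) * indicator A \<omega> \<le> (ennreal (norm (f (K \<omega>))) + ennreal e) * indicator A \<omega>"
        using e by (auto simp: indicator_def ennreal_leI simp flip: ennreal_plus)
    qed
    finally show ?thesis .
  qed
  then show ?thesis using d1(1) d2(1) by (intro exI[of _ "min d1 d2"]) auto
qed

text \<open>Finitely many of the small balls cover the compact ball. They are split off from
  \<open>A\<close> one at a time, so that the pieces are disjoint and the local estimates add up;
  hence the induction with \<open>A\<close> arbitrary.\<close>

lemma tempered_T_compact:
  assumes e: "0 < e" and A: "A \<in> sets M" "A \<subseteq> cball 0 (real k)"
  shows "ennreal (norm (f (T A))) \<le> (\<integral>\<^sup>+\<omega>\<in>A. (ennreal (norm (f (K \<omega>))) + ennreal e) \<partial>M)"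
proof -
  define d where "d \<omega>0 = (SOME d. d > 0 \<and> (\<forall>A\<in>sets M. A \<subseteq> ball \<omega>0 d \<longrightarrow> emeasure M A < \<infinity> \<longrightarrow>
    ennreal (norm (f (T A))) \<le> (\<integral>\<^sup>+\<omega>\<in>A. (ennreal (norm (f (K \<omega>))) + ennreal e) \<partial>M)))" for \<omega>0
  have d: "d \<omega>0 > 0 \<and> (\<forall>A\<in>sets M. A \<subseteq> ball \<omega>0 (d \<omega>0) \<longrightarrow> emeasure M A < \<infinity> \<longrightarrow>
    ennreal (norm (f (T A))) \<le> (\<integral>\<^sup>+\<omega>\<in>A. (ennreal (norm (f (K \<omega>))) + ennreal e) \<partial>M))" for \<omega>0
    unfolding d_def by (rule someI_ex[OF tempered_T_local[OF e]])
  have cp: "compact (cball 0 (real k) :: 'w set)" by simp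
  have cov: "cball 0 (real k) \<subseteq> (\<Union>\<omega>0\<in>UNIV. ball \<omega>0 (d \<omega>0))" using d centre_in_ball by blast
  obtain S where S: "finite S" "cball 0 (real k) \<subseteq> (\<Union>\<omega>0\<in>S. ball \<omega>0 (d \<omega>0))"
    by (rule compactE_image[OF cp _ cov]) auto
  have "ennreal (norm (f (T A))) \<le> (\<integral>\<^sup>+\<omega>\<in>A. (ennreal (norm (f (K \<omega>))) + ennreal e) \<partial>M)"
    if "A \<in> sets M" "A \<subseteq> (\<Union>\<omega>0\<in>S. ball \<omega>0 (d \<omega>0))" "A \<subseteq> cball 0 (real k)" for A
    using S(1) that
  proof (induction S arbitrary: A rule: finite_induct)
    case empty
    have "T {} = (\<lambda>_. 0)" by (simp add: T_def fun_eq_iff)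
    then show ?case using empty tempered_zero[OF f] by simp
  next
    case (insert \<omega>0 S)
    have B: "ball \<omega>0 (d \<omega>0) \<in> sets M" by simp
    define A1 where "A1 = A \<inter> ball \<omega>0 (d \<omega>0)"
    define A2 where "A2 = A - ball \<omega>0 (d \<omega>0)"
    have [measurable]: "A1 \<in> sets M" "A2 \<in> sets M" using insert.prems B by (auto simp: A1_def A2_def)
    note [measurable] = measurable_f_K
    have "emeasure M A1 \<le> emeasure M (cball 0 (real k))"
      using insert.prems by (intro emeasure_mono) (auto simp: A1_def)
    then have "emeasure M A1 < \<infinity>" using finite_M le_less_trans by blast
    then have 1: "ennreal (norm (f (T A1))) \<le> (\<integral>\<^sup>+\<omega>\<in>A1. (ennreal (norm (f (K \<omega>))) + ennreal e) \<partial>M)"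
      using conjunct2[OF d[of \<omega>0], rule_format, OF \<open>A1 \<in> sets M\<close>] by (simp add: A1_def)
    have 2: "ennreal (norm (f (T A2))) \<le> (\<integral>\<^sup>+\<omega>\<in>A2. (ennreal (norm (f (K \<omega>))) + ennreal e) \<partial>M)"
      using insert.prems by (intro insert.IH) (auto simp: A2_def)
    have "f (T A) = f (T A1) + f (T A2)"
      unfolding T_Int_Diff[OF insert.prems(1) B, folded A1_def A2_def]
      by (intro tempered_add[OF f] Schwartz_T) simp_all
    then have "ennreal (norm (f (T A))) \<le> ennreal (norm (f (T A1)) + norm (f (T A2)))"
      by (simp add: ennreal_leI norm_triangle_ineq del: ennreal_plus)
    also have "\<dots> = ennreal (norm (f (T A1))) + ennreal (norm (f (T A2)))" by simp
    also have "\<dots> \<le> (\<integral>\<^sup>+\<omega>\<in>A1. (ennreal (norm (f (K \<omega>))) + ennreal e) \<partial>M) + (\<integral>\<^sup>+\<omega>\<in>A2. (ennreal (norm (f (K \<omega>))) + ennreal e) \<partial>M)"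
      by (intro add_mono 1 2)
    also have "\<dots> = (\<integral>\<^sup>+\<omega>. (ennreal (norm (f (K \<omega>))) + ennreal e) * indicator A1 \<omega> + (ennreal (norm (f (K \<omega>))) + ennreal e) * indicator A2 \<omega> \<partial>M)"
      by (intro nn_integral_add[symmetric]) measurable
    also have "\<dots> = (\<integral>\<^sup>+\<omega>\<in>A. (ennreal (norm (f (K \<omega>))) + ennreal e) \<partial>M)"
      by (intro nn_integral_cong) (auto simp: indicator_def A1_def A2_def)
    finally show ?case .
  qed
  then show ?thesis using A S(2) by blast
qed

text \<open>The error of the local estimates is a constant density, which is small in total only on
  a set of finite measure. Therefore a large ball is split off, with \<open>e'\<close> scaled by its
  mass, and the rest is controlled by the seminorm bound for \<open>f\<close> and the tails of the
  dominating functions.\<close>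

lemma tempered_T_bound:
  "ennreal (norm (f (\<lambda>z. LINT \<omega>|M. K \<omega> z))) \<le> (\<integral>\<^sup>+\<omega>. ennreal (norm (f (K \<omega>))) \<partial>M)"
proof -
  note [measurable] = measurable_f_K
  have TU: "T UNIV = (\<lambda>z. LINT \<omega>|M. K \<omega> z)" by (simp add: T_def fun_eq_iff)
  have spM: "space M = UNIV" using sets_eq_imp_space_eq[OF sets_M] by simp
  obtain C F where C: "0 \<le> C" and F: "finite F" "\<And>N bs. (N, bs) \<in> F \<Longrightarrow> set bs \<subseteq> Basis"
    and bound: "\<And>g. g \<in> Schwartz \<Longrightarrow> norm (f g) \<le> C * (\<Sum>(N, bs)\<in>F. Schwartz_seminorm N bs g)"
    using tempered_bounded[OF f] by metis
  have "\<exists>W. integrable M W \<and> (\<forall>\<omega> z. (1 + norm z) ^ fst x * norm (iter_partial (snd x) (K \<omega>) z) \<le> W \<omega>)" if "x \<in> F" for x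
    using integrable_K[of "snd x" "fst x"] F(2)[of "fst x" "snd x"] that by simp
  then obtain W where W: "\<And>x. x \<in> F \<Longrightarrow> integrable M (W x)"
    "\<And>x \<omega> z. x \<in> F \<Longrightarrow> (1 + norm z) ^ fst x * norm (iter_partial (snd x) (K \<omega>) z) \<le> W x \<omega>"
    by metis
  define P where "P \<omega> = C * (\<Sum>x\<in>F. W x \<omega>)" for \<omega>
  have P: "integrable M P" unfolding P_def using W by (intro integrable_mult_right Bochner_Integration.integrable_sum)
  define r where "r k = (LINT \<omega>|M. indicator (- cball 0 (real k)) \<omega> * P \<omega>)" for k :: nat
  have tail: "norm (f (T (- cball 0 (real k)))) \<le> r k" for k :: nat
  proof -
    have A: "- cball 0 (real k) \<in> sets M" by simp
    have "norm (f (T (- cball 0 (real k)))) \<le> C * (\<Sum>(N, bs)\<in>F. Schwartz_seminorm N bs (T (- cball 0 (real k))))"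
      by (intro bound Schwartz_T A)
    also have "\<dots> \<le> C * (\<Sum>x\<in>F. (LINT \<omega>|M. indicator (- cball 0 (real k)) \<omega> * W x \<omega>))"
      unfolding split_beta using C W F(2)
      by (intro mult_left_mono sum_mono Schwartz_seminorm_least T_bound A) (simp_all, metis prod.collapse)
    also have "(\<Sum>x\<in>F. (LINT \<omega>|M. indicator (- cball 0 (real k)) \<omega> * W x \<omega>)) = (LINT \<omega>|M. (\<Sum>x\<in>F. indicator (- cball 0 (real k)) \<omega> * W x \<omega>))"
      using integrable_mult_indicator[OF A W(1)] by (intro Bochner_Integration.integral_sum[symmetric]) simp
    also have "C * \<dots> = r k" unfolding r_def P_def by (simp add: sum_distrib_left mult.left_commute flip: integral_mult_right_zero)
    finally show ?thesis .
  qed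
  have "r \<longlonglongrightarrow> (LINT \<omega>|M. 0)"
    unfolding r_def
  proof (rule integral_dominated_convergence[where w="\<lambda>\<omega>. norm (P \<omega>)"])
    show "AE \<omega> in M. (\<lambda>k. indicator (- cball 0 (real k)) \<omega> * P \<omega>) \<longlonglongrightarrow> 0"
    proof (rule AE_I2)
      fix \<omega> :: 'w
      obtain k0 :: nat where "norm \<omega> \<le> real k0" using real_arch_simple by blast
      then have "eventually (\<lambda>k. indicator (- cball 0 (real k)) \<omega> * P \<omega> = 0) sequentially"
        by (intro eventually_sequentiallyI[of k0]) (auto simp: indicator_def)
      then show "(\<lambda>k. indicator (- cball 0 (real k)) \<omega> * P \<omega>) \<longlonglongrightarrow> 0" by (rule tendsto_eventually)
    qed
  qed (use P in \<open>auto simp: indicator_def\<close>)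
  then have r0: "r \<longlonglongrightarrow> 0" by simp
  show ?thesis
  proof (rule ennreal_le_epsilon)
    fix e :: real assume e: "0 < e"
    obtain k where k: "r k < e / 2" using order_tendstoD(2)[OF r0, of "e / 2"] e by (auto simp: eventually_sequentially)
    define A where "A = cball (0::'w) (real k)"
    have A[measurable]: "A \<in> sets M" by (simp add: A_def)
    define e' where "e' = e / 2 / (measure M A + 1)"
    have mp: "0 < measure M A + 1" by (simp add: add_nonneg_pos)
    have e': "0 < e'" "e' * measure M A \<le> e / 2"
    proof -
      show "0 < e'" using e mp by (simp add: e'_def)
      then have "e' * measure M A \<le> e' * (measure M A + 1)" by simp
      also have "\<dots> = e / 2" using less_imp_neq[OF mp] unfolding e'_def by (metis nonzero_eq_divide_eq)
      finally show "e' * measure M A \<le> e / 2" .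
    qed
    have "T UNIV = (\<lambda>z. T A z + T (- A) z)" using T_Int_Diff[OF _ A, of UNIV] spM sets.top[of M] by (simp add: Compl_eq_Diff_UNIV)
    then have "f (T UNIV) = f (T A) + f (T (- A))"
      using tempered_add[OF f Schwartz_T Schwartz_T, of A "- A"] A by (simp add: A_def)
    then have "norm (f (T UNIV)) \<le> norm (f (T A)) + e / 2"
      using tail[of k] k norm_triangle_ineq[of "f (T A)" "f (T (- A))"] unfolding A_def by simp
    then have "ennreal (norm (f (T UNIV))) \<le> ennreal (norm (f (T A)) + e / 2)" by (rule ennreal_leI)
    also have "\<dots> = ennreal (norm (f (T A))) + ennreal (e / 2)" using e by simp
    also have "\<dots> \<le> (\<integral>\<^sup>+\<omega>\<in>A. (ennreal (norm (f (K \<omega>))) + ennreal e') \<partial>M) + ennreal (e / 2)"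
      by (intro add_right_mono tempered_T_compact[OF e'(1) A, of k]) (simp add: A_def)
    also have "(\<integral>\<^sup>+\<omega>\<in>A. (ennreal (norm (f (K \<omega>))) + ennreal e') \<partial>M)
       \<le> (\<integral>\<^sup>+\<omega>. ennreal (norm (f (K \<omega>))) + ennreal e' * indicator A \<omega> \<partial>M)"
      by (intro nn_integral_mono) (auto simp: indicator_def)
    also have "\<dots> = (\<integral>\<^sup>+\<omega>. ennreal (norm (f (K \<omega>))) \<partial>M) + ennreal e' * emeasure M A"
      by (subst nn_integral_add) (auto simp: nn_integral_cmult_indicator)
    also have "emeasure M A = ennreal (measure M A)"
      using finite_M[of k] by (simp add: A_def emeasure_eq_ennreal_measure)
    also have "ennreal e' * ennreal (measure M A) \<le> ennreal (e / 2)"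
      using e' by (simp add: ennreal_leI flip: ennreal_mult)
    also have "(\<integral>\<^sup>+\<omega>. ennreal (norm (f (K \<omega>))) \<partial>M) + ennreal (e / 2) + ennreal (e / 2)
       = (\<integral>\<^sup>+\<omega>. ennreal (norm (f (K \<omega>))) \<partial>M) + ennreal e"
      using e by (simp add: add.assoc flip: ennreal_plus)
    finally show "ennreal (norm (f (\<lambda>z. LINT \<omega>|M. K \<omega> z))) \<le> (\<integral>\<^sup>+\<omega>. ennreal (norm (f (K \<omega>))) \<partial>M) + ennreal e"
      unfolding TU by (simp add: add_mono)
  qed
qed

end

end

section \<open>Injectivity of the Fourier transform\<close>

lemma integral_lborel_affine:
  fixes f :: "'a::euclidean_space \<Rightarrow> complex"
  assumes [measurable]: "f \<in> borel_measurable borel" and c: "c \<noteq> 0"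
  shows "(LINT x|lborel. f x) = \<bar>c\<bar> ^ DIM('a) *\<^sub>R (LINT x|lborel. f (y + c *\<^sub>R x))"
  by (subst lborel_affine[OF c, of y]) (simp add: integral_density integral_distr)

lemma integral_swap:
  fixes f :: "_ \<Rightarrow> _ \<Rightarrow> complex"
  assumes "sigma_finite_measure M" "sigma_finite_measure N"
    and [measurable]: "(\<lambda>(x, y). f x y) \<in> borel_measurable (M \<Otimes>\<^sub>M N)"
    and fin: "(\<integral>\<^sup>+x. \<integral>\<^sup>+y. ennreal (norm (f x y)) \<partial>N \<partial>M) < \<infinity>"
  shows "(LINT x|M. LINT y|N. f x y) = (LINT y|N. LINT x|M. f x y)"
    and "integrable (M \<Otimes>\<^sub>M N) (\<lambda>(x, y). f x y)"
proof -
  interpret pair_sigma_finite M N using assms by (simp add: pair_sigma_finite_def)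
  show int: "integrable (M \<Otimes>\<^sub>M N) (\<lambda>(x, y). f x y)"
    using fin by (intro integrableI_bounded) (auto simp: M2.nn_integral_fst[symmetric])
  show "(LINT x|M. LINT y|N. f x y) = (LINT y|N. LINT x|M. f x y)"
    using Fubini_integral[OF int] by simp
qed

definition gaussian :: "'a::euclidean_space \<Rightarrow> real" where
  "gaussian u = exp (- (norm u)\<^sup>2 / 2)"

lemma gaussian_measurable[measurable]: "gaussian \<in> borel_measurable borel"
  unfolding gaussian_def by measurable

text \<open>Up to the factor \<open>sqrt (2 * pi)\<close> this is the characteristic function of the
  standard normal distribution.\<close>

lemma gaussian_Fourier_1D:
  fixes t :: real
  shows "integrable lborel (\<lambda>x. cis (x * t) * complex_of_real (exp (- x\<^sup>2 / 2)))"
    and "(LINT x|lborel. cis (x * t) * complex_of_real (exp (- x\<^sup>2 / 2))) = complex_of_real (sqrt (2 * pi) * exp (- t\<^sup>2 / 2))"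
proof -
  have eq: "cis (x * t) * complex_of_real (exp (- x\<^sup>2 / 2)) = complex_of_real (sqrt (2 * pi)) * (std_normal_density x *\<^sub>R iexp (t * x))" for x
    by (simp add: std_normal_density_def cis_conv_exp scaleR_conv_of_real mult_ac)
  have "integrable lborel std_normal_density" by (rule integrable_normal_density) simp
  then have i: "integrable lborel (\<lambda>x. std_normal_density x *\<^sub>R iexp (t * x))"
    by (rule Bochner_Integration.integrable_bound) auto
  then show "integrable lborel (\<lambda>x. cis (x * t) * complex_of_real (exp (- x\<^sup>2 / 2)))"
    unfolding eq by (rule integrable_mult_right)
  have "(LINT x|lborel. std_normal_density x *\<^sub>R iexp (t * x)) = char std_normal_distribution t"
    unfolding char_def by (subst integral_density) auto
  also have "\<dots> = complex_of_real (exp (- t\<^sup>2 / 2))" by (simp add: char_std_normal_distribution)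
  finally show "(LINT x|lborel. cis (x * t) * complex_of_real (exp (- x\<^sup>2 / 2))) = complex_of_real (sqrt (2 * pi) * exp (- t\<^sup>2 / 2))"
    unfolding eq integral_mult_right_zero by simp
qed

lemma gaussian_prod: "gaussian u = (\<Prod>b\<in>Basis. exp (- (u \<bullet> b)\<^sup>2 / 2))"
proof -
  have "(norm u)\<^sup>2 = (\<Sum>b\<in>Basis. (u \<bullet> b)\<^sup>2)"
    unfolding power2_norm_eq_inner euclidean_inner[of u u] by (simp add: power2_eq_square)
  then have "- (norm u)\<^sup>2 / 2 = (\<Sum>b\<in>Basis. - (u \<bullet> b)\<^sup>2 / 2)"
    by (simp add: sum_negf sum_divide_distrib)
  then show ?thesis unfolding gaussian_def by (simp add: exp_sum)
qed

lemma cis_sum: "finite A \<Longrightarrow> cis (\<Sum>a\<in>A. f a) = (\<Prod>a\<in>A. cis (f a))"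
  by (induction A rule: finite_induct) (auto simp: cis_mult[symmetric])

text \<open>The Gaussian and the character both factor over the coordinates, and
  \<open>lborel\<close> is the image of a product of one-dimensional Lebesgue measures; so the
  integral is a product of one-dimensional ones.\<close>

lemma gaussian_Fourier:
  fixes \<eta> :: "'a::euclidean_space"
  shows "integrable lborel (\<lambda>u. cis (u \<bullet> \<eta>) * complex_of_real (gaussian u))"
    and "(LINT u|lborel. cis (u \<bullet> \<eta>) * complex_of_real (gaussian u)) = complex_of_real (sqrt (2 * pi) ^ DIM('a) * gaussian \<eta>)"
proof -
  interpret product_sigma_finite "\<lambda>_::'a. lborel :: real measure" ..
  define S where "S = (\<lambda>f. \<Sum>b\<in>Basis. f b *\<^sub>R b :: 'a)"
  define P :: "('a \<Rightarrow> real) measure" where "P = (\<Pi>\<^sub>M b\<in>Basis. lborel)"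
  have lb: "(lborel :: 'a measure) = distr P borel S" unfolding P_def S_def by (rule lborel_eq)
  have [measurable]: "S \<in> P \<rightarrow>\<^sub>M borel" unfolding S_def P_def by measurable
  define g where "g b x = cis (x * (\<eta> \<bullet> b)) * complex_of_real (exp (- x\<^sup>2 / 2))" for b :: 'a and x
  have Sb: "S f \<bullet> b = f b" if "b \<in> Basis" for f b unfolding S_def using that by (rule inner_sum_left_Basis)
  have eq: "cis (S f \<bullet> \<eta>) * complex_of_real (gaussian (S f)) = (\<Prod>b\<in>Basis. g b (f b))" for f
    unfolding euclidean_inner[of "S f" \<eta>] gaussian_prod g_def prod.distrib
    by (simp add: cis_sum Sb cong: sum.cong prod.cong)
  have gi: "integrable lborel (g b)" for b unfolding g_def by (rule gaussian_Fourier_1D)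
  have [measurable]: "(\<lambda>u::'a. cis (u \<bullet> \<eta>)) \<in> borel_measurable borel"
    by (intro borel_measurable_continuous_onI continuous_intros)
  have "integrable P (\<lambda>f. \<Prod>b\<in>(Basis::'a set). g b (f b))"
    unfolding P_def by (intro product_integrable_prod gi) simp
  then show "integrable lborel (\<lambda>u. cis (u \<bullet> \<eta>) * complex_of_real (gaussian u))"
    unfolding lb by (subst integrable_distr_eq) (auto simp: eq)
  have "(LINT u|lborel. cis (u \<bullet> \<eta>) * complex_of_real (gaussian u)) = (LINT f|P. (\<Prod>b\<in>(Basis::'a set). g b (f b)))"
    unfolding lb by (subst integral_distr) (auto simp: eq)
  also have "\<dots> = (\<Prod>b\<in>(Basis::'a set). (LINT x|lborel. g b x))"
    unfolding P_def by (intro product_integral_prod gi) simp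
  also have "\<dots> = (\<Prod>b\<in>(Basis::'a set). complex_of_real (sqrt (2 * pi) * exp (- (\<eta> \<bullet> b)\<^sup>2 / 2)))"
    unfolding g_def gaussian_Fourier_1D ..
  also have "\<dots> = complex_of_real (sqrt (2 * pi) ^ DIM('a) * gaussian \<eta>)"
    by (simp only: of_real_prod[symmetric] prod.distrib prod_constant gaussian_prod)
  finally show "(LINT u|lborel. cis (u \<bullet> \<eta>) * complex_of_real (gaussian u)) = complex_of_real (sqrt (2 * pi) ^ DIM('a) * gaussian \<eta>)" .
qed

lemma continuous_cis_inner[continuous_intros]:
  assumes "continuous_on UNIV f" "continuous_on UNIV g"
  shows "continuous_on UNIV (\<lambda>x. cis (f x \<bullet> g x))"
  by (rule continuous_on_compose2[of UNIV cis]) (use assms in \<open>auto intro!: continuous_on_inner continuous_on_cis continuous_on_id\<close>)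

text \<open>
  By Fubini the averages of \<open>G\<close> against Gaussians centred at \<open>x\<close> vanish; shrinking the Gaussians
  gives a multiple of \<open>G x\<close> in the limit.
\<close>
lemma Fourier_injective:
  fixes G :: "'a::euclidean_space \<Rightarrow> complex"
  assumes cont: "continuous_on UNIV G" and int: "integrable lborel G" and bdd: "\<And>x. norm (G x) \<le> B"
    and zero: "\<And>\<xi>. Fourier G \<xi> = 0"
  shows "G x = 0"
proof -
  have [measurable]: "G \<in> borel_measurable borel" using cont by (rule borel_measurable_continuous_onI)
  define c where "c = complex_of_real (sqrt (2 * pi) ^ DIM('a))"
  have c: "c \<noteq> 0" by (simp add: c_def)
  have gint: "integrable lborel (\<lambda>u::'a. complex_of_real (gaussian u))"
    using gaussian_Fourier(1)[of 0] by simp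
  have gnn: "(\<integral>\<^sup>+u. ennreal (gaussian (u::'a)) \<partial>lborel) < \<infinity>"
    using gint unfolding integrable_iff_bounded by (simp add: gaussian_def)
  have Gnn: "(\<integral>\<^sup>+y. ennreal (norm (G y)) \<partial>lborel) < \<infinity>"
    using int unfolding integrable_iff_bounded by simp
  have avg: "(LINT v|lborel. G (x + \<sigma> *\<^sub>R v) * complex_of_real (gaussian v)) = 0" if \<sigma>: "0 < \<sigma>" for \<sigma>
  proof -
    have [measurable]: "(\<lambda>(y, u). cis (u \<bullet> ((x - y) /\<^sub>R \<sigma>))) \<in> borel_measurable (borel \<Otimes>\<^sub>M borel)"
      unfolding split_beta borel_prod
      by (intro borel_measurable_continuous_onI continuous_intros)
    \<comment> \<open>The Gaussian is written as its own Fourier transform, up to \<open>c\<close>;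
      after Fubini the inner integral over \<open>y\<close> is a multiple of a value of
      \<open>Fourier G\<close>, hence 0.\<close>
    have "c * (LINT y|lborel. G y * complex_of_real (gaussian ((x - y) /\<^sub>R \<sigma>)))
       = (LINT y|lborel. c * (G y * complex_of_real (gaussian ((x - y) /\<^sub>R \<sigma>))))"
      by simp
    also have "\<dots> = (LINT y|lborel. LINT u|lborel. G y * (cis (u \<bullet> ((x - y) /\<^sub>R \<sigma>)) * complex_of_real (gaussian u)))"
    proof (rule Bochner_Integration.integral_cong[OF refl])
      fix y
      show "c * (G y * complex_of_real (gaussian ((x - y) /\<^sub>R \<sigma>))) = (LINT u|lborel. G y * (cis (u \<bullet> ((x - y) /\<^sub>R \<sigma>)) * complex_of_real (gaussian u)))"
        unfolding integral_mult_right_zero gaussian_Fourier c_def by simp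
    qed
    also have "\<dots> = (LINT u|lborel. LINT y|lborel. G y * (cis (u \<bullet> ((x - y) /\<^sub>R \<sigma>)) * complex_of_real (gaussian u)))"
    proof (rule integral_swap)
      show "(\<lambda>(y, u). G y * (cis (u \<bullet> ((x - y) /\<^sub>R \<sigma>)) * complex_of_real (gaussian u))) \<in> borel_measurable (lborel \<Otimes>\<^sub>M lborel)"
        by measurable
      have "(\<integral>\<^sup>+y. \<integral>\<^sup>+u. ennreal (norm (G y * (cis (u \<bullet> ((x - y) /\<^sub>R \<sigma>)) * complex_of_real (gaussian u)))) \<partial>lborel \<partial>lborel)
        = (\<integral>\<^sup>+y. \<integral>\<^sup>+u. ennreal (norm (G y)) * ennreal (gaussian (u::'a)) \<partial>lborel \<partial>lborel)"
        by (simp add: norm_mult ennreal_mult gaussian_def)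
      also have "\<dots> = (\<integral>\<^sup>+y. ennreal (norm (G y)) \<partial>lborel) * (\<integral>\<^sup>+u. ennreal (gaussian (u::'a)) \<partial>lborel)"
        by (simp add: nn_integral_cmult nn_integral_multc)
      also have "\<dots> < \<infinity>" using gnn Gnn by (simp add: ennreal_mult_less_top)
      finally show "(\<integral>\<^sup>+y. \<integral>\<^sup>+u. ennreal (norm (G y * (cis (u \<bullet> ((x - y) /\<^sub>R \<sigma>)) * complex_of_real (gaussian u)))) \<partial>lborel \<partial>lborel) < \<infinity>" .
    qed (auto intro: sigma_finite_lborel)
    also have "\<dots> = (LINT u|lborel. (cis (u \<bullet> (x /\<^sub>R \<sigma>)) * complex_of_real (gaussian u)) * Fourier G (u /\<^sub>R \<sigma>))"
    proof (rule Bochner_Integration.integral_cong[OF refl])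
      fix u :: 'a
      have eq: "G y * (cis (u \<bullet> ((x - y) /\<^sub>R \<sigma>)) * complex_of_real (gaussian u))
        = (cis (u \<bullet> (x /\<^sub>R \<sigma>)) * complex_of_real (gaussian u)) * (cis (- (y \<bullet> (u /\<^sub>R \<sigma>))) * G y)" for y
      proof -
        have "u \<bullet> ((x - y) /\<^sub>R \<sigma>) = u \<bullet> (x /\<^sub>R \<sigma>) + - (y \<bullet> (u /\<^sub>R \<sigma>))"
          by (simp add: inner_diff_right algebra_simps inner_commute)
        then have "cis (u \<bullet> ((x - y) /\<^sub>R \<sigma>)) = cis (u \<bullet> (x /\<^sub>R \<sigma>)) * cis (- (y \<bullet> (u /\<^sub>R \<sigma>)))"
          by (simp only: cis_mult)
        then show ?thesis by (simp only: mult_ac)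
      qed
      show "(LINT y|lborel. G y * (cis (u \<bullet> ((x - y) /\<^sub>R \<sigma>)) * complex_of_real (gaussian u)))
         = (cis (u \<bullet> (x /\<^sub>R \<sigma>)) * complex_of_real (gaussian u)) * Fourier G (u /\<^sub>R \<sigma>)"
        unfolding eq Fourier_def integral_mult_right_zero ..
    qed
    also have "\<dots> = 0" by (simp add: zero)
    finally have "(LINT y|lborel. G y * complex_of_real (gaussian ((x - y) /\<^sub>R \<sigma>))) = 0" using c by simp
    then have "\<bar>\<sigma>\<bar> ^ DIM('a) *\<^sub>R (LINT v|lborel. G (x + \<sigma> *\<^sub>R v) * complex_of_real (gaussian ((x - (x + \<sigma> *\<^sub>R v)) /\<^sub>R \<sigma>))) = 0"
      using \<sigma> by (subst (asm) integral_lborel_affine[of _ \<sigma> x]) auto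
    then show ?thesis using \<sigma> by (simp add: gaussian_def)
  qed
  have "(\<lambda>k. LINT v|lborel. G (x + (1 / real (Suc k)) *\<^sub>R v) * complex_of_real (gaussian v))
     \<longlonglongrightarrow> (LINT v|lborel. G x * complex_of_real (gaussian (v::'a)))"
  proof (rule integral_dominated_convergence[where w="\<lambda>v::'a. B * gaussian v"])
    show "integrable lborel (\<lambda>v::'a. B * gaussian v)"
      using gint by (intro integrable_mult_right) (simp add: complex_of_real_integrable_eq)
    show "AE v in lborel. (\<lambda>k. G (x + (1 / real (Suc k)) *\<^sub>R v) * complex_of_real (gaussian v)) \<longlonglongrightarrow> G x * complex_of_real (gaussian v)"
    proof (rule AE_I2)
      fix v :: 'a
      have "(\<lambda>k. x + (1 / real (Suc k)) *\<^sub>R v) \<longlonglongrightarrow> x + 0 *\<^sub>R v"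
        by (intro tendsto_intros LIMSEQ_Suc[OF lim_1_over_n])
      then have "(\<lambda>k. G (x + (1 / real (Suc k)) *\<^sub>R v)) \<longlonglongrightarrow> G x"
        using cont by (intro continuous_on_tendsto_compose[where s=UNIV and f=G]) auto
      then show "(\<lambda>k. G (x + (1 / real (Suc k)) *\<^sub>R v) * complex_of_real (gaussian v)) \<longlonglongrightarrow> G x * complex_of_real (gaussian v)"
        by (intro tendsto_intros)
    qed
    show "AE v in lborel. norm (G (x + (1 / real (Suc k)) *\<^sub>R v) * complex_of_real (gaussian v)) \<le> B * gaussian v" for k
      using bdd by (intro AE_I2) (auto simp: norm_mult gaussian_def intro!: mult_mono order_trans[OF norm_ge_zero])
  qed auto
  moreover have "(LINT v|lborel. G (x + (1 / real (Suc k)) *\<^sub>R v) * complex_of_real (gaussian v)) = 0" for k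
    by (rule avg) simp
  ultimately have "(LINT v|lborel. G x * complex_of_real (gaussian (v::'a))) = 0"
    using LIMSEQ_unique[OF _ tendsto_const] by fastforce
  moreover have "(LINT v|lborel. complex_of_real (gaussian (v::'a))) = c"
    using gaussian_Fourier(2)[of "0::'a"] by (simp add: c_def gaussian_def)
  ultimately show ?thesis using c by auto
qed

section \<open>Decay, integrability and Fourier transforms of Schwartz functions\<close>

lemma Schwartz_continuous: "g \<in> Schwartz \<Longrightarrow> continuous_on UNIV g"
  using continuous_iter_partial[of g "[]"] by (simp add: Schwartz_smooth)

lemma Schwartz_measurable: "g \<in> Schwartz \<Longrightarrow> g \<in> borel_measurable borel"
  by (intro borel_measurable_continuous_onI Schwartz_continuous)

lemma Schwartz_decay:
  assumes g: "g \<in> Schwartz"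
  shows "\<exists>c. \<forall>x. norm (g x) \<le> c * (1 + norm x) powr (- m)"
proof -
  define N where "N = nat \<lceil>m\<rceil>"
  define c where "c = Schwartz_seminorm N [] g"
  have c: "(1 + norm x) ^ N * norm (g x) \<le> c" for x
    using Schwartz_seminorm_upper[OF g, of "[]" x N] by (simp add: c_def)
  have c0: "0 \<le> c" by (rule order_trans[OF _ c[of 0]]) simp
  have "norm (g x) \<le> c * (1 + norm x) powr (- m)" for x
  proof -
    have p: "0 < 1 + norm x" by (simp add: add_pos_nonneg)
    have "norm (g x) \<le> c * (1 + norm x) powr (- real N)"
      using c[of x] p by (simp add: powr_minus powr_realpow field_simps)
    also have "\<dots> \<le> c * (1 + norm x) powr (- m)"
      using c0 by (intro mult_left_mono powr_mono) (auto simp: N_def real_nat_ceiling_ge)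
    finally show ?thesis .
  qed
  then show ?thesis by blast
qed

lemma nn_integral_Schwartz_finite:
  fixes g :: "'a::euclidean_space \<Rightarrow> complex"
  assumes g: "g \<in> Schwartz"
  shows "(\<integral>\<^sup>+x. ennreal (norm (g x)) \<partial>lborel) < \<infinity>"
proof -
  obtain c where c: "\<And>x. norm (g x) \<le> c * (1 + norm x) powr (- (2 * real DIM('a)))"
    using Schwartz_decay[OF g] by blast
  have c0: "0 \<le> c" using order_trans[OF norm_ge_zero c[of 0]] by simp
  have "(\<integral>\<^sup>+x. ennreal (norm (g x)) \<partial>lborel) \<le> (\<integral>\<^sup>+x. ennreal c * ennreal ((1 + norm (x::'a)) powr (- (2 * real DIM('a)))) \<partial>lborel)"
    using c c0 by (intro nn_integral_mono) (simp add: ennreal_leI flip: ennreal_mult)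
  also have "\<dots> = ennreal c * (\<integral>\<^sup>+x. ennreal ((1 + norm (x::'a)) powr (- (2 * real DIM('a)))) \<partial>lborel)"
    by (intro nn_integral_cmult) measurable
  also have "\<dots> < \<infinity>" using nn_integral_one_plus_norm_finite[where 'a='a] by (simp add: ennreal_mult_less_top)
  finally show ?thesis .
qed

lemma Schwartz_integrable: "g \<in> Schwartz \<Longrightarrow> integrable lborel g"
  by (intro integrableI_bounded nn_integral_Schwartz_finite) (simp_all add: Schwartz_measurable)

lemma cis_inner_measurable[measurable]: "(\<lambda>x::'a::euclidean_space. cis (- (x \<bullet> \<xi>))) \<in> borel_measurable borel"
  using continuous_cis_inner[of "\<lambda>x. x" "\<lambda>_. - \<xi>"]
  by (intro borel_measurable_continuous_onI) (simp add: continuous_on_id continuous_on_const)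

lemma Fourier_reflect:
  fixes g :: "'a::euclidean_space \<Rightarrow> complex"
  assumes [measurable]: "g \<in> borel_measurable borel"
  shows "Fourier (\<lambda>z. g (x - z)) \<xi> = cis (- (x \<bullet> \<xi>)) * Fourier g (- \<xi>)"
proof -
  have "Fourier (\<lambda>z. g (x - z)) \<xi> = (LINT u|lborel. cis (- ((x + (-1) *\<^sub>R u) \<bullet> \<xi>)) * g (x - (x + (-1) *\<^sub>R u)))"
    unfolding Fourier_def by (subst integral_lborel_affine[of _ "-1" x]) auto
  also have "\<dots> = (LINT u|lborel. cis (- (x \<bullet> \<xi>)) * (cis (- (u \<bullet> (- \<xi>))) * g u))"
  proof (intro Bochner_Integration.integral_cong refl)
    fix u
    have "- ((x + (-1) *\<^sub>R u) \<bullet> \<xi>) = - (x \<bullet> \<xi>) + - (u \<bullet> (- \<xi>))" by (simp add: inner_diff_left)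
    then show "cis (- ((x + (-1) *\<^sub>R u) \<bullet> \<xi>)) * g (x - (x + (-1) *\<^sub>R u)) = cis (- (x \<bullet> \<xi>)) * (cis (- (u \<bullet> (- \<xi>))) * g u)"
      by (simp only: cis_mult[symmetric]) simp
  qed
  finally show ?thesis unfolding Fourier_def by simp
qed

lemma Fourier_dilate:
  fixes g :: "'a::euclidean_space \<Rightarrow> complex"
  assumes [measurable]: "g \<in> borel_measurable borel" and t: "0 < t"
  shows "Fourier (dilate t g) \<xi> = Fourier g (t *\<^sub>R \<xi>)"
proof -
  have "Fourier (dilate t g) \<xi> = \<bar>t\<bar> ^ DIM('a) *\<^sub>R (LINT u|lborel. cis (- ((0 + t *\<^sub>R u) \<bullet> \<xi>)) * (g ((0 + t *\<^sub>R u) /\<^sub>R t) / complex_of_real (t ^ DIM('a))))"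
    unfolding Fourier_def dilate_def using t by (intro integral_lborel_affine) auto
  also have "\<dots> = Fourier g (t *\<^sub>R \<xi>)"
  proof -
    have "cis (- ((0 + t *\<^sub>R u) \<bullet> \<xi>)) * (g ((0 + t *\<^sub>R u) /\<^sub>R t) / complex_of_real (t ^ DIM('a)))
      = complex_of_real (1 / t ^ DIM('a)) * (cis (- (u \<bullet> (t *\<^sub>R \<xi>))) * g u)" for u
      using t by simp
    then show ?thesis unfolding Fourier_def using t by (simp only: integral_mult_right_zero) (simp add: scaleR_conv_of_real)
  qed
  finally show ?thesis .
qed

section \<open>The reproducing formula\<close>

text \<open>The dependence on \<open>c\<close>, \<open>r\<close> and \<open>y\<close> is explicit
  because it is used twice: its continuity makes affine families a \<open>Schwartz_family\<close>,
  and its polynomial growth in \<open>y\<close> is what the decay of \<Theta> must beat in the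
  reproducing formula.\<close>

lemma Schwartz_affine_bound:
  assumes \<psi>: "\<psi> \<in> Schwartz" and bs: "set bs \<subseteq> Basis" and r: "r \<noteq> 0"
  shows "(1 + norm z) ^ N * norm (iter_partial bs (\<lambda>z. c * \<psi> (r *\<^sub>R z + y)) z)
    \<le> norm c * \<bar>r\<bar> ^ length bs * ((1 + norm y) * (1 + 1 / \<bar>r\<bar>)) ^ N * Schwartz_seminorm N bs \<psi>"
proof -
  let ?u = "r *\<^sub>R z + y"
  have z: "norm z \<le> (norm ?u + norm y) / \<bar>r\<bar>"
  proof -
    have "norm (r *\<^sub>R z) = norm (?u - y)" by simp
    also have "\<dots> \<le> norm ?u + norm y" by (rule norm_triangle_ineq4)
    finally show ?thesis using r by (simp add: field_simps)
  qed
  have "1 + norm z \<le> (1 + norm ?u) * ((1 + norm y) * (1 + 1 / \<bar>r\<bar>))"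
  proof -
    have "1 + norm z \<le> 1 + (norm ?u * (1 / \<bar>r\<bar>) + norm y * (1 / \<bar>r\<bar>))" using z by (simp add: add_divide_distrib)
    also have "\<dots> \<le> (1 + norm ?u) * ((1 + norm y) * (1 + 1 / \<bar>r\<bar>))"
    proof -
      have "1 + (A * C + B * C) \<le> (1 + A) * ((1 + B) * (1 + C))" if "0 \<le> A" "0 \<le> B" "0 \<le> C" for A B C :: real
      proof -
        have "0 \<le> A + B + C + A * B + A * B * C" using that by simp
        then show ?thesis by (simp add: algebra_simps)
      qed
      from this[of "norm ?u" "norm y" "1 / \<bar>r\<bar>"] show ?thesis by simp
    qed
    finally show ?thesis .
  qed
  then have "(1 + norm z) ^ N \<le> (1 + norm ?u) ^ N * ((1 + norm y) * (1 + 1 / \<bar>r\<bar>)) ^ N"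
    unfolding power_mult_distrib[symmetric] by (intro power_mono) auto
  then have "(1 + norm z) ^ N * norm (iter_partial bs (\<lambda>z. c * \<psi> (r *\<^sub>R z + y)) z)
    \<le> (1 + norm ?u) ^ N * ((1 + norm y) * (1 + 1 / \<bar>r\<bar>)) ^ N * (norm c * \<bar>r\<bar> ^ length bs * norm (iter_partial bs \<psi> ?u))"
    unfolding iter_partial_affine(1)[OF Schwartz_smooth[OF \<psi>] bs]
    by (intro mult_mono) (auto simp: norm_mult norm_power)
  also have "\<dots> = norm c * \<bar>r\<bar> ^ length bs * ((1 + norm y) * (1 + 1 / \<bar>r\<bar>)) ^ N * ((1 + norm ?u) ^ N * norm (iter_partial bs \<psi> ?u))"
    by (simp only: mult_ac)
  also have "\<dots> \<le> norm c * \<bar>r\<bar> ^ length bs * ((1 + norm y) * (1 + 1 / \<bar>r\<bar>)) ^ N * Schwartz_seminorm N bs \<psi>"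
    by (intro mult_left_mono Schwartz_seminorm_upper \<psi> bs) auto
  finally show ?thesis .
qed

lemma Schwartz_family_affine:
  fixes \<psi> :: "'a::euclidean_space \<Rightarrow> complex" and c :: "'w::euclidean_space \<Rightarrow> complex"
  assumes \<psi>: "\<psi> \<in> Schwartz" and cont: "continuous_on UNIV c" "continuous_on UNIV r" "continuous_on UNIV y"
    and r: "\<And>\<omega>. r \<omega> \<noteq> 0"
  shows "Schwartz_family (\<lambda>\<omega> z. c \<omega> * \<psi> (r \<omega> *\<^sub>R z + y \<omega>))"
proof
  show "smooth (\<lambda>z. c \<omega> * \<psi> (r \<omega> *\<^sub>R z + y \<omega>))" for \<omega>
    by (intro smooth_affine Schwartz_smooth \<psi>)
  fix bs :: "'a list" assume bs: "set bs \<subseteq> Basis"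
  have cfst: "continuous_on UNIV (\<lambda>x::'w \<times> 'a. g (fst x))" if "continuous_on UNIV g" for g :: "'w \<Rightarrow> 'c::topological_space"
    using that by (rule continuous_on_compose2) (auto intro: continuous_on_fst continuous_on_id)
  have "continuous_on UNIV (\<lambda>x::'w \<times> 'a. iter_partial bs \<psi> (r (fst x) *\<^sub>R snd x + y (fst x)))"
    by (rule continuous_on_compose2[OF continuous_iter_partial[OF Schwartz_smooth[OF \<psi>] bs]])
       (auto intro!: continuous_on_add continuous_on_scaleR cfst cont continuous_on_snd continuous_on_id)
  then show "continuous_on UNIV (\<lambda>(\<omega>, z). iter_partial bs (\<lambda>z. c \<omega> * \<psi> (r \<omega> *\<^sub>R z + y \<omega>)) z)"
    unfolding iter_partial_affine(1)[OF Schwartz_smooth[OF \<psi>] bs] split_beta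
    by (intro continuous_on_mult continuous_on_of_real continuous_on_power cfst cont)
  fix N :: nat
  have "continuous_on UNIV (\<lambda>\<omega>. norm (c \<omega>) * \<bar>r \<omega>\<bar> ^ length bs * ((1 + norm (y \<omega>)) * (1 + 1 / \<bar>r \<omega>\<bar>)) ^ N * Schwartz_seminorm N bs \<psi>)"
    using r by (intro continuous_on_mult continuous_on_power continuous_on_add continuous_on_norm continuous_on_divide continuous_on_rabs cont continuous_on_const) auto
  then show "\<exists>W. continuous_on UNIV W \<and> (\<forall>\<omega> z. (1 + norm z) ^ N * norm (iter_partial bs (\<lambda>z. c \<omega> * \<psi> (r \<omega> *\<^sub>R z + y \<omega>)) z) \<le> W \<omega>)"
    using Schwartz_affine_bound[OF \<psi> bs r] by blast
qed

lemma dilate_diff: "dilate t \<psi> (y - z) = complex_of_real (1 / t ^ DIM('a)) * \<psi> ((- 1 / t) *\<^sub>R z + (1 / t) *\<^sub>R (y::'a::euclidean_space))"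
  by (simp add: dilate_def scaleR_diff_right divide_inverse)

lemma dilate_1: "dilate 1 g = g"
  by (simp add: dilate_def fun_eq_iff)

text \<open>The function is treated as a family that is constant in a dummy real parameter, so that
  the bounds for affine families apply.\<close>

lemma Schwartz_dilate:
  assumes "g \<in> Schwartz" "t \<noteq> 0"
  shows "dilate t g \<in> Schwartz"
proof -
  interpret Schwartz_family "\<lambda>(\<omega>::real) z::'a. complex_of_real (1 / t ^ DIM('a)) * g ((1 / t) *\<^sub>R z + 0)"
    using assms by (intro Schwartz_family_affine continuous_on_const) auto
  show ?thesis using Schwartz_K by (simp add: dilate_def[abs_def] divide_inverse mult.commute)
qed

lemma Schwartz_reflect: "g \<in> Schwartz \<Longrightarrow> (\<lambda>z. g (x - z)) \<in> Schwartz"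
proof -
  assume "g \<in> Schwartz"
  then interpret Schwartz_family "\<lambda>(\<omega>::real) z. 1 * g ((-1) *\<^sub>R z + x)"
    by (intro Schwartz_family_affine continuous_on_const) auto
  show ?thesis using Schwartz_K by simp
qed

text \<open>With the scale written as an exponential the kernel depends continuously on all its real
  parameters, and \<open>f\<close> preserves this continuity; composing with the Borel function
  \<open>ln\<close> gives measurability in \<tau> on the whole line.\<close>

lemma conv_dist_measurable:
  fixes \<psi> :: "'a::euclidean_space \<Rightarrow> complex"
  assumes \<psi>: "\<psi> \<in> Schwartz" and f: "f \<in> tempered_distributions"
  shows "(\<lambda>(\<tau>, y). conv_dist (dilate (exp (ln \<tau>)) \<psi>) f y) \<in> borel_measurable (borel \<Otimes>\<^sub>M borel)"
proof -
  interpret Schwartz_family "\<lambda>(\<omega>::real \<times> 'a) z. complex_of_real (1 / exp (fst \<omega>) ^ DIM('a)) * \<psi> ((- 1 / exp (fst \<omega>)) *\<^sub>R z + (1 / exp (fst \<omega>)) *\<^sub>R snd \<omega>)"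
    by (intro Schwartz_family_affine \<psi> continuous_intros) auto
  have "continuous_on UNIV (\<lambda>\<omega>. conv_dist (dilate (exp (fst \<omega>)) \<psi>) f (snd \<omega>))"
    using continuous_tempered_K[OF f] unfolding conv_dist_def dilate_diff .
  then have [measurable]: "(\<lambda>\<omega>. conv_dist (dilate (exp (fst \<omega>)) \<psi>) f (snd \<omega>)) \<in> borel_measurable (borel \<Otimes>\<^sub>M borel)"
    unfolding borel_prod by (rule borel_measurable_continuous_onI)
  have "(\<lambda>\<omega>. (\<lambda>\<omega>. conv_dist (dilate (exp (fst \<omega>)) \<psi>) f (snd \<omega>)) (ln (fst \<omega>), snd \<omega>)) \<in> borel_measurable (borel \<Otimes>\<^sub>M borel)"
    by (rule measurable_compose[of "\<lambda>\<omega>. (ln (fst \<omega>), snd \<omega>)" _ "borel \<Otimes>\<^sub>M borel"]) measurable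
  then show ?thesis by (simp add: split_beta)
qed

text \<open>Peetre's inequality in the form
  \<open>1 + norm y \<le> (1 + norm x) * (1 + norm (x - y))\<close> converts decay in
  \<open>x - y\<close> into decay in \<open>y\<close>. The constant may depend on \<open>x\<close>,
  which stays fixed in the reproducing formula.\<close>

lemma tail_weight_bound:
  fixes \<Theta> :: "'a::euclidean_space \<Rightarrow> complex"
  assumes "\<Theta> \<in> Schwartz"
  shows "\<exists>C\<ge>0. \<forall>y. norm (\<Theta> (x - y)) * (1 + norm y) ^ N \<le> C * (1 + norm y) powr (- (2 * real DIM('a)))"
proof -
  define m where "m = real N + 2 * real DIM('a)"
  obtain c where c: "\<And>x. norm (\<Theta> x) \<le> c * (1 + norm x) powr (- m)" using Schwartz_decay[OF assms] by blast
  have c0: "0 \<le> c" using order_trans[OF norm_ge_zero c[of 0]] by simp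
  have "norm (\<Theta> (x - y)) * (1 + norm y) ^ N \<le> c * (1 + norm x) powr m * (1 + norm y) powr (- (2 * real DIM('a)))" for y
  proof -
    have pos: "0 < 1 + norm y" "0 < 1 + norm x" "0 < 1 + norm (x - y)" by (auto intro: add_pos_nonneg)
    have "norm y \<le> norm x + norm (x - y)" using norm_triangle_ineq4[of x "x - y"] by simp
    then have "1 + norm y \<le> (1 + norm x) * (1 + norm (x - y))" 
      using mult_nonneg_nonneg[OF norm_ge_zero norm_ge_zero, of x "x - y"] by (simp add: algebra_simps del: mult_nonneg_nonneg)
    then have "((1 + norm x) * (1 + norm (x - y))) powr (- m) \<le> (1 + norm y) powr (- m)"
      using pos by (intro powr_mono2') (auto simp: m_def)
    then have "(1 + norm x) powr m * ((1 + norm x) powr (- m) * (1 + norm (x - y)) powr (- m)) \<le> (1 + norm x) powr m * (1 + norm y) powr (- m)"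
      by (intro mult_left_mono) (auto simp: powr_mult)
    then have le: "(1 + norm (x - y)) powr (- m) \<le> (1 + norm x) powr m * (1 + norm y) powr (- m)"
      using pos by (simp add: mult.assoc[symmetric] powr_minus)
    have "norm (\<Theta> (x - y)) * (1 + norm y) ^ N \<le> (c * ((1 + norm x) powr m * (1 + norm y) powr (- m))) * (1 + norm y) powr real N"
      using pos c0 le by (intro mult_mono order_trans[OF c]) (auto simp: powr_realpow intro: mult_left_mono)
    also have "\<dots> = c * (1 + norm x) powr m * ((1 + norm y) powr (- m) * (1 + norm y) powr real N)" by (simp only: mult_ac)
    also have "(1 + norm y) powr (- m) * (1 + norm y) powr real N = (1 + norm y) powr (- (2 * real DIM('a)))"
      by (simp add: m_def flip: powr_add)
    finally show ?thesis .
  qed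
  then show ?thesis using c0 by (intro exI[of _ "c * (1 + norm x) powr m"]) auto
qed

lemma borel_measurable_Fourier:
  fixes g :: "'a::euclidean_space \<Rightarrow> complex"
  assumes [measurable]: "g \<in> borel_measurable borel"
  shows "Fourier g \<in> borel_measurable borel"
proof -
  have "continuous_on UNIV (\<lambda>v::'a \<times> 'a. cis (snd v \<bullet> (- fst v)))"
    by (intro continuous_cis_inner continuous_on_minus continuous_on_fst continuous_on_snd continuous_on_id)
  then have [measurable]: "(\<lambda>(\<xi>::'a, x). cis (- (x \<bullet> \<xi>))) \<in> borel_measurable (borel \<Otimes>\<^sub>M borel)"
    unfolding borel_prod split_beta by (intro borel_measurable_continuous_onI) simp
  show ?thesis unfolding Fourier_def by measurable
qed

text \<open>\<open>T\<close> is the function of \<open>z\<close> obtained by integrating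
  \<open>\<Theta> (x - y) * dilate \<tau> \<psi> (y - z)\<close> over \<open>y\<close> and \<tau>.
  Applying \<open>f\<close> to it formally gives the convolution of \<Theta> with
  \<open>dilate \<tau> \<psi>\<close> and \<open>f\<close>, averaged over \<tau>, at the point
  \<open>x\<close>. The reflection in \<open>z\<close> is the reason for \<open>- \<xi>\<close> in
  its Fourier transform.\<close>

lemma reproducing_kernel:
  fixes \<Theta> \<psi> :: "'a::euclidean_space \<Rightarrow> complex"
  assumes \<Theta>: "\<Theta> \<in> Schwartz" and \<psi>: "\<psi> \<in> Schwartz"
    and N: "finite_measure N" and sN[measurable_cong]: "sets N = sets (borel :: real measure)"
    and ab: "0 < a" "a \<le> b" and AEN: "AE \<tau> in N. a \<le> \<tau> \<and> \<tau> \<le> b"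
  obtains T where "T \<in> Schwartz"
    "\<And>\<xi>. Fourier T \<xi> = cis (- (x \<bullet> \<xi>)) * Fourier \<Theta> (- \<xi>) * (LINT \<tau>|N. Fourier \<psi> (\<tau> *\<^sub>R (- \<xi>)))"
    "\<And>f. f \<in> tempered_distributions \<Longrightarrow> ennreal (norm (f T)) \<le>
      (\<integral>\<^sup>+\<tau>. \<integral>\<^sup>+y. ennreal (norm (\<Theta> (x - y)) * norm (conv_dist (dilate (exp (ln \<tau>)) \<psi>) f y)) \<partial>lborel \<partial>N)"
proof -
  interpret N: finite_measure N by fact
  interpret P: pair_sigma_finite "lborel :: 'a measure" N ..
  have Nfin: "emeasure N (space N) < \<infinity>" using N.emeasure_finite[of "space N"] by (simp add: less_top[symmetric])
  \<comment> \<open>Clamping the scale makes the kernel below continuous in all its parameters.\<close>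
  define cl where "cl \<tau> = max a (min b \<tau>)" for \<tau>
  have cl: "a \<le> cl \<tau>" "cl \<tau> \<le> b" "0 < cl \<tau>" for \<tau> using ab by (auto simp: cl_def)
  have clid: "cl \<tau> = \<tau>" if "a \<le> \<tau> \<and> \<tau> \<le> b" for \<tau> using that by (simp add: cl_def)
  have clc: "continuous_on UNIV cl" unfolding cl_def by (intro continuous_intros)
  have [measurable]: "cl \<in> borel_measurable borel" unfolding cl_def by measurable
  have [measurable]: "\<Theta> \<in> borel_measurable borel" "\<psi> \<in> borel_measurable borel" using \<Theta> \<psi> by (auto intro: Schwartz_measurable)
  define K where "K = (\<lambda>(\<omega>::'a \<times> real) z. \<Theta> (x - fst \<omega>) * complex_of_real (1 / cl (snd \<omega>) ^ DIM('a)) *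
      \<psi> ((- 1 / cl (snd \<omega>)) *\<^sub>R z + (1 / cl (snd \<omega>)) *\<^sub>R fst \<omega>))"
  have Keq: "K \<omega> z = \<Theta> (x - fst \<omega>) * dilate (cl (snd \<omega>)) \<psi> (fst \<omega> - z)" for \<omega> z
    unfolding K_def dilate_diff by simp
  define M where "M = (lborel :: 'a measure) \<Otimes>\<^sub>M N"
  have sM[measurable_cong]: "sets M = sets borel"
  proof -
    have "sets M = sets ((borel :: 'a measure) \<Otimes>\<^sub>M (borel :: real measure))"
      unfolding M_def by (intro sets_pair_measure_cong) (simp_all add: sN)
    then show ?thesis unfolding borel_prod .
  qed
  have clc2: "continuous_on UNIV (\<lambda>\<omega>::'a \<times> real. cl (snd \<omega>))"
    by (rule continuous_on_compose2[OF clc]) (auto intro: continuous_on_snd continuous_on_id)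
  have nz: "cl \<tau> \<noteq> 0" for \<tau> using cl(3)[of \<tau>] by simp
  have fam: "Schwartz_family K"
    unfolding K_def
  proof (rule Schwartz_family_affine[OF \<psi>])
    have "continuous_on UNIV (\<lambda>\<omega>::'a \<times> real. \<Theta> (x - fst \<omega>))"
      by (rule continuous_on_compose2[OF Schwartz_continuous[OF \<Theta>]]) (auto intro!: continuous_intros)
    then show "continuous_on UNIV (\<lambda>\<omega>::'a \<times> real. \<Theta> (x - fst \<omega>) * complex_of_real (1 / cl (snd \<omega>) ^ DIM('a)))"
      using nz by (intro continuous_on_mult continuous_on_of_real continuous_on_divide continuous_on_power clc2 continuous_on_const) auto
    show "continuous_on UNIV (\<lambda>\<omega>::'a \<times> real. - 1 / cl (snd \<omega>))"
      using nz by (intro continuous_on_divide clc2 continuous_on_const) auto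
    show "continuous_on UNIV (\<lambda>\<omega>::'a \<times> real. (1 / cl (snd \<omega>)) *\<^sub>R fst \<omega>)"
      using nz by (intro continuous_on_scaleR continuous_on_divide clc2 continuous_on_const continuous_on_fst continuous_on_id) auto
  qed (use nz in auto)
  have weight_fin: "(\<integral>\<^sup>+y. ennreal ((1 + norm (y::'a)) powr (- (2 * real DIM('a)))) \<partial>lborel) < \<infinity>"
    using nn_integral_one_plus_norm_finite[where 'a='a] by simp
  interpret Schwartz_family_measure K M
  proof (intro Schwartz_family_measure.intro fam Schwartz_family_measure_axioms.intro)
    show "sets M = sets borel" by (rule sM)
    fix k :: nat
    have "emeasure M (cball 0 (real k)) \<le> emeasure M (cball (0::'a) (real k) \<times> space N)"
    proof (rule emeasure_mono)
      show "cball 0 (real k) \<subseteq> cball (0::'a) (real k) \<times> space N"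
        using sets_eq_imp_space_eq[OF sN] by (auto simp: norm_Pair intro: order_trans[OF real_sqrt_sum_squares_ge1])
      show "cball (0::'a) (real k) \<times> space N \<in> sets M" unfolding M_def by (intro pair_measureI) auto
    qed
    also have "\<dots> = emeasure lborel (cball (0::'a) (real k)) * emeasure N (space N)"
      unfolding M_def by (intro N.emeasure_pair_measure_Times) auto
    also have "\<dots> < \<infinity>" using emeasure_lborel_cball_finite[of "0::'a" "real k"] Nfin
      by (simp add: ennreal_mult_less_top)
    finally show "emeasure M (cball 0 (real k)) < \<infinity>" .
  next
    fix n :: nat and bs :: "'a list" assume bs: "set bs \<subseteq> Basis"
    obtain C where C: "0 \<le> C" "\<And>y. norm (\<Theta> (x - y)) * (1 + norm y) ^ n \<le> C * (1 + norm y) powr (- (2 * real DIM('a)))"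
      using tail_weight_bound[OF \<Theta>] by blast
    \<comment> \<open>This collects the constants of \<open>Schwartz_affine_bound\<close> for
      clamped scales, whose dilation factors lie between \<open>1 / b\<close> and
      \<open>1 / a\<close>.\<close>
    define D where "D = (1 / a) ^ DIM('a) * (1 / a) ^ length bs * ((1 + 1 / a) * (1 + b)) ^ n * Schwartz_seminorm n bs \<psi>"
    have S0: "0 \<le> Schwartz_seminorm n bs \<psi>" by (rule Schwartz_seminorm_nonneg[OF \<psi> bs])
    have D0: "0 \<le> D" using ab S0 by (simp add: D_def)
    define W where "W \<omega> = D * C * (1 + norm (fst \<omega>)) powr (- (2 * real DIM('a)))" for \<omega> :: "'a \<times> real"
    have "integrable M W"
    proof (rule integrableI_bounded)
      show "W \<in> borel_measurable M" unfolding W_def M_def by measurable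
      have "(\<integral>\<^sup>+\<omega>. ennreal (norm (W \<omega>)) \<partial>M) = (\<integral>\<^sup>+y. \<integral>\<^sup>+\<tau>. ennreal (norm (W (y, \<tau>))) \<partial>N \<partial>lborel)"
        unfolding M_def W_def by (subst N.nn_integral_fst[symmetric]) measurable
      also have "\<dots> = (\<integral>\<^sup>+y. (ennreal (D * C) * emeasure N (space N)) * ennreal ((1 + norm (y::'a)) powr (- (2 * real DIM('a)))) \<partial>lborel)"
        using D0 C by (intro nn_integral_cong) (simp add: W_def ennreal_mult mult_ac)
      also have "\<dots> = (ennreal (D * C) * emeasure N (space N)) * (\<integral>\<^sup>+y. ennreal ((1 + norm (y::'a)) powr (- (2 * real DIM('a)))) \<partial>lborel)"
        by (intro nn_integral_cmult) measurable
      also have "\<dots> < \<infinity>" using weight_fin Nfin by (simp add: ennreal_mult_less_top)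
      finally show "(\<integral>\<^sup>+\<omega>. ennreal (norm (W \<omega>)) \<partial>M) < \<infinity>" .
    qed
    moreover have "(1 + norm z) ^ n * norm (iter_partial bs (K \<omega>) z) \<le> W \<omega>" for \<omega> z
    proof -
      define y \<tau> where "y = fst \<omega>" and "\<tau> = snd \<omega>"
      let ?c = "cl \<tau>"
      have "(1 + norm z) ^ n * norm (iter_partial bs (K \<omega>) z)
        \<le> norm (\<Theta> (x - y) * complex_of_real (1 / ?c ^ DIM('a))) * \<bar>- 1 / ?c\<bar> ^ length bs *
          ((1 + norm ((1 / ?c) *\<^sub>R y)) * (1 + 1 / \<bar>- 1 / ?c\<bar>)) ^ n * Schwartz_seminorm n bs \<psi>"
        unfolding K_def y_def \<tau>_def using nz by (intro Schwartz_affine_bound[OF \<psi> bs]) auto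
      also have "\<dots> \<le> (norm (\<Theta> (x - y)) * (1 / a) ^ DIM('a)) * (1 / a) ^ length bs *
          (((1 + 1 / a) * (1 + norm y)) * (1 + b)) ^ n * Schwartz_seminorm n bs \<psi>"
      proof (intro mult_mono power_mono mult_nonneg_nonneg)
        have ic: "1 / ?c \<le> 1 / a" using cl[of \<tau>] ab by (intro divide_left_mono) auto
        have "(1 / ?c) ^ DIM('a) \<le> (1 / a) ^ DIM('a)" using ic cl(3)[of \<tau>] by (intro power_mono) auto
        then show "norm (\<Theta> (x - y) * complex_of_real (1 / ?c ^ DIM('a))) \<le> norm (\<Theta> (x - y)) * (1 / a) ^ DIM('a)"
          using cl(3)[of \<tau>] unfolding norm_mult norm_of_real by (intro mult_left_mono) (auto simp: power_divide)
        show "\<bar>- 1 / ?c\<bar> \<le> 1 / a" using ic cl(3)[of \<tau>] by simp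
        show "1 + 1 / \<bar>- 1 / ?c\<bar> \<le> 1 + b" using cl[of \<tau>] by simp
        have "norm ((1 / ?c) *\<^sub>R y) \<le> (1 / a) * norm y" using mult_right_mono[OF ic norm_ge_zero[of y]] cl(3)[of \<tau>] by simp
        moreover have "(1 / a) * norm y + 1 \<le> (1 + 1 / a) * (1 + norm y)" using ab by (simp add: algebra_simps)
        ultimately show "1 + norm ((1 / ?c) *\<^sub>R y) \<le> (1 + 1 / a) * (1 + norm y)" by linarith
      qed (use ab S0 cl(3)[of \<tau>] in \<open>auto intro!: add_nonneg_nonneg divide_nonneg_nonneg\<close>)
      also have "\<dots> = D * (norm (\<Theta> (x - y)) * (1 + norm y) ^ n)"
        unfolding D_def power_mult_distrib by (simp only: mult_ac)
      also have "\<dots> \<le> D * (C * (1 + norm y) powr (- (2 * real DIM('a))))" by (intro mult_left_mono C D0)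
      also have "\<dots> = W \<omega>" by (simp add: W_def y_def)
      finally show ?thesis .
    qed
    ultimately show "\<exists>W. integrable M W \<and> (\<forall>\<omega> z. (1 + norm z) ^ n * norm (iter_partial bs (K \<omega>) z) \<le> W \<omega>)" by blast
  qed
  define T0 where "T0 = (\<lambda>z. LINT \<omega>|M. K \<omega> z)"
  have TU: "T UNIV = T0" by (simp add: T_def T0_def fun_eq_iff)
  show thesis
  proof (rule that[of T0])
    show "T0 \<in> Schwartz"
      unfolding TU[symmetric] using sets_eq_imp_space_eq[OF sM] sets.top[of M] by (intro Schwartz_T) simp
  next
    fix f :: "('a \<Rightarrow> complex) \<Rightarrow> complex" assume f: "f \<in> tempered_distributions"
    have fK: "f (K (y, \<tau>)) = \<Theta> (x - y) * conv_dist (dilate (cl \<tau>) \<psi>) f y" for y \<tau>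
    proof -
      have "K (y, \<tau>) = (\<lambda>z. \<Theta> (x - y) * (\<lambda>z. dilate (cl \<tau>) \<psi> (y - z)) z)" unfolding Keq[abs_def] by (simp add: Keq fun_eq_iff)
      then show ?thesis
        unfolding conv_dist_def using tempered_cmult[OF f Schwartz_reflect[OF Schwartz_dilate[OF \<psi> nz[of \<tau>]], of y]] by simp
    qed
    have [measurable]: "(\<lambda>\<omega>. f (K \<omega>)) \<in> borel_measurable (lborel \<Otimes>\<^sub>M N)"
      using measurable_f_K[OF f] unfolding M_def .
    have "ennreal (norm (f T0)) \<le> (\<integral>\<^sup>+\<omega>. ennreal (norm (f (K \<omega>))) \<partial>M)"
      unfolding T0_def by (rule tempered_T_bound[OF f])
    also have "\<dots> = (\<integral>\<^sup>+\<tau>. \<integral>\<^sup>+y. ennreal (norm (f (K (y, \<tau>)))) \<partial>lborel \<partial>N)"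
      unfolding M_def by (intro P.nn_integral_snd[symmetric]) measurable
    \<comment> \<open>For almost every \<tau> the clamped scale and \<open>exp (ln \<tau>)\<close>
      both equal \<tau>.\<close>
    also have "\<dots> = (\<integral>\<^sup>+\<tau>. \<integral>\<^sup>+y. ennreal (norm (\<Theta> (x - y)) * norm (conv_dist (dilate (exp (ln \<tau>)) \<psi>) f y)) \<partial>lborel \<partial>N)"
      by (intro nn_integral_cong_AE eventually_mono[OF AEN]) (use ab in \<open>simp add: fK norm_mult clid\<close>)
    finally show "ennreal (norm (f T0)) \<le> (\<integral>\<^sup>+\<tau>. \<integral>\<^sup>+y. ennreal (norm (\<Theta> (x - y)) * norm (conv_dist (dilate (exp (ln \<tau>)) \<psi>) f y)) \<partial>lborel \<partial>N)" .
  next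
    fix \<xi> :: 'a
    have [measurable]: "Fourier \<psi> \<in> borel_measurable borel" by (rule borel_measurable_Fourier) measurable
    define J where "J = (LINT u|lborel. norm (\<psi> u))"
    have J: "norm (Fourier \<psi> \<eta>) \<le> J" for \<eta>
      unfolding Fourier_def J_def by (rule order_trans[OF integral_norm_bound]) (simp add: norm_mult)
    have \<Theta>fin: "(\<integral>\<^sup>+y. ennreal (norm (\<Theta> (x - y))) \<partial>lborel) < \<infinity>"
      by (rule nn_integral_Schwartz_finite[OF Schwartz_reflect[OF \<Theta>]])
    have nnz: "(\<integral>\<^sup>+z. ennreal (norm (dilate (cl \<tau>) \<psi> (y - z))) \<partial>lborel) = (\<integral>\<^sup>+u. ennreal (norm (\<psi> u)) \<partial>lborel)" for \<tau> y
    proof -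
      let ?c = "cl \<tau>"
      have "(\<integral>\<^sup>+z. ennreal (norm (dilate ?c \<psi> (y - z))) \<partial>lborel)
        = ennreal (\<bar>- ?c\<bar> ^ DIM('a)) * (\<integral>\<^sup>+u. ennreal (norm (dilate ?c \<psi> (y - (y + (- ?c) *\<^sub>R u)))) \<partial>lborel)"
        unfolding dilate_def using nz by (intro nn_integral_lborel_affine) auto
      also have "\<dots> = (\<integral>\<^sup>+u. ennreal (\<bar>- ?c\<bar> ^ DIM('a)) * ennreal (norm (dilate ?c \<psi> (y - (y + (- ?c) *\<^sub>R u)))) \<partial>lborel)"
        unfolding dilate_def by (intro nn_integral_cmult[symmetric]) measurable
      also have "\<dots> = (\<integral>\<^sup>+u. ennreal (norm (\<psi> u)) \<partial>lborel)"
        using cl(3)[of \<tau>] by (intro nn_integral_cong) (simp add: dilate_def norm_divide norm_power flip: ennreal_mult)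
      finally show ?thesis .
    qed
    have meas: "(\<lambda>(\<omega>, z). cis (- (z \<bullet> \<xi>)) * K \<omega> z) \<in> borel_measurable ((lborel \<Otimes>\<^sub>M N) \<Otimes>\<^sub>M lborel)"
      unfolding Keq dilate_def by measurable
    have fin: "(\<integral>\<^sup>+\<omega>. \<integral>\<^sup>+z. ennreal (norm (cis (- (z \<bullet> \<xi>)) * K \<omega> z)) \<partial>lborel \<partial>M) < \<infinity>"
    proof -
      have "(\<integral>\<^sup>+z. ennreal (norm (cis (- (z \<bullet> \<xi>)) * K \<omega> z)) \<partial>lborel) = ennreal (norm (\<Theta> (x - fst \<omega>))) * (\<integral>\<^sup>+u. ennreal (norm (\<psi> u)) \<partial>lborel)" for \<omega>
        unfolding nnz[of "snd \<omega>" "fst \<omega>", symmetric] Keq norm_mult norm_cis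
        by (subst nn_integral_cmult[symmetric]) (simp_all add: ennreal_mult dilate_def)
      then have "(\<integral>\<^sup>+\<omega>. \<integral>\<^sup>+z. ennreal (norm (cis (- (z \<bullet> \<xi>)) * K \<omega> z)) \<partial>lborel \<partial>M)
        = (\<integral>\<^sup>+\<omega>. ennreal (norm (\<Theta> (x - fst \<omega>))) * (\<integral>\<^sup>+u. ennreal (norm (\<psi> u)) \<partial>lborel) \<partial>(lborel \<Otimes>\<^sub>M N))"
        unfolding M_def by simp
      also have "\<dots> = (\<integral>\<^sup>+y. \<integral>\<^sup>+\<tau>. ennreal (norm (\<Theta> (x - y))) * (\<integral>\<^sup>+u. ennreal (norm (\<psi> u)) \<partial>lborel) \<partial>N \<partial>lborel)"
        by (subst N.nn_integral_fst[symmetric]) simp_all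
      also have "\<dots> = (\<integral>\<^sup>+y. ennreal (norm (\<Theta> (x - y))) \<partial>lborel) * ((\<integral>\<^sup>+u. ennreal (norm (\<psi> u)) \<partial>lborel) * emeasure N (space N))"
        by (simp add: mult.assoc nn_integral_multc)
      also have "\<dots> < \<infinity>"
        using \<Theta>fin nn_integral_Schwartz_finite[OF \<psi>] Nfin by (simp add: ennreal_mult_less_top)
      finally show ?thesis .
    qed
    have sigM: "sigma_finite_measure M" unfolding M_def by (rule P.sigma_finite_measure_axioms)
    have "Fourier T0 \<xi> = (LINT z|lborel. LINT \<omega>|M. cis (- (z \<bullet> \<xi>)) * K \<omega> z)"
      unfolding Fourier_def T0_def integral_mult_right_zero ..
    also have "\<dots> = (LINT \<omega>|M. LINT z|lborel. cis (- (z \<bullet> \<xi>)) * K \<omega> z)"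
      by (rule integral_swap(1)[OF sigM sigma_finite_lborel _ fin, symmetric]) (use meas in \<open>simp add: M_def\<close>)
    also have "\<dots> = (LINT \<omega>|M. (cis (- (fst \<omega> \<bullet> \<xi>)) * \<Theta> (x - fst \<omega>)) * Fourier \<psi> (cl (snd \<omega>) *\<^sub>R (- \<xi>)))"
    proof (rule Bochner_Integration.integral_cong[OF refl])
      fix \<omega>
      have "(LINT z|lborel. cis (- (z \<bullet> \<xi>)) * K \<omega> z) = \<Theta> (x - fst \<omega>) * Fourier (\<lambda>z. dilate (cl (snd \<omega>)) \<psi> (fst \<omega> - z)) \<xi>"
        unfolding Fourier_def integral_mult_right_zero[symmetric] Keq by (simp only: mult_ac)
      also have "\<dots> = \<Theta> (x - fst \<omega>) * (cis (- (fst \<omega> \<bullet> \<xi>)) * Fourier (dilate (cl (snd \<omega>)) \<psi>) (- \<xi>))"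
        using Fourier_reflect[OF Schwartz_measurable[OF Schwartz_dilate[OF \<psi> nz[of "snd \<omega>"]]], of "fst \<omega>" \<xi>] by simp
      also have "Fourier (dilate (cl (snd \<omega>)) \<psi>) (- \<xi>) = Fourier \<psi> (cl (snd \<omega>) *\<^sub>R (- \<xi>))"
        using cl(3) by (intro Fourier_dilate) auto
      finally show "(LINT z|lborel. cis (- (z \<bullet> \<xi>)) * K \<omega> z) = (cis (- (fst \<omega> \<bullet> \<xi>)) * \<Theta> (x - fst \<omega>)) * Fourier \<psi> (cl (snd \<omega>) *\<^sub>R (- \<xi>))"
        by (simp only: mult_ac)
    qed
    also have "\<dots> = (LINT y|lborel. LINT \<tau>|N. (cis (- (y \<bullet> \<xi>)) * \<Theta> (x - y)) * Fourier \<psi> (cl \<tau> *\<^sub>R (- \<xi>)))"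
    proof -
      have "integrable (lborel \<Otimes>\<^sub>M N) (\<lambda>\<omega>. (cis (- (fst \<omega> \<bullet> \<xi>)) * \<Theta> (x - fst \<omega>)) * Fourier \<psi> (cl (snd \<omega>) *\<^sub>R (- \<xi>)))"
      proof (rule integrableI_bounded)
        show "(\<lambda>\<omega>. (cis (- (fst \<omega> \<bullet> \<xi>)) * \<Theta> (x - fst \<omega>)) * Fourier \<psi> (cl (snd \<omega>) *\<^sub>R (- \<xi>))) \<in> borel_measurable (lborel \<Otimes>\<^sub>M N)"
          by measurable
        have "(\<integral>\<^sup>+\<omega>. ennreal (norm ((cis (- (fst \<omega> \<bullet> \<xi>)) * \<Theta> (x - fst \<omega>)) * Fourier \<psi> (cl (snd \<omega>) *\<^sub>R (- \<xi>)))) \<partial>(lborel \<Otimes>\<^sub>M N))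
          \<le> (\<integral>\<^sup>+\<omega>. ennreal (norm (\<Theta> (x - fst \<omega>))) * ennreal J \<partial>(lborel \<Otimes>\<^sub>M N))"
          using J by (intro nn_integral_mono) (auto simp: norm_mult mult_left_mono intro!: ennreal_leI simp flip: ennreal_mult')
        also have "\<dots> = (\<integral>\<^sup>+y. \<integral>\<^sup>+\<tau>. ennreal (norm (\<Theta> (x - y))) * ennreal J \<partial>N \<partial>lborel)"
          by (subst N.nn_integral_fst[symmetric]) simp_all
        also have "\<dots> = (\<integral>\<^sup>+y. ennreal (norm (\<Theta> (x - y))) \<partial>lborel) * (ennreal J * emeasure N (space N))"
          by (simp add: mult.assoc nn_integral_multc)
        also have "\<dots> < \<infinity>"
          using \<Theta>fin Nfin by (simp add: ennreal_mult_less_top)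
        finally show "(\<integral>\<^sup>+\<omega>. ennreal (norm ((cis (- (fst \<omega> \<bullet> \<xi>)) * \<Theta> (x - fst \<omega>)) * Fourier \<psi> (cl (snd \<omega>) *\<^sub>R (- \<xi>)))) \<partial>(lborel \<Otimes>\<^sub>M N)) < \<infinity>" .
      qed
      from P.integral_fst'[OF this] show ?thesis unfolding M_def by simp
    qed
    also have "\<dots> = Fourier (\<lambda>y. \<Theta> (x - y)) \<xi> * (LINT \<tau>|N. Fourier \<psi> (cl \<tau> *\<^sub>R (- \<xi>)))"
      unfolding Fourier_def[of "\<lambda>y. \<Theta> (x - y)"] by simp
    also have "Fourier (\<lambda>y. \<Theta> (x - y)) \<xi> = cis (- (x \<bullet> \<xi>)) * Fourier \<Theta> (- \<xi>)"
      by (rule Fourier_reflect) simp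
    also have "(LINT \<tau>|N. Fourier \<psi> (cl \<tau> *\<^sub>R (- \<xi>))) = (LINT \<tau>|N. Fourier \<psi> (\<tau> *\<^sub>R (- \<xi>)))"
      by (intro integral_cong_AE eventually_mono[OF AEN]) (simp_all add: clid)
    finally show "Fourier T0 \<xi> = cis (- (x \<bullet> \<xi>)) * Fourier \<Theta> (- \<xi>) * (LINT \<tau>|N. Fourier \<psi> (\<tau> *\<^sub>R (- \<xi>)))" .
  qed
qed

section \<open>Comparison of Besov norms\<close>

lemma Fourier_add:
  assumes "g \<in> Schwartz" "h \<in> Schwartz"
  shows "Fourier (\<lambda>z. g z + h z) \<xi> = Fourier g \<xi> + Fourier h \<xi>"
proof -
  have i: "integrable lborel (\<lambda>x. cis (- (x \<bullet> \<xi>)) * u x)" if "u \<in> Schwartz" for u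
  proof (rule Bochner_Integration.integrable_bound[OF Schwartz_integrable[OF that]])
    note [measurable] = Schwartz_measurable[OF that]
    show "(\<lambda>x. cis (- (x \<bullet> \<xi>)) * u x) \<in> borel_measurable lborel" by measurable
  qed (simp add: norm_mult)
  show ?thesis unfolding Fourier_def distrib_left by (intro Bochner_Integration.integral_add i assms)
qed

lemma Fourier_eq_imp_eq:
  fixes g h :: "'a::euclidean_space \<Rightarrow> complex"
  assumes g: "g \<in> Schwartz" and h: "h \<in> Schwartz" and eq: "\<And>\<xi>. Fourier g \<xi> = Fourier h \<xi>"
  shows "g = h"
proof
  fix x
  define u where "u = (\<lambda>z. g z - h z)"
  have u: "u \<in> Schwartz" unfolding u_def by (rule Schwartz_diff[OF g h])
  have "u x = 0"
  proof (rule Fourier_injective[where G=u and B="Schwartz_seminorm 0 [] u"])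
    show "norm (u x) \<le> Schwartz_seminorm 0 [] u" for x using Schwartz_seminorm_upper[OF u, of "[]" x 0] by simp
    show "Fourier u \<xi> = 0" for \<xi>
      using Fourier_add[OF u h, of \<xi>] eq[of \<xi>] by (simp add: u_def)
  qed (use u in \<open>auto intro: Schwartz_continuous Schwartz_integrable\<close>)
  then show "g x = h x" by (simp add: u_def)
qed

text \<open>The logarithm in the condition is at least 1, so \<open>g\<close> stays within
  \<open>c\<close> of \<open>g 0\<close>. For \<alpha> this bound makes the weights of comparable
  scales comparable.\<close>

lemma Clog_loc_bounded:
  assumes "g \<in> Clog_loc"
  obtains L where "0 \<le> L" "\<And>x. \<bar>g x\<bar> \<le> L"
proof -
  obtain c where c: "0 < c" "\<And>x y. \<bar>g x - g y\<bar> \<le> c / ln (exp 1 + 1 / norm (x - y))"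
    using assms by (auto simp: Clog_loc_def)
  have "\<bar>g x\<bar> \<le> \<bar>g 0\<bar> + c" for x
  proof -
    have l: "1 \<le> ln (exp 1 + 1 / norm (x - 0))" by (intro one_le_ln_exp1_plus) simp
    have "\<bar>g x - g 0\<bar> \<le> c / ln (exp 1 + 1 / norm (x - 0))" by (rule c)
    also have "\<dots> \<le> c / 1" using c(1) l by (intro divide_left_mono) auto
    finally show ?thesis by simp
  qed
  then show thesis using c(1) by (intro that[of "\<bar>g 0\<bar> + c"]) auto
qed

lemma powr_le_comparable:
  fixes s t e L :: real
  assumes "0 < s" "0 < t" "s \<le> 4 * t" "t \<le> 4 * s" "\<bar>e\<bar> \<le> L"
  shows "t powr e \<le> 4 powr L * s powr e"
proof -
  have "\<bar>ln (t / s)\<bar> \<le> ln 4"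
  proof -
    have "ln (t / s) \<le> ln 4" using assms by (intro ln_mono) (auto simp: field_simps)
    moreover have "ln (s / t) \<le> ln 4" using assms by (intro ln_mono) (auto simp: field_simps)
    moreover have "ln (s / t) = - ln (t / s)" using assms by (simp add: ln_div)
    ultimately show ?thesis by linarith
  qed
  then have "\<bar>e\<bar> * \<bar>ln (t / s)\<bar> \<le> L * ln 4" using assms by (intro mult_mono) auto
  then have "e * ln (t / s) \<le> L * ln 4" by (metis abs_le_D1 abs_mult)
  then have "(t / s) powr e \<le> 4 powr L" using assms by (simp add: powr_def)
  then have "(t / s) powr e * s powr e \<le> 4 powr L * s powr e" by (intro mult_right_mono) auto
  then show ?thesis using assms by (simp add: powr_divide)
qed

text \<open>
  For \<open>t > 0\<close> the scale \<open>exp (ln t)\<close> is \<open>t\<close>; for \<open>t \<le> 0\<close> it is still positive, which makes \<open>scale_norm\<close>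
  measurable on the whole line.
\<close>
definition scale_norm :: "('a::euclidean_space \<Rightarrow> real) \<Rightarrow> ('a \<Rightarrow> real) \<Rightarrow> ('a \<Rightarrow> complex) \<Rightarrow>
    (('a \<Rightarrow> complex) \<Rightarrow> complex) \<Rightarrow> real \<Rightarrow> ennreal" where
  "scale_norm p \<alpha> g f t = Lp_norm p (\<lambda>x. complex_of_real (t powr (- \<alpha> x)) * conv_dist (dilate (exp (ln t)) g) f x)"

text \<open>\<kappa> switches on the low-frequency term, which lives at scale 1 and is comparable to
  scale \<open>t\<close> only for \<open>1 / 4 \<le> t\<close>. The factor
  \<open>Fourier \<Theta>\<close> stands on both sides because the bracket is claimed to be 1 only
  where that factor does not vanish. \<open>C\<close> precedes \<open>t\<close>, \<kappa> and
  \<open>f\<close>.\<close>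

definition reproducing_constant :: "('a::euclidean_space \<Rightarrow> real) \<Rightarrow> ('a \<Rightarrow> real) \<Rightarrow>
    ('a \<Rightarrow> complex) \<Rightarrow> ('a \<Rightarrow> complex) \<Rightarrow> ('a \<Rightarrow> complex) \<Rightarrow> real \<Rightarrow> bool" where
  "reproducing_constant p \<alpha> \<Theta> \<Psi> \<psi> C \<longleftrightarrow> 0 < C \<and>
    (\<forall>t \<kappa> f. 0 < t \<longrightarrow> t \<le> 1 \<longrightarrow> (\<kappa> \<longrightarrow> 1 / 4 \<le> t) \<longrightarrow> f \<in> tempered_distributions \<longrightarrow>
      (\<forall>\<xi>. Fourier \<Theta> (t *\<^sub>R \<xi>) = Fourier \<Theta> (t *\<^sub>R \<xi>) * ((if \<kappa> then Fourier \<Psi> \<xi> else 0) +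
        (LINT \<tau>:{t / 4..min 1 (4 * t)}|lborel. Fourier \<psi> (\<tau> *\<^sub>R \<xi>) / complex_of_real \<tau>))) \<longrightarrow>
      scale_norm p \<alpha> \<Theta> f t \<le> ennreal C * ((if \<kappa> then Lp_norm p (conv_dist \<Psi> f) else 0) +
        (\<integral>\<^sup>+\<tau>\<in>{t / 4..min 1 (4 * t)}. scale_norm p \<alpha> \<psi> f \<tau> * ennreal (1 / \<tau>) \<partial>lborel)))"

lemma borel_measurable_scale_norm:
  assumes p: "p \<in> log_exponents" and \<alpha>: "\<alpha> \<in> Clog_loc" and g: "g \<in> Schwartz" and f: "f \<in> tempered_distributions"
  shows "scale_norm p \<alpha> g f \<in> borel_measurable borel"
proof -
  note [measurable] = conv_dist_measurable[OF g f]
  have [measurable]: "\<alpha> \<in> borel_measurable borel" "p \<in> borel_measurable borel"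
    using continuous_Clog_loc[OF \<alpha>] continuous_log_exponents[OF p] by (auto intro: borel_measurable_continuous_onI)
  have "0 \<le> p x" for x using p by (auto simp: log_exponents_def var_exponents_def intro: order_trans[OF zero_le_one])
  then show ?thesis unfolding scale_norm_def by (intro borel_measurable_Lp_norm) auto
qed

text \<open>By injectivity of the Fourier transform the assumed identity decomposes the reflected
  \<open>dilate t \<Theta>\<close> into two functions from \<open>reproducing_kernel\<close>, one
  for a point mass at scale 1 or the zero measure, one for \<open>d\<tau>/\<tau>\<close>. The
  convolution bound keeps the weight of scale \<open>t\<close>; passing to the weight of scale
  \<tau> costs the constant \<open>Q\<close>, since the two scales are comparable.\<close>

lemma reproducing_Lp_bound:
  fixes p \<alpha> :: "'a::euclidean_space \<Rightarrow> real" and \<Theta> \<Psi> \<psi> :: "'a \<Rightarrow> complex"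
  assumes p: "p \<in> log_exponents" and \<alpha>: "\<alpha> \<in> Clog_loc"
    and \<Theta>: "\<Theta> \<in> Schwartz" and \<Psi>: "\<Psi> \<in> Schwartz" and \<psi>: "\<psi> \<in> Schwartz"
  shows "\<exists>C. reproducing_constant p \<alpha> \<Theta> \<Psi> \<psi> C"
proof -
  obtain C1 where cc: "convolution_constant p \<alpha> \<Theta> C1"
    using Lp_convolution_bound[OF p \<alpha> Schwartz_measurable[OF \<Theta>] Schwartz_decay[OF \<Theta>]] by blast
  then have C1: "0 < C1" by (simp add: convolution_constant_def)
  note conv = cc[unfolded convolution_constant_def, THEN conjunct2, rule_format]
  obtain L where L: "0 \<le> L" "\<And>x. \<bar>\<alpha> x\<bar> \<le> L" using Clog_loc_bounded[OF \<alpha>] by blast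
  have [measurable]: "\<alpha> \<in> borel_measurable borel" "p \<in> borel_measurable borel"
    using continuous_Clog_loc[OF \<alpha>] continuous_log_exponents[OF p] by (auto intro: borel_measurable_continuous_onI)
  have p1: "1 \<le> p x" for x using p by (simp add: log_exponents_def var_exponents_def)
  have p0: "0 \<le> p x" for x using p1[of x] by simp
  define Q where "Q = (4::real) powr L"
  have Q: "0 < Q" by (simp add: Q_def)
  \<comment> \<open>The 8 is 2, for the halving of \<open>F\<close>, times the 4 of
    \<open>Lp_norm_triangle\<close>.\<close>
  define C where "C = 8 * C1 * Q"
  have C: "0 < C" using C1 Q by (simp add: C_def)
  have main: "scale_norm p \<alpha> \<Theta> f t \<le> ennreal C * ((if \<kappa> then Lp_norm p (conv_dist \<Psi> f) else 0) +
       (\<integral>\<^sup>+\<tau>\<in>{t / 4..min 1 (4 * t)}. scale_norm p \<alpha> \<psi> f \<tau> * ennreal (1 / \<tau>) \<partial>lborel))"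
    if t: "0 < t" "t \<le> 1" and \<kappa>: "\<kappa> \<Longrightarrow> 1 / 4 \<le> t" and f: "f \<in> tempered_distributions"
    and id: "\<And>\<xi>. Fourier \<Theta> (t *\<^sub>R \<xi>) = Fourier \<Theta> (t *\<^sub>R \<xi>) * ((if \<kappa> then Fourier \<Psi> \<xi> else 0) +
       (LINT \<tau>:{t / 4..min 1 (4 * t)}|lborel. Fourier \<psi> (\<tau> *\<^sub>R \<xi>) / complex_of_real \<tau>))"
    for t \<kappa> f
  proof -
    define a where "a = t / 4"
    define b where "b = min 1 (4 * t)"
    have ab: "0 < a" "a \<le> b" using t by (auto simp: a_def b_def)
    define N1 where "N1 = (if \<kappa> then return borel 1 else null_measure borel :: real measure)"
    define N2 where "N2 = density lborel (\<lambda>\<tau>. ennreal (indicator {a..b} \<tau> / \<tau>))"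
    have sN[measurable_cong]: "sets N1 = sets borel" "sets N2 = sets borel" by (auto simp: N1_def N2_def)
    have fN1: "finite_measure N1"
      unfolding N1_def by (auto intro: prob_space.finite_measure prob_space_return finite_measureI)
    have iN2: "(\<integral>\<^sup>+\<tau>. g \<tau> \<partial>N2) = (\<integral>\<^sup>+\<tau>\<in>{a..b}. g \<tau> * ennreal (1 / \<tau>) \<partial>lborel)"
      if [measurable]: "g \<in> borel_measurable borel" for g
      unfolding N2_def by (subst nn_integral_density) (auto intro!: nn_integral_cong simp: indicator_def mult.commute)
    have fN2: "finite_measure N2"
    proof (rule finite_measureI)
      have "emeasure N2 (space N2) = (\<integral>\<^sup>+\<tau>. 1 \<partial>N2)" by simp
      also have "\<dots> = (\<integral>\<^sup>+\<tau>\<in>{a..b}. ennreal (1 / \<tau>) \<partial>lborel)" by (subst iN2) auto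
      also have "\<dots> \<le> ennreal ((b - a) / a)" using ab by (rule nn_integral_inverse_Icc_le)
      finally show "emeasure N2 (space N2) \<noteq> \<infinity>" by (auto simp: top_unique)
    qed
    have AE1: "AE \<tau> in N1. 1 \<le> \<tau> \<and> \<tau> \<le> 1"
    proof (cases \<kappa>)
      case True
      then show ?thesis unfolding N1_def by (simp add: AE_return)
    next
      case False
      then show ?thesis unfolding N1_def by (intro AE_I'[of UNIV]) (auto simp: null_sets_def)
    qed
    have AE2: "AE \<tau> in N2. a \<le> \<tau> \<and> \<tau> \<le> b"
      unfolding N2_def by (subst AE_density) (auto simp: indicator_def)
    define V where "V g \<tau> y = conv_dist (dilate (exp (ln \<tau>)) g) f y" for g \<tau> y
    have V[measurable]: "(\<lambda>(\<tau>, y). V \<Psi> \<tau> y) \<in> borel_measurable (borel \<Otimes>\<^sub>M borel)"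
        "(\<lambda>(\<tau>, y). V \<psi> \<tau> y) \<in> borel_measurable (borel \<Otimes>\<^sub>M borel)"
      unfolding V_def by (intro conv_dist_measurable f \<Psi> \<psi>)+
    have dS: "dilate t \<Theta> \<in> Schwartz" using \<Theta> t by (intro Schwartz_dilate) auto
    have dF: "Fourier (dilate t \<Theta>) \<xi> = Fourier \<Theta> (t *\<^sub>R \<xi>)" for \<xi>
      using t Schwartz_measurable[OF \<Theta>] by (intro Fourier_dilate)
    define F where "F = conv_dist (dilate t \<Theta>) f"
    define I where "I N g x = (\<integral>\<^sup>+\<tau>. \<integral>\<^sup>+y. ennreal (norm (dilate t \<Theta> (x - y)) * norm (V g \<tau> y)) \<partial>lborel \<partial>N)" for N g x
    have [measurable]: "dilate t \<Theta> \<in> borel_measurable borel" by (rule Schwartz_measurable[OF dS])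
    interpret N1: finite_measure N1 by fact
    interpret N2: finite_measure N2 by fact
    have [measurable]: "I N1 \<Psi> \<in> borel_measurable borel" "I N2 \<psi> \<in> borel_measurable borel"
      unfolding I_def by measurable
    have [measurable]: "F \<in> borel_measurable borel"
    proof -
      have "(\<lambda>y. (\<lambda>(\<tau>, y). conv_dist (dilate (exp (ln \<tau>)) (dilate t \<Theta>)) f y) (1, y)) \<in> borel_measurable borel"
        by (rule measurable_compose[OF _ conv_dist_measurable[OF dS f]]) measurable
      then show ?thesis by (simp add: F_def dilate_1)
    qed
    have Fle: "ennreal (norm (F x)) \<le> I N1 \<Psi> x + I N2 \<psi> x" for x
    proof -
      obtain T1 where T1: "T1 \<in> Schwartz"
        "\<And>\<xi>. Fourier T1 \<xi> = cis (- (x \<bullet> \<xi>)) * Fourier (dilate t \<Theta>) (- \<xi>) * (LINT \<tau>|N1. Fourier \<Psi> (\<tau> *\<^sub>R (- \<xi>)))"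
        "ennreal (norm (f T1)) \<le> I N1 \<Psi> x"
        by (rule reproducing_kernel[OF dS \<Psi> fN1 sN(1) zero_less_one order_refl AE1, of x]) (use f in \<open>simp add: I_def V_def\<close>)
      obtain T2 where T2: "T2 \<in> Schwartz"
        "\<And>\<xi>. Fourier T2 \<xi> = cis (- (x \<bullet> \<xi>)) * Fourier (dilate t \<Theta>) (- \<xi>) * (LINT \<tau>|N2. Fourier \<psi> (\<tau> *\<^sub>R (- \<xi>)))"
        "ennreal (norm (f T2)) \<le> I N2 \<psi> x"
        by (rule reproducing_kernel[OF dS \<psi> fN2 sN(2) ab AE2, of x]) (use f in \<open>simp add: I_def V_def\<close>)
      have [measurable]: "Fourier \<psi> \<in> borel_measurable borel" "Fourier \<Psi> \<in> borel_measurable borel"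
        using \<psi> \<Psi> by (auto intro: borel_measurable_Fourier Schwartz_measurable)
      have "(\<lambda>z. dilate t \<Theta> (x - z)) = (\<lambda>z. T1 z + T2 z)"
      proof (rule Fourier_eq_imp_eq[OF Schwartz_reflect[OF dS] Schwartz_add(1)[OF T1(1) T2(1)]])
        fix \<xi> :: 'a
        have i1: "(LINT \<tau>|N1. Fourier \<Psi> (\<tau> *\<^sub>R (- \<xi>))) = (if \<kappa> then Fourier \<Psi> (- \<xi>) else 0)"
          unfolding N1_def by (simp add: integral_return)
        have i2: "(LINT \<tau>|N2. Fourier \<psi> (\<tau> *\<^sub>R (- \<xi>))) = (LINT \<tau>:{a..b}|lborel. Fourier \<psi> (\<tau> *\<^sub>R (- \<xi>)) / complex_of_real \<tau>)"
          unfolding N2_def set_lebesgue_integral_def using ab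
          by (subst integral_density) (auto intro!: Bochner_Integration.integral_cong simp: indicator_def scaleR_conv_of_real)
        have "Fourier (\<lambda>z. T1 z + T2 z) \<xi> = cis (- (x \<bullet> \<xi>)) * (Fourier \<Theta> (t *\<^sub>R (- \<xi>)) *
            ((if \<kappa> then Fourier \<Psi> (- \<xi>) else 0) + (LINT \<tau>:{a..b}|lborel. Fourier \<psi> (\<tau> *\<^sub>R (- \<xi>)) / complex_of_real \<tau>)))"
          unfolding Fourier_add[OF T1(1) T2(1)] T1(2) T2(2) i1 i2 dF by (simp only: distrib_left mult.assoc)
        also have "\<dots> = cis (- (x \<bullet> \<xi>)) * Fourier \<Theta> (t *\<^sub>R (- \<xi>))"
          unfolding a_def b_def id[of "- \<xi>", symmetric] ..
        also have "\<dots> = Fourier (\<lambda>z. dilate t \<Theta> (x - z)) \<xi>"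
          using Fourier_reflect[OF Schwartz_measurable[OF dS], of x \<xi>] dF by simp
        finally show "Fourier (\<lambda>z. dilate t \<Theta> (x - z)) \<xi> = Fourier (\<lambda>z. T1 z + T2 z) \<xi>" ..
      qed
      then have "F x = f T1 + f T2" unfolding F_def conv_dist_def using tempered_add[OF f T1(1) T2(1)] by simp
      then have "ennreal (norm (F x)) \<le> ennreal (norm (f T1) + norm (f T2))"
        by (simp add: ennreal_leI norm_triangle_ineq del: ennreal_plus)
      also have "\<dots> = ennreal (norm (f T1)) + ennreal (norm (f T2))" by simp
      also have "\<dots> \<le> I N1 \<Psi> x + I N2 \<psi> x" by (intro add_mono T1 T2)
      finally show ?thesis .
    qed
    \<comment> \<open>The convolution bound admits a single majorant, so \<open>F\<close> is split according to the larger one.\<close>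
    define F1 where "F1 x = (if I N2 \<psi> x \<le> I N1 \<Psi> x then F x / 2 else 0)" for x
    define F2 where "F2 x = (if I N2 \<psi> x \<le> I N1 \<Psi> x then 0 else F x / 2)" for x
    have half: "ennreal (norm z / 2) \<le> c" if "ennreal (norm z) \<le> c + c" for z :: complex and c
    proof (cases c)
      case (real r)
      then have "norm z \<le> r + r" using that by (auto simp: ennreal_le_iff2 simp flip: ennreal_plus)
      then show ?thesis using real by (simp add: norm_divide ennreal_leI)
    qed simp
    have F1le: "ennreal (norm (F1 x)) \<le> I N1 \<Psi> x" for x
      unfolding F1_def using order_trans[OF Fle[of x] add_left_mono[of "I N2 \<psi> x" "I N1 \<Psi> x" "I N1 \<Psi> x"]] by (auto simp: norm_divide intro!: half)
    have F2le: "ennreal (norm (F2 x)) \<le> I N2 \<psi> x" for x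
      unfolding F2_def using order_trans[OF Fle[of x] add_right_mono[of "I N1 \<Psi> x" "I N2 \<psi> x" "I N2 \<psi> x"]] by (auto simp: norm_divide intro!: half)
    have [measurable]: "F1 \<in> borel_measurable borel" "F2 \<in> borel_measurable borel" unfolding F1_def F2_def by measurable
    let ?w = "\<lambda>x. complex_of_real (t powr (- \<alpha> x))"
    define H where "H = scale_norm p \<alpha> \<psi> f"
    have [measurable]: "H \<in> borel_measurable borel"
      unfolding H_def by (rule borel_measurable_scale_norm[OF p \<alpha> \<psi> f])
    have [measurable]: "(\<lambda>\<tau>. Lp_norm p (\<lambda>y. ?w y * V \<Psi> \<tau> y)) \<in> borel_measurable borel"
      using p0 by (intro borel_measurable_Lp_norm) auto
    have w1: "Lp_norm p (\<lambda>x. ?w x * F1 x) \<le> ennreal C1 * (ennreal Q * (if \<kappa> then Lp_norm p (conv_dist \<Psi> f) else 0))"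
    proof -
      have "Lp_norm p (\<lambda>x. ?w x * F1 x) \<le> ennreal C1 * (\<integral>\<^sup>+\<tau>. Lp_norm p (\<lambda>y. ?w y * V \<Psi> \<tau> y) \<partial>N1)"
        using F1le unfolding I_def by (intro conv t fN1 sN V)
      also have "(\<integral>\<^sup>+\<tau>. Lp_norm p (\<lambda>y. ?w y * V \<Psi> \<tau> y) \<partial>N1) \<le> ennreal Q * (if \<kappa> then Lp_norm p (conv_dist \<Psi> f) else 0)"
      proof (cases \<kappa>)
        case True
        have "(\<integral>\<^sup>+\<tau>. Lp_norm p (\<lambda>y. ?w y * V \<Psi> \<tau> y) \<partial>N1) = Lp_norm p (\<lambda>y. ?w y * V \<Psi> 1 y)"
          unfolding N1_def using True by (simp add: nn_integral_return)
        also have "\<dots> \<le> ennreal Q * Lp_norm p (conv_dist \<Psi> f)"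
        proof (intro Lp_norm_mono_scaled p0 Q)
          fix y
          have "t powr (- \<alpha> y) \<le> Q * 1 powr (- \<alpha> y)"
            unfolding Q_def using t \<kappa>[OF True] L by (intro powr_le_comparable) auto
          then show "norm (?w y * V \<Psi> 1 y) \<le> Q * norm (conv_dist \<Psi> f y)"
            by (simp add: norm_mult V_def dilate_1 mult_right_mono)
        qed
        finally show ?thesis using True by simp
      qed (simp add: N1_def)
      finally show ?thesis by (simp add: mult_left_mono)
    qed
    have w2: "Lp_norm p (\<lambda>x. ?w x * F2 x) \<le> ennreal C1 * (ennreal Q * (\<integral>\<^sup>+\<tau>\<in>{a..b}. H \<tau> * ennreal (1 / \<tau>) \<partial>lborel))"
    proof -
      have "Lp_norm p (\<lambda>x. ?w x * F2 x) \<le> ennreal C1 * (\<integral>\<^sup>+\<tau>. Lp_norm p (\<lambda>y. ?w y * V \<psi> \<tau> y) \<partial>N2)"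
        using F2le unfolding I_def by (intro conv t fN2 sN V)
      also have "(\<integral>\<^sup>+\<tau>. Lp_norm p (\<lambda>y. ?w y * V \<psi> \<tau> y) \<partial>N2) \<le> (\<integral>\<^sup>+\<tau>. ennreal Q * H \<tau> \<partial>N2)"
      proof (intro nn_integral_mono_AE eventually_mono[OF AE2])
        fix \<tau> assume \<tau>: "a \<le> \<tau> \<and> \<tau> \<le> b"
        show "Lp_norm p (\<lambda>y. ?w y * V \<psi> \<tau> y) \<le> ennreal Q * H \<tau>"
          unfolding H_def scale_norm_def V_def[symmetric]
        proof (intro Lp_norm_mono_scaled p0 Q)
          fix y
          have "t powr (- \<alpha> y) \<le> Q * \<tau> powr (- \<alpha> y)"
            unfolding Q_def using t \<tau> ab L by (intro powr_le_comparable) (auto simp: a_def b_def)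
          then have "t powr (- \<alpha> y) * norm (V \<psi> \<tau> y) \<le> (Q * \<tau> powr (- \<alpha> y)) * norm (V \<psi> \<tau> y)"
            by (intro mult_right_mono) auto
          then show "norm (?w y * V \<psi> \<tau> y) \<le> Q * norm (complex_of_real (\<tau> powr (- \<alpha> y)) * V \<psi> \<tau> y)"
            by (simp add: norm_mult mult.assoc)
        qed
      qed
      also have "\<dots> = ennreal Q * (\<integral>\<^sup>+\<tau>. H \<tau> \<partial>N2)" by (intro nn_integral_cmult) measurable
      also have "(\<integral>\<^sup>+\<tau>. H \<tau> \<partial>N2) = (\<integral>\<^sup>+\<tau>\<in>{a..b}. H \<tau> * ennreal (1 / \<tau>) \<partial>lborel)" by (intro iN2) measurable
      finally show ?thesis by (simp add: mult_left_mono)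
    qed
    have "Lp_norm p (\<lambda>x. ?w x * F x) \<le> ennreal 2 * Lp_norm p (\<lambda>x. ?w x * F x / 2)"
      by (intro Lp_norm_mono_scaled p0) (auto simp: norm_divide)
    also have "\<dots> \<le> ennreal 2 * (4 * (Lp_norm p (\<lambda>x. ?w x * F1 x) + Lp_norm p (\<lambda>x. ?w x * F2 x)))"
      by (intro mult_left_mono Lp_norm_triangle p1) (auto simp: F1_def F2_def)
    also have "\<dots> \<le> ennreal 2 * (4 * (ennreal C1 * (ennreal Q * (if \<kappa> then Lp_norm p (conv_dist \<Psi> f) else 0))
        + ennreal C1 * (ennreal Q * (\<integral>\<^sup>+\<tau>\<in>{a..b}. H \<tau> * ennreal (1 / \<tau>) \<partial>lborel))))"
      by (intro mult_left_mono add_mono w1 w2) auto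
    also have "\<dots> = (ennreal 2 * ennreal 4 * ennreal C1 * ennreal Q) * ((if \<kappa> then Lp_norm p (conv_dist \<Psi> f) else 0)
        + (\<integral>\<^sup>+\<tau>\<in>{a..b}. H \<tau> * ennreal (1 / \<tau>) \<partial>lborel))"
      by (simp add: distrib_left mult.assoc)
    also have "ennreal 2 * ennreal 4 * ennreal C1 * ennreal Q = ennreal C"
      unfolding C_def using C1 Q by (simp add: ennreal_mult flip: mult.assoc)
    finally show ?thesis using t unfolding F_def H_def a_def b_def by (simp add: scale_norm_def)
  qed
  show ?thesis
    unfolding reproducing_constant_def by (intro exI[of _ C] conjI allI impI C main) auto
qed

section \<open>Localisation by supports and the final comparison\<close>

lemma Fourier_support_zero:
  assumes "supp (Fourier g) \<subseteq> S" "\<xi> \<notin> S"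
  shows "Fourier g \<xi> = 0"
proof (rule ccontr)
  assume "Fourier g \<xi> \<noteq> 0"
  then have "\<xi> \<in> {x. Fourier g x \<noteq> 0}" by simp
  then have "\<xi> \<in> supp (Fourier g)" unfolding supp_def by (rule closure_subset[THEN subsetD])
  with assms show False by blast
qed

text \<open>The low-frequency part uses the reproducing bound at \<open>t = 1\<close>, the other
  part uses it at every \<open>t\<close> and then the local averages over scales. What has to be
  verified here is the identity of Fourier transforms, which follows from the supports.\<close>

lemma Besov_norm_le:
  fixes \<Phi> \<phi> \<Psi> \<psi> :: "'a::euclidean_space \<Rightarrow> complex"
    and p \<alpha> :: "'a \<Rightarrow> real" and q :: "real \<Rightarrow> real"
  assumes r1: "resolution_of_unity \<Phi> \<phi>" and r2: "resolution_of_unity \<Psi> \<psi>"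
    and p: "p \<in> log_exponents" and \<alpha>: "\<alpha> \<in> Clog_loc"
    and q: "q \<in> var_exponents" "log_Hoelder_at_0 q"
  shows "\<exists>C>0. \<forall>f\<in>tempered_distributions. Besov_norm \<Phi> \<phi> \<alpha> p q f \<le> ennreal C * Besov_norm \<Psi> \<psi> \<alpha> p q f"
proof -
  have S: "\<Phi> \<in> Schwartz" "\<phi> \<in> Schwartz" "\<Psi> \<in> Schwartz" "\<psi> \<in> Schwartz"
    using r1 r2 by (auto simp: resolution_of_unity_def)
  have supp1: "Fourier \<Phi> \<xi> = 0" if "2 \<le> norm \<xi>" for \<xi>
    using r1 that by (intro Fourier_support_zero[of _ "{x. norm x < 2}"]) (auto simp: resolution_of_unity_def)
  have supp2: "Fourier \<phi> \<xi> = 0" if "norm \<xi> \<le> 1 / 2 \<or> 2 \<le> norm \<xi>" for \<xi>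
    using r1 that by (intro Fourier_support_zero[of _ "{x. 1 / 2 < norm x \<and> norm x < 2}"]) (auto simp: resolution_of_unity_def)
  have supp3: "Fourier \<Psi> \<xi> = 0" if "2 \<le> norm \<xi>" for \<xi>
    using r2 that by (intro Fourier_support_zero[of _ "{x. norm x < 2}"]) (auto simp: resolution_of_unity_def)
  have supp4: "Fourier \<psi> \<xi> = 0" if "norm \<xi> \<le> 1 / 2 \<or> 2 \<le> norm \<xi>" for \<xi>
    using r2 that by (intro Fourier_support_zero[of _ "{x. 1 / 2 < norm x \<and> norm x < 2}"]) (auto simp: resolution_of_unity_def)
  have one: "Fourier \<Psi> \<xi> + (LINT t:{0<..1}|lborel. Fourier \<psi> (t *\<^sub>R \<xi>) / complex_of_real t) = 1" for \<xi>
    using r2 by (simp add: resolution_of_unity_def)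
  \<comment> \<open>Outside the window, \<open>\<tau> *\<^sub>R \<xi>\<close> misses the annulus of
    \<psi>: below \<open>t / 4\<close> because \<open>t * norm \<xi> < 2\<close>, above
    \<open>4 * t\<close> because \<open>1 / 2 < t * norm \<xi>\<close>. For \<open>t = 1\<close> no
    scale in the unit interval lies above the window, which accommodates the ball supporting
    \<open>Fourier \<Phi>\<close>.\<close>
  have localise: "(LINT \<tau>:{t / 4..min 1 (4 * t)}|lborel. Fourier \<psi> (\<tau> *\<^sub>R \<xi>) / complex_of_real \<tau>)
      = (LINT \<tau>:{0<..1}|lborel. Fourier \<psi> (\<tau> *\<^sub>R \<xi>) / complex_of_real \<tau>)"
    if t: "0 < t" "t * norm \<xi> < 2" "1 / 2 < t * norm \<xi> \<or> t = 1" for t and \<xi> :: 'a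
    unfolding set_lebesgue_integral_def
  proof (rule Bochner_Integration.integral_cong[OF refl])
    fix \<tau>
    have z: "Fourier \<psi> (\<tau> *\<^sub>R \<xi>) = 0" if \<tau>: "0 < \<tau>" "\<tau> \<le> 1" "\<tau> < t / 4 \<or> 4 * t < \<tau>"
    proof (rule supp4)
      show "norm (\<tau> *\<^sub>R \<xi>) \<le> 1 / 2 \<or> 2 \<le> norm (\<tau> *\<^sub>R \<xi>)"
        using \<tau>(3)
      proof
        assume "\<tau> < t / 4"
        then have "\<tau> * norm \<xi> \<le> (t / 4) * norm \<xi>" by (intro mult_right_mono) auto
        then show ?thesis using t \<tau> by simp
      next
        assume *: "4 * t < \<tau>"
        then have "(4 * t) * norm \<xi> \<le> \<tau> * norm \<xi>" by (intro mult_right_mono) auto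
        then show ?thesis using t \<tau> * by auto
      qed
    qed
    show "indicator {t / 4..min 1 (4 * t)} \<tau> *\<^sub>R (Fourier \<psi> (\<tau> *\<^sub>R \<xi>) / complex_of_real \<tau>)
      = indicator {0<..1} \<tau> *\<^sub>R (Fourier \<psi> (\<tau> *\<^sub>R \<xi>) / complex_of_real \<tau>)"
      by (cases "\<tau> < t / 4 \<or> 4 * t < \<tau>") (use z t in \<open>auto simp: indicator_def\<close>)
  qed
  obtain C1 where C1: "reproducing_constant p \<alpha> \<Phi> \<Psi> \<psi> C1"
    using reproducing_Lp_bound[OF p \<alpha> S(1,3,4)] by blast
  note B1 = C1[unfolded reproducing_constant_def, THEN conjunct2, rule_format]
  obtain C2 where C2: "reproducing_constant p \<alpha> \<phi> \<Psi> \<psi> C2"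
    using reproducing_Lp_bound[OF p \<alpha> S(2,3,4)] by blast
  note B2 = C2[unfolded reproducing_constant_def, THEN conjunct2, rule_format]
  have C120: "0 < C1" "0 < C2" using C1 C2 by (simp_all add: reproducing_constant_def)
  obtain C3 where C3: "local_average_constant q C2 C3"
    using Lq_norm_dt_local_average_bound[OF q less_imp_le[OF C120(2)]] by blast
  note B3 = C3[unfolded local_average_constant_def, THEN conjunct2, THEN conjunct1, rule_format]
  note B4 = C3[unfolded local_average_constant_def, THEN conjunct2, THEN conjunct2, rule_format]
  have C30: "0 < C3" using C3 by (simp add: local_average_constant_def)
  \<comment> \<open>The sum of the constants of both parts, once \<open>A\<close> and
    \<open>X\<close> have been enlarged to \<open>A + X\<close>.\<close>
  define C where "C = C1 * (1 + C3) + C3"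
  have C: "0 < C" using C120 C30 by (simp add: C_def add_pos_pos)
  have "Besov_norm \<Phi> \<phi> \<alpha> p q f \<le> ennreal C * Besov_norm \<Psi> \<psi> \<alpha> p q f" if f: "f \<in> tempered_distributions" for f
  proof -
    define A where "A = Lp_norm p (conv_dist \<Psi> f)"
    define H where "H = scale_norm p \<alpha> \<psi> f"
    have Hm: "H \<in> borel_measurable borel"
      unfolding H_def by (rule borel_measurable_scale_norm[OF p \<alpha> S(4) f])
    have scale: "scale_norm p \<alpha> g f t = Lp_norm p (\<lambda>x. complex_of_real (t powr (- \<alpha> x)) * conv_dist (dilate t g) f x)"
      if "0 < t" for g t using that by (simp add: scale_norm_def)
    define X where "X = Lq_norm_dt q {0<..1} H"
    have X: "Lq_norm_dt q {0<..1} (\<lambda>t. Lp_norm p (\<lambda>x. complex_of_real (t powr (- \<alpha> x)) * conv_dist (dilate t \<psi>) f x)) = X"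
      unfolding X_def H_def by (intro Lq_norm_dt_cong) (simp add: scale)
    have low: "Lp_norm p (conv_dist \<Phi> f) \<le> ennreal C1 * (A + ennreal C3 * X)"
    proof -
      have "scale_norm p \<alpha> \<Phi> f 1 \<le>
        ennreal C1 * ((if True then A else 0) + (\<integral>\<^sup>+\<tau>\<in>{1 / 4..min 1 (4 * 1)}. H \<tau> * ennreal (1 / \<tau>) \<partial>lborel))"
        unfolding A_def H_def
      proof (rule B1[OF _ _ _ f])
        fix \<xi> :: 'a
        show "Fourier \<Phi> (1 *\<^sub>R \<xi>) = Fourier \<Phi> (1 *\<^sub>R \<xi>) * ((if True then Fourier \<Psi> \<xi> else 0) +
          (LINT \<tau>:{1 / 4..min 1 (4 * 1)}|lborel. Fourier \<psi> (\<tau> *\<^sub>R \<xi>) / complex_of_real \<tau>))"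
        proof (cases "norm \<xi> < 2")
          case True
          then show ?thesis using localise[of 1 \<xi>] one[of \<xi>] by simp
        next
          case False
          then show ?thesis using supp1[of \<xi>] by simp
        qed
      qed auto
      also have "\<dots> \<le> ennreal C1 * (A + ennreal C3 * X)"
        using B4[OF Hm] unfolding X_def by (intro mult_left_mono add_mono) auto
      finally show ?thesis by (simp add: scale dilate_1)
    qed
    have high: "Lq_norm_dt q {0<..1} (\<lambda>t. Lp_norm p (\<lambda>x. complex_of_real (t powr (- \<alpha> x)) * conv_dist (dilate t \<phi>) f x))
        \<le> ennreal C3 * (A + X)"
      unfolding X_def
    proof (rule B3[OF Hm])
      fix t :: real assume t: "0 < t" "t \<le> 1"
      show "Lp_norm p (\<lambda>x. complex_of_real (t powr (- \<alpha> x)) * conv_dist (dilate t \<phi>) f x) \<le>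
        ennreal C2 * ((if 1 / 4 \<le> t then A else 0) + (\<integral>\<^sup>+\<tau>\<in>{t / 4..min 1 (4 * t)}. H \<tau> * ennreal (1 / \<tau>) \<partial>lborel))"
        unfolding A_def H_def scale[OF t(1), symmetric]
      proof (rule B2[OF t _ f])
        fix \<xi> :: 'a
        show "Fourier \<phi> (t *\<^sub>R \<xi>) = Fourier \<phi> (t *\<^sub>R \<xi>) * ((if 1 / 4 \<le> t then Fourier \<Psi> \<xi> else 0) +
          (LINT \<tau>:{t / 4..min 1 (4 * t)}|lborel. Fourier \<psi> (\<tau> *\<^sub>R \<xi>) / complex_of_real \<tau>))"
        proof (cases "1 / 2 < t * norm \<xi> \<and> t * norm \<xi> < 2")
          case True
          \<comment> \<open>For \<open>t < 1 / 4\<close> the condition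
            \<open>1 / 2 < t * norm \<xi>\<close> forces \<open>norm \<xi> > 2\<close>, outside the
            support of \<open>Fourier \<Psi>\<close>.\<close>
          have "(if 1 / 4 \<le> t then Fourier \<Psi> \<xi> else 0) = Fourier \<Psi> \<xi>"
          proof (cases "1 / 4 \<le> t")
            case False
            have "2 \<le> norm \<xi>"
            proof (rule ccontr)
              assume "\<not> 2 \<le> norm \<xi>"
              then have "t * norm \<xi> \<le> 1 / 4 * 2" using False t by (intro mult_mono) auto
              with True show False by simp
            qed
            then show ?thesis using supp3[of \<xi>] by simp
          qed simp
          then show ?thesis using localise[of t \<xi>] one[of \<xi>] True t by simp
        next
          case False
          then show ?thesis using supp2[of "t *\<^sub>R \<xi>"] t by (auto simp: not_less)
        qed
      qed
    qed
    have "Besov_norm \<Phi> \<phi> \<alpha> p q f \<le> ennreal C1 * (A + ennreal C3 * X) + ennreal C3 * (A + X)"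
      unfolding Besov_norm_def by (intro add_mono low high)
    also have "\<dots> \<le> ennreal C1 * ((A + X) + ennreal C3 * (A + X)) + ennreal C3 * (A + X)"
      by (intro add_mono mult_left_mono) auto
    also have "\<dots> = (ennreal C1 * (1 + ennreal C3) + ennreal C3) * (A + X)"
      by (simp only: distrib_left distrib_right mult_1 mult.assoc add_ac)
    also have "ennreal C1 * (1 + ennreal C3) + ennreal C3 = ennreal C"
      unfolding C_def using C120 C30 by (simp add: ennreal_mult)
    finally show ?thesis unfolding Besov_norm_def X A_def .
  qed
  then show ?thesis using C by blast
qed

theorem theorem1:
  fixes \<Phi> \<phi> \<Psi> \<psi> :: "'a::euclidean_space \<Rightarrow> complex"
    and p \<alpha> :: "'a \<Rightarrow> real"
    and q :: "real \<Rightarrow> real"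
  assumes "resolution_of_unity \<Phi> \<phi>" and "resolution_of_unity \<Psi> \<psi>"
    and "p \<in> log_exponents"
    and "\<alpha> \<in> Clog_loc"
    and "q \<in> var_exponents" and "log_Hoelder_at_0 q"
  shows "\<exists>c>0. \<exists>C>0. \<forall>f\<in>tempered_distributions.
           ennreal c * Besov_norm \<Phi> \<phi> \<alpha> p q f \<le> Besov_norm \<Psi> \<psi> \<alpha> p q f \<and>
           Besov_norm \<Psi> \<psi> \<alpha> p q f \<le> ennreal C * Besov_norm \<Phi> \<phi> \<alpha> p q f"
proof -
  obtain c where c: "0 < c" "\<And>f. f \<in> tempered_distributions \<Longrightarrow> Besov_norm \<Phi> \<phi> \<alpha> p q f \<le> ennreal c * Besov_norm \<Psi> \<psi> \<alpha> p q f"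
    using Besov_norm_le[OF assms] by blast
  obtain C where C: "0 < C" "\<And>f. f \<in> tempered_distributions \<Longrightarrow> Besov_norm \<Psi> \<psi> \<alpha> p q f \<le> ennreal C * Besov_norm \<Phi> \<phi> \<alpha> p q f"
    using Besov_norm_le[OF assms(2,1) assms(3-)] by blast
  have "ennreal (1 / c) * Besov_norm \<Phi> \<phi> \<alpha> p q f \<le> Besov_norm \<Psi> \<psi> \<alpha> p q f" if "f \<in> tempered_distributions" for f
  proof -
    have "ennreal (1 / c) * Besov_norm \<Phi> \<phi> \<alpha> p q f \<le> ennreal (1 / c) * (ennreal c * Besov_norm \<Psi> \<psi> \<alpha> p q f)"
      by (intro mult_left_mono c that) simp
    also have "\<dots> = Besov_norm \<Psi> \<psi> \<alpha> p q f"
      using c(1) by (simp add: mult.assoc[symmetric] flip: ennreal_mult)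
    finally show ?thesis .
  qed
  moreover have "0 < 1 / c" using c(1) by simp
  ultimately show ?thesis using C by blast
qed

end
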